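(* Let $n\in\mathbb{Z}$. There exist at least countably many (i.e. infinitely many) non-constant elements $f\in\mathrm{Pol}(B_0)\subseteq\mathcal{A}(\mathbb{C}\mathrm{P}_q^1)$ for which there exists a nonzero scalar $\alpha\in\mathbb{C}^\times$ such that the holomorphic structures $\overline{\nabla}^{(n)}_{\overline\partial f}$ and $\overline{\nabla}^{(n)}_{\overline\partial(\alpha f)}$ on $\mathcal{L}_n$ are not gauge equivalent.
   Context: Fix a real number $0<q<1$. $\mathcal{A}(SU_q(2))$ is the unital $*$-algebra generated by $a,c$ with relations $ac=qca$, $ac^*=qc^*a$, $cc^*=c^*c$, $a^*a+c^*c=1$, $aa^*+q^2cc^*=1$; $C(SU_q(2))$ is the corresponding universal $C^*$-algebra, and $L^2(SU_q(2))$ its GNS space for the Haar state $\mathsf{h}$, with inner product $\langle x,y\rangle=\mathsf{h}(x^*y)$. $K\triangleright$ denotes the algebra automorphism of $\mathcal{A}(SU_q(2))$ with $K\triangleright a=q^{-1/2}a$, $K\triangleright c=q^{-1/2}c$, $K\triangleright a^*=q^{1/2}a^*$, $K\triangleright c^*=q^{1/2}c^*$ (with inverse $K^{-1}\triangleright$), and $F\triangleright$ is the linear map with $F\triangleright 1=F\triangleright a=F\triangleright c=0$, $F\triangleright a^*=c$, $F\triangleright c^*=-q^{-1}a$ and $F\triangleright(xy)=(F\triangleright x)(K\triangleright y)+(K^{-1}\triangleright x)(F\triangleright y)$. For $n\in\mathbb{Z}$ put $\mathcal{L}_n=\{x\in\mathcal{A}(SU_q(2)):K\triangleright x=q^{n/2}x\}$;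 one has $F\triangleright\mathcal{L}_n\subseteq\mathcal{L}_{n-2}$. $\mathcal{A}(\mathbb{C}\mathrm{P}_q^1):=\mathcal{L}_0$, and $C(\mathbb{C}\mathrm{P}_q^1)$ is its norm closure in $C(SU_q(2))$. $B_0:=cc^*\in\mathcal{A}(\mathbb{C}\mathrm{P}_q^1)$, and $\mathrm{Pol}(B_0)$ is the unital algebra of polynomials in $B_0$. $H_\pm$ is the closure of $\mathcal{L}_{\pm1}$ in $L^2(SU_q(2))$; $C(\mathbb{C}\mathrm{P}_q^1)$ acts on $H_+$ and $H_-$ by left multiplication (representations $\pi_\pm$). For $f\in\mathcal{A}(\mathbb{C}\mathrm{P}_q^1)$, $\overline\partial f\in\mathcal{B}(H_+,H_-)$ is the bounded extension of left multiplication by $q^{-1/2}(F\triangleright f)\in\mathcal{L}_{-2}$ (up to a fixed unimodular scalar, which plays no role). Products $xT$, $Tx$ of $T\in\mathcal{B}(H_+,H_-)$ with $x\in C(\mathbb{C}\mathrm{P}_q^1)$ mean $\pi_-(x)T$, $T\pi_+(x)$; with this, $\overline\partial$ is a closable derivation. $\mathscr{D}\subseteq C(\mathbb{C}\mathrm{P}_q^1)$ is the domain of its closure, still denoted $\overline\partial$: $x\in\mathscr{D}$ iff there are $x_k\in\mathcal{A}(\mathbb{C}\mathrm{P}_q^1)$ with $x_k\to x$ in $C^*$-norm and $\overline\partial x_k$ convergent in operator norm (to $\overline\partial x$). With the graph norm $\|x\|_{\mathrm{Gr}}=\|x\|_{C(\mathbb{C}\mathrm{P}_q^1)}+\|\overline\partial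 x\|_{\mathrm{op}}$, $\mathscr{D}$ is a unital Banach algebra; "invertible in $\mathscr{D}$" means the inverse lies in $\mathscr{D}$. Holomorphic structures: $\Omega^{0,1}(\mathbb{C}\mathrm{P}_q^1)=\mathcal{L}_{-2}\,\omega_-$ with $\omega_-=c^*da^*-qa^*dc^*$ is the bimodule of $(0,1)$-forms, with differential $\overline\partial f=(X_-\triangleright f)\omega_-$, $X_-=q^{-1/2}FK$. The standard holomorphic structure on $\mathcal{L}_n$ is the flat $\overline\partial$-connection $\overline\nabla^{(n)}_0\phi=q^{-n+2}\omega_-(X_-\triangleright\phi)$. For $f\in\mathcal{A}(\mathbb{C}\mathrm{P}_q^1)$, $\overline\nabla^{(n)}_{\overline\partial f}(s)=\overline\nabla^{(n)}_0(s)-\Phi_{(n)}(s\otimes\overline\partial f)$, where $\Phi_{(n)}:\mathcal{L}_n\otimes_{\mathcal{A}(\mathbb{C}\mathrm{P}_q^1)}\Omega^{0,1}\to\Omega^{0,1}\otimes_{\mathcal{A}(\mathbb{C}\mathrm{P}_q^1)}\mathcal{L}_n$ is the bimodule isomorphism (twisted flip) with $\overline\nabla^{(n)}_0(sx)=\overline\nabla^{(n)}_0(s)x+\Phi_{(n)}(s\otimes\overline\partial x)$. By definition, $\overline\nabla^{(n)}_{\overline\partial f}$ and $\overline\nabla^{(n)}_{\overline\partial h}$ are gauge equivalent if the mixed gauge equation $\overline\partial g=g\,\overline\partial f-\overline\partial h\cdot g$ has a solution $g\in\mathscr{D}$ that is invertible in $\mathscr{D}$. *)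

theory Defs
  imports Complex_Main "HOL-Library.Poly_Mapping" "HOL-Library.Product_Plus"
    "HOL-Library.FuncSet"
begin

(* Words form a monoid under concatenation, written additively so that the convolution
   product of Poly_Mapping on 'g list =>0 complex is the product of the free algebra on 'g. *)
instantiation list :: (type) monoid_add
begin
definition zero_list :: "'a list" where "zero_list = []"
definition plus_list :: "'a list \<Rightarrow> 'a list \<Rightarrow> 'a list" where "plus_list xs ys = xs @ ys"
instance by standard (simp_all add: zero_list_def plus_list_def)
end


section \<open>The free *-algebra on two generators\<close>

datatype gen = LA | LC | LAs | LCs   (* the letters a, c, a^*, c^* *)

type_synonym word = "gen list"
type_synonym free = "word \<Rightarrow>\<^sub>0 complex"

(* The free algebra tensored with itself, as the algebra of the product monoid. *)
type_synonym free2 = "(word \<times> word) \<Rightarrow>\<^sub>0 complex"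

definition cscale :: "complex \<Rightarrow> ('m::monoid_add \<Rightarrow>\<^sub>0 complex) \<Rightarrow> ('m \<Rightarrow>\<^sub>0 complex)" where
  "cscale z x = Poly_Mapping.single 0 z * x"

definition letter :: "gen \<Rightarrow> free" where
  "letter g = Poly_Mapping.single [g] 1"

abbreviation "ga \<equiv> letter LA"
abbreviation "gc \<equiv> letter LC"
abbreviation "gas \<equiv> letter LAs"
abbreviation "gcs \<equiv> letter LCs"

fun adj :: "gen \<Rightarrow> gen" where
  "adj LA = LAs" | "adj LC = LCs" | "adj LAs = LA" | "adj LCs = LC"

definition star :: "free \<Rightarrow> free" where
  "star x = (\<Sum>w\<in>Poly_Mapping.keys x.
     Poly_Mapping.single (rev (map adj w)) (cnj (Poly_Mapping.lookup x w)))"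

definition lin_ext :: "(word \<Rightarrow> ('m::monoid_add \<Rightarrow>\<^sub>0 complex)) \<Rightarrow> free \<Rightarrow> ('m \<Rightarrow>\<^sub>0 complex)" where
  "lin_ext f x = (\<Sum>w\<in>Poly_Mapping.keys x. cscale (Poly_Mapping.lookup x w) (f w))"

definition alg_ext :: "(gen \<Rightarrow> ('m::monoid_add \<Rightarrow>\<^sub>0 complex)) \<Rightarrow> free \<Rightarrow> ('m \<Rightarrow>\<^sub>0 complex)" where
  "alg_ext f = lin_ext (\<lambda>w. prod_list (map f w))"


section \<open>The *-algebra of $SU_q(2)$\<close>

(* An element of the coordinate algebra A(SU_q(2)) is a coset, in the free *-algebra, of the
   *-ideal generated by the relators.  Operations are defined on representatives in the free
   algebra, equality in A(SU_q(2)) is equality of suq_class, that is, congruence modulo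
   suq_ideal. *)

definition relators :: "real \<Rightarrow> free set" where
  "relators q =
    {ga * gc - cscale q (gc * ga),
     ga * gcs - cscale q (gcs * ga),
     gc * gcs - gcs * gc,
     gas * ga + gcs * gc - 1,
     ga * gas + cscale (q\<^sup>2) (gc * gcs) - 1}"

inductive_set suq_ideal :: "real \<Rightarrow> free set" for q where
  zero: "0 \<in> suq_ideal q"
| relator: "r \<in> relators q \<union> star ` relators q \<Longrightarrow> x * r * y \<in> suq_ideal q"
| add: "u \<in> suq_ideal q \<Longrightarrow> v \<in> suq_ideal q \<Longrightarrow> u + v \<in> suq_ideal q"

definition suq_class :: "real \<Rightarrow> free \<Rightarrow> free set" where
  "suq_class q x = {y. y - x \<in> suq_ideal q}"

fun K_gen :: "real \<Rightarrow> gen \<Rightarrow> free" where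
  "K_gen q LA = cscale (q powr (-1/2)) ga"
| "K_gen q LC = cscale (q powr (-1/2)) gc"
| "K_gen q LAs = cscale (q powr (1/2)) gas"
| "K_gen q LCs = cscale (q powr (1/2)) gcs"

fun Kinv_gen :: "real \<Rightarrow> gen \<Rightarrow> free" where
  "Kinv_gen q LA = cscale (q powr (1/2)) ga"
| "Kinv_gen q LC = cscale (q powr (1/2)) gc"
| "Kinv_gen q LAs = cscale (q powr (-1/2)) gas"
| "Kinv_gen q LCs = cscale (q powr (-1/2)) gcs"

fun F_gen :: "real \<Rightarrow> gen \<Rightarrow> free" where
  "F_gen q LA = 0"
| "F_gen q LC = 0"
| "F_gen q LAs = gc"
| "F_gen q LCs = - cscale (1 / q) ga"

definition K_act :: "real \<Rightarrow> free \<Rightarrow> free" where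
  "K_act q = alg_ext (K_gen q)"

definition Kinv_act :: "real \<Rightarrow> free \<Rightarrow> free" where
  "Kinv_act q = alg_ext (Kinv_gen q)"

(* The twisted Leibniz rule for the product of a letter and a word determines F. *)
primrec F_word :: "real \<Rightarrow> word \<Rightarrow> free" where
  "F_word q [] = 0"
| "F_word q (g # w) =
     F_gen q g * K_act q (Poly_Mapping.single w 1) + Kinv_act q (letter g) * F_word q w"

definition F_act :: "real \<Rightarrow> free \<Rightarrow> free" where
  "F_act q = lin_ext (F_word q)"

definition line_module :: "real \<Rightarrow> int \<Rightarrow> free set" where
  "line_module q n =
     {x. suq_class q (K_act q x) = suq_class q (cscale (q powr (real_of_int n / 2)) x)}"

abbreviation A_CP :: "real \<Rightarrow> free set" where
  "A_CP q \<equiv> line_module q 0"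

definition B0 :: free where
  "B0 = gc * gcs"

definition Pol_B0 :: "free set" where
  "Pol_B0 = {\<Sum>i\<le>d. cscale (u i) (B0 ^ i) | (d::nat) (u :: nat \<Rightarrow> complex). True}"


section \<open>Haar state\<close>

(* The entries of the fundamental unitary corepresentation (a, -q c^*; c, a^* ) are comultiplied
   as matrix coefficients, which fixes the coproduct of SU_q(2). *)
fun coproduct_gen :: "real \<Rightarrow> gen \<Rightarrow> free2" where
  "coproduct_gen q LA =
     Poly_Mapping.single ([LA], [LA]) 1 - cscale q (Poly_Mapping.single ([LCs], [LC]) 1)"
| "coproduct_gen q LC =
     Poly_Mapping.single ([LC], [LA]) 1 + Poly_Mapping.single ([LAs], [LC]) 1"
| "coproduct_gen q LAs =
     Poly_Mapping.single ([LAs], [LAs]) 1 - cscale q (Poly_Mapping.single ([LC], [LCs]) 1)"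
| "coproduct_gen q LCs =
     Poly_Mapping.single ([LCs], [LAs]) 1 + Poly_Mapping.single ([LA], [LCs]) 1"

definition coproduct :: "real \<Rightarrow> free \<Rightarrow> free2" where
  "coproduct q = alg_ext (coproduct_gen q)"

definition slice_right :: "(free \<Rightarrow> complex) \<Rightarrow> free2 \<Rightarrow> free" where   (* id tensor h *)
  "slice_right h t = (\<Sum>p\<in>Poly_Mapping.keys t.
     Poly_Mapping.single (fst p) (Poly_Mapping.lookup t p * h (Poly_Mapping.single (snd p) 1)))"

definition slice_left :: "(free \<Rightarrow> complex) \<Rightarrow> free2 \<Rightarrow> free" where   (* h tensor id *)
  "slice_left h t = (\<Sum>p\<in>Poly_Mapping.keys t.
     Poly_Mapping.single (snd p) (Poly_Mapping.lookup t p * h (Poly_Mapping.single (fst p) 1)))"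

(* The Haar state is the unique bi-invariant state; the third clause makes h a functional on
   A(SU_q(2)). *)
definition haar_state :: "real \<Rightarrow> (free \<Rightarrow> complex) \<Rightarrow> bool" where
  "haar_state q h \<longleftrightarrow>
     (\<forall>x y. h (x + y) = h x + h y) \<and>
     (\<forall>z x. h (cscale z x) = z * h x) \<and>
     (\<forall>x\<in>suq_ideal q. h x = 0) \<and>
     h 1 = 1 \<and>
     (\<forall>x. h (star x * x) \<in> \<real> \<and> 0 \<le> Re (h (star x * x))) \<and>
     (\<forall>x. suq_class q (slice_right h (coproduct q x)) = suq_class q (cscale (h x) 1)) \<and>
     (\<forall>x. suq_class q (slice_left h (coproduct q x)) = suq_class q (cscale (h x) 1))"


section \<open>Norms and completions\<close>

definition cstar_seminorm :: "real \<Rightarrow> (free \<Rightarrow> real) \<Rightarrow> bool" where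
  "cstar_seminorm q p \<longleftrightarrow>
     (\<forall>x y. p (x + y) \<le> p x + p y) \<and>
     (\<forall>z x. p (cscale z x) = cmod z * p x) \<and>
     (\<forall>x y. p (x * y) \<le> p x * p y) \<and>
     (\<forall>x. p (star x * x) = (p x)\<^sup>2) \<and>
     (\<forall>x\<in>suq_ideal q. p x = 0)"

(* The norm of the universal C*-algebra C(SU_q(2)): the largest C*-seminorm on A(SU_q(2)). *)
definition univ_norm :: "real \<Rightarrow> free \<Rightarrow> real" where
  "univ_norm q x = (SUP p\<in>Collect (cstar_seminorm q). p x)"

(* The norm of L^2(SU_q(2)), from the inner product h(x^* y). *)
definition l2_norm :: "(free \<Rightarrow> complex) \<Rightarrow> free \<Rightarrow> real" where
  "l2_norm h x = sqrt (Re (h (star x * x)))"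

(* Separated completion for a seminorm p: a point is an equivalence class of p-Cauchy sequences.
   For a subspace V, completion p V is the closure of the image of V in completion p UNIV. *)
definition sn_cauchy :: "(free \<Rightarrow> real) \<Rightarrow> (nat \<Rightarrow> free) \<Rightarrow> bool" where
  "sn_cauchy p X \<longleftrightarrow> (\<forall>e>0. \<exists>N. \<forall>m\<ge>N. \<forall>n\<ge>N. p (X m - X n) < e)"

definition sn_class :: "(free \<Rightarrow> real) \<Rightarrow> (nat \<Rightarrow> free) \<Rightarrow> (nat \<Rightarrow> free) set" where
  "sn_class p X = {Y. sn_cauchy p Y \<and> (\<lambda>k. p (X k - Y k)) \<longlonglongrightarrow> 0}"

definition completion :: "(free \<Rightarrow> real) \<Rightarrow> free set \<Rightarrow> (nat \<Rightarrow> free) set set" where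
  "completion p V = {sn_class p X | X. range X \<subseteq> V \<and> sn_cauchy p X}"

type_synonym point = "(nat \<Rightarrow> free) set"

definition emb :: "(free \<Rightarrow> real) \<Rightarrow> free \<Rightarrow> point" where
  "emb p x = sn_class p (\<lambda>_. x)"

definition sn_dist :: "(free \<Rightarrow> real) \<Rightarrow> point \<Rightarrow> point \<Rightarrow> real" where
  "sn_dist p \<xi> \<eta> = (THE d. \<exists>X\<in>\<xi>. \<exists>Y\<in>\<eta>. (\<lambda>k. p (X k - Y k)) \<longlonglongrightarrow> d)"

definition sn_norm :: "(free \<Rightarrow> real) \<Rightarrow> point \<Rightarrow> real" where
  "sn_norm p \<xi> = sn_dist p \<xi> (emb p 0)"

(* Continuous extensions of maps on representatives.  The unions are over representatives of
   the arguments, all of which yield the same class. *)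
definition lift1 :: "(free \<Rightarrow> real) \<Rightarrow> (free \<Rightarrow> free) \<Rightarrow> point \<Rightarrow> point" where
  "lift1 p f \<xi> = (\<Union>X\<in>\<xi>. sn_class p (\<lambda>k. f (X k)))"

definition lift2 :: "(free \<Rightarrow> real) \<Rightarrow> (free \<Rightarrow> free \<Rightarrow> free) \<Rightarrow> point \<Rightarrow> point \<Rightarrow> point" where
  "lift2 p f \<xi> \<eta> = (\<Union>X\<in>\<xi>. \<Union>Y\<in>\<eta>. sn_class p (\<lambda>k. f (X k) (Y k)))"

definition C_CP :: "real \<Rightarrow> point set" where
  "C_CP q = completion (univ_norm q) (A_CP q)"

definition C_mult :: "real \<Rightarrow> point \<Rightarrow> point \<Rightarrow> point" where
  "C_mult q = lift2 (univ_norm q) (*)"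

definition H_plus :: "real \<Rightarrow> (free \<Rightarrow> complex) \<Rightarrow> point set" where
  "H_plus q h = completion (l2_norm h) (line_module q 1)"

definition H_minus :: "real \<Rightarrow> (free \<Rightarrow> complex) \<Rightarrow> point set" where
  "H_minus q h = completion (l2_norm h) (line_module q (-1))"

(* The action of C(CP) by left multiplication; it restricts to pi_+ on H_+ and pi_- on H_-. *)
definition C_act :: "(free \<Rightarrow> complex) \<Rightarrow> point \<Rightarrow> point \<Rightarrow> point" where
  "C_act h = lift2 (l2_norm h) (*)"

definition H_minus_diff :: "(free \<Rightarrow> complex) \<Rightarrow> point \<Rightarrow> point \<Rightarrow> point" where
  "H_minus_diff h = lift2 (l2_norm h) (-)"

(* Only the values on H_+ are relevant. *)
definition bounded_ops :: "real \<Rightarrow> (free \<Rightarrow> complex) \<Rightarrow> (point \<Rightarrow> point) set" where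
  "bounded_ops q h = {T.
     (\<forall>\<xi>\<in>H_plus q h. T \<xi> \<in> H_minus q h) \<and>
     (\<forall>\<xi>\<in>H_plus q h. \<forall>\<eta>\<in>H_plus q h.
        T (lift2 (l2_norm h) (+) \<xi> \<eta>) = lift2 (l2_norm h) (+) (T \<xi>) (T \<eta>)) \<and>
     (\<forall>z. \<forall>\<xi>\<in>H_plus q h.
        T (lift1 (l2_norm h) (cscale z) \<xi>) = lift1 (l2_norm h) (cscale z) (T \<xi>)) \<and>
     (\<exists>M. \<forall>\<xi>\<in>H_plus q h. sn_norm (l2_norm h) (T \<xi>) \<le> M * sn_norm (l2_norm h) \<xi>)}"

definition op_tendsto ::
  "real \<Rightarrow> (free \<Rightarrow> complex) \<Rightarrow> (nat \<Rightarrow> point \<Rightarrow> point) \<Rightarrow> (point \<Rightarrow> point) \<Rightarrow> bool" where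
  "op_tendsto q h S T \<longleftrightarrow> (\<forall>e>0. \<forall>\<^sub>F k in sequentially. \<forall>\<xi>\<in>H_plus q h.
     sn_dist (l2_norm h) (S k \<xi>) (T \<xi>) \<le> e * sn_norm (l2_norm h) \<xi>)"


section \<open>The closed derivation and gauge equivalence\<close>

definition dbar :: "real \<Rightarrow> (free \<Rightarrow> complex) \<Rightarrow> free \<Rightarrow> point \<Rightarrow> point" where
  "dbar q h f = lift1 (l2_norm h) (\<lambda>x. cscale (q powr (-1/2)) (F_act q f) * x)"

(* x is in the domain of the closure of dbar, and the closure maps x to T. *)
definition dbar_closure :: "real \<Rightarrow> (free \<Rightarrow> complex) \<Rightarrow> point \<Rightarrow> (point \<Rightarrow> point) \<Rightarrow> bool" where
  "dbar_closure q h x T \<longleftrightarrow> x \<in> C_CP q \<and> T \<in> bounded_ops q h \<and>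
     (\<exists>X. range X \<subseteq> A_CP q \<and>
        (\<lambda>k. sn_dist (univ_norm q) (emb (univ_norm q) (X k)) x) \<longlonglongrightarrow> 0 \<and>
        op_tendsto q h (\<lambda>k. dbar q h (X k)) T)"

definition dbar_domain :: "real \<Rightarrow> (free \<Rightarrow> complex) \<Rightarrow> point set" where
  "dbar_domain q h = {x. \<exists>T. dbar_closure q h x T}"

definition invertible_in_domain :: "real \<Rightarrow> (free \<Rightarrow> complex) \<Rightarrow> point \<Rightarrow> bool" where
  "invertible_in_domain q h g \<longleftrightarrow> g \<in> dbar_domain q h \<and>
     (\<exists>g'\<in>dbar_domain q h. C_mult q g g' = emb (univ_norm q) 1 \<and>
                            C_mult q g' g = emb (univ_norm q) 1)"

(* The mixed gauge equation: dbar g = g (dbar f1) - (dbar f2) g. *)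
definition mixed_gauge_eq ::
  "real \<Rightarrow> (free \<Rightarrow> complex) \<Rightarrow> free \<Rightarrow> free \<Rightarrow> point \<Rightarrow> bool" where
  "mixed_gauge_eq q h f1 f2 g \<longleftrightarrow> dbar_closure q h g
     (\<lambda>\<xi>. H_minus_diff h (C_act h g (dbar q h f1 \<xi>)) (dbar q h f2 (C_act h g \<xi>)))"

definition X_minus :: "real \<Rightarrow> free \<Rightarrow> free" where
  "X_minus q x = cscale (q powr (-1/2)) (F_act q (K_act q x))"

(* Forms are given by their coefficients: y stands for y omega_- in Omega^{0,1} = L_{-2} omega_-
   and for omega_- y in Omega^{0,1} tensor L_n, identified with omega_- L_{n-2}.  In the
   calculus, omega_- y = q^m y omega_- for y in L_m, so that the twisted flip sends
   s tensor y omega_- to q^{-n+2} omega_- s y. *)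
definition nabla0 :: "real \<Rightarrow> int \<Rightarrow> free \<Rightarrow> free" where
  "nabla0 q n s = cscale (q powr real_of_int (2 - n)) (X_minus q s)"

definition twisted_flip :: "real \<Rightarrow> int \<Rightarrow> free \<Rightarrow> free \<Rightarrow> free" where
  "twisted_flip q n s y = cscale (q powr real_of_int (2 - n)) (s * y)"

(* The connection on L_n perturbed by dbar f, as a map from L_n to classes. *)
definition connection :: "real \<Rightarrow> int \<Rightarrow> free \<Rightarrow> free \<Rightarrow> free set" where
  "connection q n f = (\<lambda>s\<in>line_module q n.
     suq_class q (nabla0 q n s - twisted_flip q n s (X_minus q f)))"

definition gauge_equivalent ::
  "real \<Rightarrow> (free \<Rightarrow> complex) \<Rightarrow> int \<Rightarrow> (free \<Rightarrow> free set) \<Rightarrow> (free \<Rightarrow> free set) \<Rightarrow> bool" where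
  "gauge_equivalent q h n D1 D2 \<longleftrightarrow>
     (\<exists>f1\<in>A_CP q. \<exists>f2\<in>A_CP q. D1 = connection q n f1 \<and> D2 = connection q n f2 \<and>
        (\<exists>g. invertible_in_domain q h g \<and> mixed_gauge_eq q h f1 f2 g))"

definition nonconstant :: "real \<Rightarrow> free \<Rightarrow> bool" where
  "nonconstant q f \<longleftrightarrow> (\<forall>z. suq_class q f \<noteq> suq_class q (cscale z 1))"

end

(*
  On A_CP the map F is, up to a scalar, the commutator with u = gcs^(-1) ga, so for f = B0^m the
  gauge equation reads (u + alpha [u,f]) g = g (u + [u,f]).  On the eigenbasis e_0, e_1, ... of B0
  (eigenvalues q^(2k)), u + t [u,f] is a weighted shift e_k -> e_(k-1) whose k-th weight is
  proportional to 1 - t q^(2m(k-1)) (1 - q^(2m)).  For alpha = 1 / (1 - q^(2m)) the weight of the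
  left-hand operator vanishes at k = 1, whereas all weights of the right-hand operator are nonzero.
  Hence the row of index 0 of g vanishes and g is not invertible.  Instead of basis vectors the
  argument uses the projection onto the eigenvalue 1 of B0, which is the limit of the powers of B0;
  it is nonzero because h(B0^M) = (1 - q^2) / (1 - q^(2M+2)) is bounded below.
*)
theory Submission
  imports Defs
begin

text \<open>\<open>gcs\<close> has no inverse in the algebra (its counit is 0), so the commutator
  with \<open>u\<close> is only used after multiplication by \<open>gcs\<close> on both sides. The
  row of index 0 is therefore read off with \<open>P0\<close>, which does not change under
  multiplication by \<open>gcs\<close> on the left. A second obstacle is that \<open>g\<close> lies
  only in a completion. It is replaced by some \<open>x\<close> in \<open>A_CP q\<close> that
  satisfies the gauge equation up to a small defect, and its inverse by some \<open>x'\<close>. The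
  operator \<open>(1 - mu f) ga gas\<close> that remains on the right is inverted approximately by a
  Neumann polynomial \<open>R\<close>. The norms of \<open>x\<close> and \<open>x'\<close> must be
  bounded independently of the accuracy, because the accuracy is chosen after \<open>R\<close> and
  \<open>R\<close> depends on that bound. The argument is run on \<open>gc\<close>: it has degree
  -1, which puts the test elements into the domain of the estimate, and
  \<open>P0 gc = P0 1\<close>.\<close>

section \<open>Sums over the support of a finitely supported function\<close>

lemma poly_mapping_single_induct:
  assumes "P 0" and "\<And>k v. P (Poly_Mapping.single k v)"
    and "\<And>x y. P x \<Longrightarrow> P y \<Longrightarrow> P (x + y)"
  shows "P (x :: 'a \<Rightarrow>\<^sub>0 'b::comm_monoid_add)"
proof -
  have "P (\<Sum>k\<in>A. Poly_Mapping.single k (Poly_Mapping.lookup x k))" if "finite A" for A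
    using that by induction (auto intro: assms)
  then have "P (\<Sum>k\<in>Poly_Mapping.keys x. Poly_Mapping.single k (Poly_Mapping.lookup x k))"
    by simp
  also have "(\<Sum>k\<in>Poly_Mapping.keys x. Poly_Mapping.single k (Poly_Mapping.lookup x k)) = x"
    by (rule poly_mapping_eqI)
       (auto simp: lookup_sum lookup_single when_def not_in_keys_iff_lookup_eq_zero)
  finally show ?thesis .
qed

text \<open>Cancellation can make the support of a sum smaller than the union of the supports, so
  all three sums are taken over that union, where the extra terms vanish. This is the common source
  of additivity for \<open>star\<close>, \<open>lin_ext\<close>, the slice maps and
  \<open>counit\<close>.\<close>

lemma sum_keys_add:
  fixes G :: "'a \<Rightarrow> 'b::ab_group_add \<Rightarrow> 'c::comm_monoid_add"
  assumes "\<And>w. G w 0 = 0" and "\<And>w a b. G w (a + b) = G w a + G w b"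
  shows "(\<Sum>w\<in>Poly_Mapping.keys (x + y). G w (Poly_Mapping.lookup (x + y) w)) =
    (\<Sum>w\<in>Poly_Mapping.keys x. G w (Poly_Mapping.lookup x w)) +
    (\<Sum>w\<in>Poly_Mapping.keys y. G w (Poly_Mapping.lookup y w))"
proof -
  define S where "S = Poly_Mapping.keys x \<union> Poly_Mapping.keys y"
  have extend: "(\<Sum>w\<in>Poly_Mapping.keys z. G w (Poly_Mapping.lookup z w)) =
      (\<Sum>w\<in>S. G w (Poly_Mapping.lookup z w))" if "Poly_Mapping.keys z \<subseteq> S" for z
    using that by (intro sum.mono_neutral_left)
      (auto simp: S_def assms(1) not_in_keys_iff_lookup_eq_zero)
  show ?thesis
    using keys_add[of x y]
    by (subst (1 2 3) extend) (auto simp: S_def lookup_add assms(2) sum.distrib)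
qed

lemma sum_keys_single:
  assumes "G w 0 = 0"
  shows "(\<Sum>u\<in>Poly_Mapping.keys (Poly_Mapping.single w z). G u (Poly_Mapping.lookup (Poly_Mapping.single w z) u))
    = G w z"
  using assms by (cases "z = 0") auto


section \<open>Scalars and monomials\<close>

lemma lookup_cscale [simp]: "Poly_Mapping.lookup (cscale z x) w = z * Poly_Mapping.lookup x w"
proof -
  have "cscale z x = Poly_Mapping.map ((*) z) x"
    by (simp add: cscale_def mult_map_scale_conv_mult)
  then show ?thesis
    by (simp add: Poly_Mapping.map.rep_eq when_def)
qed

lemma cscale_single: "cscale z (Poly_Mapping.single w u) = Poly_Mapping.single w (z * u)"
  by (simp add: cscale_def mult_single)

lemma cscale_add_right: "cscale z (x + y) = cscale z x + cscale z y"
  by (simp add: cscale_def algebra_simps)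

lemma cscale_diff_right: "cscale z (x - y) = cscale z x - cscale z y"
  by (simp add: cscale_def algebra_simps)

lemma cscale_minus_right: "cscale z (- x) = - cscale z x"
  by (simp add: cscale_def)

lemma cscale_add_left: "cscale (z + w) x = cscale z x + cscale w x"
  by (simp add: cscale_def algebra_simps single_add)

lemma cscale_diff_left: "cscale (z - w) x = cscale z x - cscale w x"
  by (simp add: cscale_def algebra_simps single_diff)

lemma cscale_minus_left: "cscale (- z) x = - cscale z x"
  by (simp add: cscale_def single_uminus)

lemma cscale_one [simp]: "cscale 1 x = x"
  by (simp add: cscale_def)

lemma cscale_zero_left [simp]: "cscale 0 x = 0"
  by (simp add: cscale_def)

lemma cscale_zero_right [simp]: "cscale z 0 = 0"
  by (simp add: cscale_def)

lemma cscale_cscale [simp]: "cscale z (cscale w x) = cscale (z * w) x"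
  by (rule poly_mapping_eqI) simp

lemma cscale_mult_left [simp]: "cscale z x * y = cscale z (x * y)"
  by (simp add: cscale_def mult.assoc)

lemma single_zero_central:
  "x * Poly_Mapping.single 0 z = Poly_Mapping.single 0 z * (x :: 'm::monoid_add \<Rightarrow>\<^sub>0 complex)"
proof (induction x rule: poly_mapping_single_induct)
  case (2 k v)
  then show ?case by (simp add: mult_single mult.commute)
qed (simp_all add: algebra_simps)

lemma cscale_mult_right [simp]: "x * cscale z y = cscale z (x * y)"
  by (simp add: cscale_def single_zero_central mult.assoc flip: single_zero_central mult.assoc)
     (simp add: mult.assoc single_zero_central)

lemma cscale_sum: "cscale z (\<Sum>i\<in>A. f i) = (\<Sum>i\<in>A. cscale z (f i))"
  by (simp add: cscale_def sum_distrib_left)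

lemma cscale_uminus_one: "cscale (- 1) x = - x"
  by (simp add: cscale_minus_left)

lemmas cscale_distribs = cscale_add_right cscale_diff_right cscale_minus_right

abbreviation monomial :: "'m::monoid_add \<Rightarrow> ('m \<Rightarrow>\<^sub>0 complex)" where
  "monomial w \<equiv> Poly_Mapping.single w 1"

lemma monomial_Nil [simp]: "monomial ([] :: 'g list) = 1"
  by (simp flip: zero_list_def)

lemma monomial_Cons: "monomial (g # w) = letter g * monomial w"
  by (simp add: letter_def mult_single plus_list_def)

text \<open>Words grow from the left, as in the recursion of \<open>F_word\<close>; a rule for
  products thus reduces to multiplication by one letter.\<close>

lemma free_induct [case_names one letter cscale add]:
  assumes "P 1" and "\<And>g x. P x \<Longrightarrow> P (letter g * x)"
    and "\<And>z x. P x \<Longrightarrow> P (cscale z x)"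
    and "\<And>x y. P x \<Longrightarrow> P y \<Longrightarrow> P (x + y)"
  shows "P (x :: free)"
proof (induction x rule: poly_mapping_single_induct)
  case 1
  show ?case using assms(3)[of 1 0] assms(1) by simp
next
  case (2 w v)
  have "P (monomial w)"
  proof (induction w)
    case (Cons g w)
    then show ?case using assms(2) by (simp add: monomial_Cons)
  qed (simp add: assms(1))
  then show ?case using assms(3)[of "monomial w" v] by (simp add: cscale_single)
qed (rule assms(4))


section \<open>Linear extensions\<close>

lemma lin_ext_add: "lin_ext f (x + y) = lin_ext f x + lin_ext f y"
  unfolding lin_ext_def by (rule sum_keys_add) (simp_all add: cscale_add_left)

lemma lin_ext_single: "lin_ext f (Poly_Mapping.single w z) = cscale z (f w)"
  unfolding lin_ext_def by (rule sum_keys_single) simp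

lemma lin_ext_0 [simp]: "lin_ext f 0 = 0"
  by (simp add: lin_ext_def)

lemma lin_ext_cscale: "lin_ext f (cscale z x) = cscale z (lin_ext f x)"
  by (induction x rule: poly_mapping_single_induct)
     (simp_all add: cscale_single lin_ext_single lin_ext_add cscale_add_right)

lemma lin_ext_monomial: "lin_ext f (monomial w) = f w"
  by (simp add: lin_ext_single)

lemma alg_ext_1 [simp]: "alg_ext f 1 = 1"
  unfolding alg_ext_def monomial_Nil[symmetric] lin_ext_monomial by simp

lemma alg_ext_0 [simp]: "alg_ext f 0 = 0"
  by (simp add: alg_ext_def)

lemma alg_ext_add: "alg_ext f (x + y) = alg_ext f x + alg_ext f y"
  by (simp add: alg_ext_def lin_ext_add)

lemma alg_ext_cscale: "alg_ext f (cscale z x) = cscale z (alg_ext f x)"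
  by (simp add: alg_ext_def lin_ext_cscale)

lemma alg_ext_letter: "alg_ext f (letter g) = f g"
  by (simp add: alg_ext_def letter_def lin_ext_monomial)

lemma alg_ext_letter_mult: "alg_ext f (letter g * x) = f g * alg_ext f x"
proof (induction x rule: poly_mapping_single_induct)
  case (2 w v)
  then show ?case
    by (simp add: alg_ext_def letter_def mult_single plus_list_def lin_ext_single)
qed (simp_all add: alg_ext_add distrib_left)

lemma alg_ext_mult: "alg_ext f (x * y) = alg_ext f x * alg_ext f y"
  by (induction x rule: free_induct)
     (simp_all add: alg_ext_letter_mult mult.assoc alg_ext_cscale alg_ext_add distrib_right)

lemma additive_minus:
  assumes "\<And>x y. f (x + y) = f x + f (y :: 'a::ab_group_add)"
  shows "f (- x) = - (f x :: 'b::ab_group_add)"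
  using assms[of 0 0] assms[of x "- x"] by (simp add: eq_neg_iff_add_eq_0 add.commute)

lemma additive_diff:
  assumes "\<And>x y. f (x + y) = f x + f (y :: 'a::ab_group_add)"
  shows "f (x - y) = (f x - f y :: 'b::ab_group_add)"
  using assms[of x "- y"] by (simp add: additive_minus[OF assms])


section \<open>The involution\<close>

lemma star_add: "star (x + y) = star x + star y"
  unfolding star_def by (rule sum_keys_add) (simp_all add: single_add)

lemma star_single: "star (Poly_Mapping.single w z) = Poly_Mapping.single (rev (map adj w)) (cnj z)"
  unfolding star_def by (rule sum_keys_single) simp

lemma star_0 [simp]: "star 0 = 0"
  by (simp add: star_def)

lemma star_1 [simp]: "star 1 = 1"
  using star_single[of "[]" 1] by simp

lemma star_letter: "star (letter g) = letter (adj g)"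
  by (simp add: letter_def star_single)

lemma star_cscale: "star (cscale z x) = cscale (cnj z) (star x)"
  by (induction x rule: poly_mapping_single_induct)
     (simp_all add: cscale_single star_single star_add cscale_add_right)

lemma star_letter_mult: "star (letter g * x) = star x * letter (adj g)"
proof (induction x rule: poly_mapping_single_induct)
  case (2 w v)
  then show ?case by (simp add: letter_def mult_single plus_list_def star_single)
qed (simp_all add: star_add distrib_left distrib_right)

lemma star_mult: "star (x * y) = star y * star x"
  by (induction x rule: free_induct)
     (simp_all add: star_letter_mult mult.assoc star_cscale star_add distrib_left distrib_right)

lemma adj_adj [simp]: "adj (adj g) = g"
  by (cases g) simp_all

lemma star_star [simp]: "star (star x) = x"
  by (induction x rule: free_induct)
     (simp_all add: star_mult star_letter star_cscale star_add)

lemmas star_diff = additive_diff[of star, OF star_add]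

lemma star_power: "star (x ^ n) = star x ^ n"
  by (induction n) (simp_all add: star_mult power_commutes)


section \<open>The actions of K and F\<close>

lemma K_act_simps [simp]:
  "K_act q 1 = 1" "K_act q 0 = 0" "K_act q (letter g) = K_gen q g"
  "Kinv_act q 1 = 1" "Kinv_act q 0 = 0" "Kinv_act q (letter g) = Kinv_gen q g"
  by (simp_all add: K_act_def Kinv_act_def alg_ext_letter)

lemma K_act_add: "K_act q (x + y) = K_act q x + K_act q y"
  by (simp add: K_act_def alg_ext_add)

lemma K_act_cscale: "K_act q (cscale z x) = cscale z (K_act q x)"
  by (simp add: K_act_def alg_ext_cscale)

lemma K_act_mult: "K_act q (x * y) = K_act q x * K_act q y"
  by (simp add: K_act_def alg_ext_mult)

lemma Kinv_act_add: "Kinv_act q (x + y) = Kinv_act q x + Kinv_act q y"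
  by (simp add: Kinv_act_def alg_ext_add)

lemma Kinv_act_cscale: "Kinv_act q (cscale z x) = cscale z (Kinv_act q x)"
  by (simp add: Kinv_act_def alg_ext_cscale)

lemma Kinv_act_mult: "Kinv_act q (x * y) = Kinv_act q x * Kinv_act q y"
  by (simp add: Kinv_act_def alg_ext_mult)

lemma F_act_add: "F_act q (x + y) = F_act q x + F_act q y"
  by (simp add: F_act_def lin_ext_add)

lemma F_act_cscale: "F_act q (cscale z x) = cscale z (F_act q x)"
  by (simp add: F_act_def lin_ext_cscale)

lemma F_act_0 [simp]: "F_act q 0 = 0"
  by (simp add: F_act_def)

lemma F_act_1 [simp]: "F_act q 1 = 0"
  unfolding F_act_def monomial_Nil[symmetric] lin_ext_monomial by simp

lemma F_act_letter [simp]: "F_act q (letter g) = F_gen q g"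
  by (simp add: F_act_def letter_def lin_ext_monomial)

lemma F_act_letter_mult:
  "F_act q (letter g * x) = F_gen q g * K_act q x + Kinv_gen q g * F_act q x"
proof (induction x rule: poly_mapping_single_induct)
  case (2 w v)
  have "Poly_Mapping.single w v = cscale v (monomial w)"
    by (simp add: cscale_single)
  moreover have "letter g * monomial w = monomial (g # w)"
    by (simp add: monomial_Cons)
  ultimately show ?case
    by (simp add: F_act_cscale K_act_cscale cscale_add_right F_act_def lin_ext_monomial lin_ext_cscale)
qed (simp_all add: distrib_left K_act_add F_act_add)

text \<open>\<open>F_word\<close> fixes the rule only for a letter times a word; as
  \<open>K_act\<close> and \<open>Kinv_act\<close> are multiplicative, induction on the first factor
  extends it.\<close>

lemma F_act_mult: "F_act q (x * y) = F_act q x * K_act q y + Kinv_act q x * F_act q y"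
  by (induction x rule: free_induct)
     (simp_all add: F_act_letter_mult K_act_mult Kinv_act_mult K_act_add Kinv_act_add F_act_add
        F_act_cscale Kinv_act_cscale cscale_add_right algebra_simps)

lemmas K_act_diff = additive_diff[of "K_act q" for q, OF K_act_add]
lemmas Kinv_act_diff = additive_diff[of "Kinv_act q" for q, OF Kinv_act_add]
lemmas F_act_diff = additive_diff[of "F_act q" for q, OF F_act_add]


section \<open>Congruence modulo the defining relations\<close>

lemma suq_ideal_mult_left: "u \<in> suq_ideal q \<Longrightarrow> x * u \<in> suq_ideal q"
proof (induction rule: suq_ideal.induct)
  case (relator r y z)
  then show ?case using suq_ideal.relator[of r q "x * y" z] by (simp add: mult.assoc)
qed (auto simp: distrib_left intro: suq_ideal.intros)

lemma suq_ideal_mult_right: "u \<in> suq_ideal q \<Longrightarrow> u * x \<in> suq_ideal q"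
proof (induction rule: suq_ideal.induct)
  case (relator r y z)
  then show ?case using suq_ideal.relator[of r q y "z * x"] by (simp add: mult.assoc)
qed (auto simp: distrib_right intro: suq_ideal.intros)

lemma suq_ideal_cscale: "u \<in> suq_ideal q \<Longrightarrow> cscale z u \<in> suq_ideal q"
  unfolding cscale_def by (rule suq_ideal_mult_left)

lemma suq_ideal_minus: "u \<in> suq_ideal q \<Longrightarrow> - u \<in> suq_ideal q"
  using suq_ideal_cscale[of u q "- 1"] by (simp add: cscale_uminus_one)

lemma suq_ideal_diff: "u \<in> suq_ideal q \<Longrightarrow> v \<in> suq_ideal q \<Longrightarrow> u - v \<in> suq_ideal q"
  using suq_ideal.add[OF _ suq_ideal_minus] by fastforce

lemma relator_in_suq_ideal: "r \<in> relators q \<Longrightarrow> r \<in> suq_ideal q" "r \<in> relators q \<Longrightarrow> star r \<in> suq_ideal q"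
  using suq_ideal.relator[of _ q 1 1] by auto

locale quantum_su2 =
  fixes q :: real
  assumes q_pos: "0 < q" and q_less_1: "q < 1"
begin

text \<open>A relation in place of equality of cosets, so that calculations can be chained and
  carried out inside sums and products.\<close>

definition suq_cong :: "free \<Rightarrow> free \<Rightarrow> bool" (infix "\<approx>" 50) where
  "x \<approx> y \<longleftrightarrow> x - y \<in> suq_ideal q"

lemma suq_cong_refl [simp, intro]: "x \<approx> x"
  by (simp add: suq_cong_def suq_ideal.zero)

lemma suq_cong_sym: "x \<approx> y \<Longrightarrow> y \<approx> x"
  using suq_ideal_minus[of "x - y" q] by (simp add: suq_cong_def)

lemma suq_cong_trans [trans]: "x \<approx> y \<Longrightarrow> y \<approx> z \<Longrightarrow> x \<approx> z"
  using suq_ideal.add[of "x - y" q "y - z"] by (simp add: suq_cong_def)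

lemma suq_cong_add: "x \<approx> x' \<Longrightarrow> y \<approx> y' \<Longrightarrow> x + y \<approx> x' + y'"
  using suq_ideal.add[of "x - x'" q "y - y'"] by (simp add: suq_cong_def algebra_simps)

lemma suq_cong_minus: "x \<approx> x' \<Longrightarrow> - x \<approx> - x'"
  using suq_ideal_minus[of "x - x'" q] by (simp add: suq_cong_def)

lemma suq_cong_diff: "x \<approx> x' \<Longrightarrow> y \<approx> y' \<Longrightarrow> x - y \<approx> x' - y'"
  using suq_ideal_diff[of "x - x'" q "y - y'"] by (simp add: suq_cong_def algebra_simps)

lemma suq_cong_mult:
  assumes "x \<approx> x'" "y \<approx> y'" shows "x * y \<approx> x' * y'"
proof -
  have "x * y - x' * y' = (x - x') * y + x' * (y - y')"
    by (simp add: algebra_simps)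
  then show ?thesis
    using assms unfolding suq_cong_def
    by (metis suq_ideal.add suq_ideal_mult_left suq_ideal_mult_right)
qed

lemma suq_cong_mult_left: "y \<approx> y' \<Longrightarrow> x * y \<approx> x * y'"
  by (simp add: suq_cong_mult)

lemma suq_cong_mult_right: "x \<approx> x' \<Longrightarrow> x * y \<approx> x' * y"
  by (simp add: suq_cong_mult)

lemma suq_cong_cscale: "x \<approx> x' \<Longrightarrow> cscale z x \<approx> cscale z x'"
  using suq_ideal_cscale[of "x - x'" q z] by (simp add: suq_cong_def cscale_diff_right)

lemma suq_class_eq_iff: "suq_class q x = suq_class q y \<longleftrightarrow> x \<approx> y"
proof
  assume "suq_class q x = suq_class q y"
  moreover have "x \<in> suq_class q x"
    by (simp add: suq_class_def suq_ideal.zero)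
  ultimately show "x \<approx> y"
    by (simp add: suq_class_def suq_cong_def)
next
  assume "x \<approx> y"
  then show "suq_class q x = suq_class q y"
    unfolding suq_class_def suq_cong_def[symmetric] by (blast intro: suq_cong_trans suq_cong_sym)
qed

(* sigma = q^(1/2) turns all scalars into rational functions of one variable *)
definition sigma :: complex where "sigma = complex_of_real (q powr (1/2))"

lemma sigma_nonzero [simp]: "sigma \<noteq> 0"
  using q_pos by (simp add: sigma_def)

lemma powr_half: "complex_of_real (q powr (1/2)) = sigma"
  by (simp add: sigma_def)

lemma powr_minus_half: "complex_of_real (q powr (-1/2)) = 1 / sigma"
  using q_pos by (simp add: sigma_def powr_minus_divide)

lemma of_real_q: "complex_of_real q = sigma ^ 2"
proof -
  have "q = (q powr (1/2)) ^ 2"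
    using q_pos by (simp add: powr_half_sqrt)
  then show ?thesis
    by (metis of_real_power sigma_def)
qed

lemma of_real_q2: "complex_of_real (q\<^sup>2) = sigma ^ 4"
  by (simp add: of_real_q flip: power_mult)

lemma q_power_less_1: "0 < k \<Longrightarrow> q ^ k < 1"
  using q_pos q_less_1 by (simp add: power_Suc_less_one power_less_one_iff)

lemma sigma_power_ne_1: "0 < k \<Longrightarrow> sigma ^ (2 * k) \<noteq> 1"
proof
  assume k: "0 < k" and "sigma ^ (2 * k) = 1"
  then have "complex_of_real (q ^ k) = 1"
    by (simp add: of_real_q power_mult)
  then show False
    using q_power_less_1[OF k] by (metis less_irrefl of_real_eq_1_iff)
qed

lemma sigma4_ne_1 [simp]: "sigma ^ 4 \<noteq> 1" "1 - sigma ^ 4 \<noteq> 0"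
  using sigma_power_ne_1[of 2] by auto

lemma K_gen_sigma:
  "K_gen q LA = cscale (1 / sigma) ga" "K_gen q LC = cscale (1 / sigma) gc"
  "K_gen q LAs = cscale sigma gas" "K_gen q LCs = cscale sigma gcs"
  "Kinv_gen q LA = cscale sigma ga" "Kinv_gen q LC = cscale sigma gc"
  "Kinv_gen q LAs = cscale (1 / sigma) gas" "Kinv_gen q LCs = cscale (1 / sigma) gcs"
  by (simp_all only: K_gen.simps Kinv_gen.simps powr_half powr_minus_half)

lemma F_gen_sigma: "F_gen q LCs = - cscale (1 / sigma ^ 2) ga"
  by (simp add: of_real_q)

lemma relators_sigma:
  "relators q = {ga * gc - cscale (sigma ^ 2) (gc * ga), ga * gcs - cscale (sigma ^ 2) (gcs * ga),
     gc * gcs - gcs * gc, gas * ga + gcs * gc - 1, ga * gas + cscale (sigma ^ 4) (gc * gcs) - 1}"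
  by (simp only: relators_def of_real_q of_real_q2)

lemma cnj_sigma [simp]: "cnj sigma = sigma"
  by (simp add: sigma_def)

lemma star_relators_sigma:
  "star ` relators q = {gcs * gas - cscale (sigma ^ 2) (gas * gcs), gc * gas - cscale (sigma ^ 2) (gas * gc),
     gc * gcs - gcs * gc, gas * ga + gcs * gc - 1, ga * gas + cscale (sigma ^ 4) (gc * gcs) - 1}"
  by (simp add: relators_sigma star_add star_diff star_mult star_letter star_cscale)

lemma relations:
  "ga * gc \<approx> cscale (sigma ^ 2) (gc * ga)"
  "ga * gcs \<approx> cscale (sigma ^ 2) (gcs * ga)"
  "gc * gcs \<approx> gcs * gc"
  "gas * ga + gcs * gc \<approx> 1"
  "ga * gas + cscale (sigma ^ 4) (gc * gcs) \<approx> 1"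
  "gcs * gas \<approx> cscale (sigma ^ 2) (gas * gcs)"
  "gc * gas \<approx> cscale (sigma ^ 2) (gas * gc)"
proof -
  have rel: "x \<approx> y" if "x - y \<in> relators q" for x y
    using that relator_in_suq_ideal(1) by (simp add: suq_cong_def)
  have star_rel: "x \<approx> y" if "x - y \<in> star ` relators q" for x y
    using that relator_in_suq_ideal(2) by (auto simp: suq_cong_def)
  show
    "ga * gc \<approx> cscale (sigma ^ 2) (gc * ga)"
    "ga * gcs \<approx> cscale (sigma ^ 2) (gcs * ga)"
    "gc * gcs \<approx> gcs * gc"
    "gas * ga + gcs * gc \<approx> 1"
    "ga * gas + cscale (sigma ^ 4) (gc * gcs) \<approx> 1"
    by (rule rel, unfold relators_sigma, simp)+
  show
    "gcs * gas \<approx> cscale (sigma ^ 2) (gas * gcs)"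
    "gc * gas \<approx> cscale (sigma ^ 2) (gas * gc)"
    by (rule star_rel, unfold star_relators_sigma, simp)+
qed

lemma suq_cong_addD: "x + y \<approx> z \<Longrightarrow> x \<approx> z - y" "x + y \<approx> z \<Longrightarrow> y \<approx> z - x"
  by (simp_all add: suq_cong_def algebra_simps)

section \<open>Compatibility of the actions with the defining relations\<close>

lemma all_relators_sigma:
  "relators q \<union> star ` relators q =
    {ga * gc - cscale (sigma ^ 2) (gc * ga), ga * gcs - cscale (sigma ^ 2) (gcs * ga),
     gc * gcs - gcs * gc, gas * ga + gcs * gc - 1, ga * gas + cscale (sigma ^ 4) (gc * gcs) - 1,
     gcs * gas - cscale (sigma ^ 2) (gas * gcs), gc * gas - cscale (sigma ^ 2) (gas * gc)}"
  by (subst star_relators_sigma, subst relators_sigma) auto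

text \<open>Every relator is homogeneous if \<open>ga\<close>, \<open>gc\<close> have weight -1 and
  \<open>gas\<close>, \<open>gcs\<close> weight 1. The weights -2, 0 and 2 occur, and each action
  multiplies by the corresponding power of \<open>sigma\<close>.\<close>

lemma K_relator:
  assumes "r \<in> relators q \<union> star ` relators q"
  shows "K_act q r \<in> suq_ideal q" "Kinv_act q r \<in> suq_ideal q"
proof -
  have r: "r \<in> suq_ideal q"
    using assms relator_in_suq_ideal by auto
  have "K_act q r \<in> {r, cscale (sigma ^ 2) r, cscale (1 / sigma ^ 2) r}"
       "Kinv_act q r \<in> {r, cscale (sigma ^ 2) r, cscale (1 / sigma ^ 2) r}"
    using assms unfolding all_relators_sigma
    by (auto simp: K_act_add K_act_diff K_act_cscale K_act_mult K_gen_sigma cscale_distribs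
          Kinv_act_add Kinv_act_diff Kinv_act_cscale Kinv_act_mult power2_eq_square
        simp del: K_gen.simps Kinv_gen.simps)
  then show "K_act q r \<in> suq_ideal q" "Kinv_act q r \<in> suq_ideal q"
    using r suq_ideal_cscale[OF r] by auto
qed

text \<open>\<open>F_act\<close> lowers weights by 2, which leaves few possible values. Relators of
  weight 0 go to multiples of \<open>r1\<close>; the one that exchanges \<open>gcs\<close> and
  \<open>gas\<close>, of weight 2, goes to a multiple of the difference of the two unit relations
  \<open>r4\<close> and \<open>r5\<close>.\<close>

lemma F_relator:
  assumes "r \<in> relators q \<union> star ` relators q"
  shows "F_act q r \<in> suq_ideal q"
proof -
  define r1 r4 r5 where "r1 = ga * gc - cscale (sigma ^ 2) (gc * ga)"
    and "r4 = gas * ga + gcs * gc - 1" and "r5 = ga * gas + cscale (sigma ^ 4) (gc * gcs) - 1"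
  note r_defs = r1_def r4_def r5_def
  have "r1 \<in> suq_ideal q" "r4 \<in> suq_ideal q" "r5 \<in> suq_ideal q"
    by (rule relator_in_suq_ideal(1), simp add: relators_sigma r_defs)+
  then have "{0, cscale (1 / sigma ^ 3) r1, cscale (- 1 / sigma ^ 3) r1, cscale sigma r1, cscale (1 / sigma) (r4 - r5)}
      \<subseteq> suq_ideal q"
    using suq_ideal.zero by (auto intro!: suq_ideal_cscale suq_ideal_diff)
  moreover have "F_act q r \<in> {0, cscale (1 / sigma ^ 3) r1, cscale (- 1 / sigma ^ 3) r1,
      cscale sigma r1, cscale (1 / sigma) (r4 - r5)}"
    using assms unfolding all_relators_sigma
    by (auto simp: F_act_add F_act_diff F_act_cscale F_act_mult K_gen_sigma cscale_distribs F_gen_sigma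
          power2_eq_square power3_eq_cube power4_eq_xxxx mult.assoc r_defs cscale_minus_left
        simp del: K_gen.simps Kinv_gen.simps F_gen.simps(4))
  ultimately show ?thesis by blast
qed

text \<open>Expanding \<open>F_act\<close> on \<open>x * r * y\<close> applies \<open>K_act\<close>,
  \<open>Kinv_act\<close> or \<open>F_act\<close> to the relator, so the three actions are treated
  together.\<close>

lemma act_suq_ideal:
  assumes "u \<in> suq_ideal q"
  shows "K_act q u \<in> suq_ideal q \<and> Kinv_act q u \<in> suq_ideal q \<and> F_act q u \<in> suq_ideal q"
  using assms
proof (induction rule: suq_ideal.induct)
  case (relator r x y)
  then have "r \<in> suq_ideal q"
    using relator_in_suq_ideal by auto
  then show ?case
    using K_relator[OF relator] F_relator[OF relator]
    by (simp add: K_act_mult Kinv_act_mult F_act_mult distrib_left distrib_right suq_ideal.add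
          suq_ideal_mult_left suq_ideal_mult_right)
qed (simp_all add: K_act_add Kinv_act_add F_act_add suq_ideal.zero suq_ideal.add)

lemma suq_cong_act:
  assumes "x \<approx> y"
  shows "K_act q x \<approx> K_act q y" "Kinv_act q x \<approx> Kinv_act q y" "F_act q x \<approx> F_act q y"
  using act_suq_ideal[of "x - y"] assms
  by (simp_all add: suq_cong_def K_act_diff Kinv_act_diff F_act_diff)


section \<open>The derivation as a commutator\<close>

text \<open>The factor forced by the letter \<open>gas\<close>: there the commutator formula amounts
  to \<open>sigma * kappa * (1 - sigma ^ 4) = 1\<close>. The same value fits
  \<open>gcs\<close>.\<close>

definition kappa :: complex where "kappa = 1 / (sigma * (1 - sigma ^ 4))"

lemma Kinv_gen_scalar: "\<exists>k. Kinv_gen q g = cscale k (letter g)"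
  by (cases g) auto

text \<open>This is \<open>F(g) = kappa (u K(g) - Kinv(g) u)\<close> at a letter, with
  \<open>u = gcs^(-1) ga\<close>, multiplied by \<open>gcs\<close> on the left. The scalar
  \<open>l\<close> arises when \<open>gcs\<close> is moved past the letter to meet the inverse in
  \<open>u\<close>.\<close>

lemma kappa_F_gen:
  "\<exists>l. gcs * letter g \<approx> cscale l (letter g * gcs) \<and>
     gcs * F_gen q g + cscale (l * kappa) (Kinv_gen q g * ga) \<approx> cscale kappa (ga * K_gen q g)"
proof (cases g)
  case LA
  have "gcs * ga \<approx> cscale (1 / sigma ^ 2) (ga * gcs)"
    using suq_cong_cscale[OF suq_cong_sym[OF relations(2)], of "1 / sigma ^ 2"] by simp
  moreover have "1 / sigma ^ 2 * kappa * sigma = kappa * (1 / sigma)"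
    by (simp add: power2_eq_square)
  ultimately show ?thesis
    unfolding LA by (intro exI[of _ "1 / sigma ^ 2"])
      (simp add: K_gen_sigma del: K_gen.simps Kinv_gen.simps)
next
  case LC
  have "cscale (kappa / sigma) (ga * gc) \<approx> cscale (kappa / sigma) (cscale (sigma ^ 2) (gc * ga))"
    by (intro suq_cong_cscale relations)
  moreover have "kappa / sigma * sigma ^ 2 = kappa * sigma"
    by (simp add: power2_eq_square)
  ultimately show ?thesis
    unfolding LC using relations(3) by (intro exI[of _ 1])
      (auto simp: K_gen_sigma simp del: K_gen.simps Kinv_gen.simps intro: suq_cong_sym)
next
  case LAs
  have "sigma * kappa * (1 - sigma ^ 4) = 1"
    by (simp add: kappa_def)
  then have k: "sigma * kappa * sigma ^ 4 = sigma * kappa - 1"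
    by algebra
  have "ga * gas \<approx> 1 - cscale (sigma ^ 4) (gcs * gc)"
    using suq_cong_addD(1)[OF relations(5)]
    by (rule suq_cong_trans) (intro suq_cong_diff suq_cong_cscale relations suq_cong_refl)
  then have "cscale (sigma * kappa) (ga * gas) \<approx> cscale (sigma * kappa) (1 - cscale (sigma ^ 4) (gcs * gc))"
    by (rule suq_cong_cscale)
  also have "\<dots> = cscale (sigma * kappa) (1 - gcs * gc) + gcs * gc"
    by (simp add: cscale_distribs k cscale_diff_left)
  also have "\<dots> \<approx> cscale (sigma * kappa) (gas * ga) + gcs * gc"
    by (intro suq_cong_add suq_cong_cscale suq_cong_refl suq_cong_sym[OF suq_cong_addD(1)[OF relations(4)]])
  finally have "gcs * gc + cscale (sigma * kappa) (gas * ga) \<approx> cscale (kappa * sigma) (ga * gas)"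
    by (simp add: suq_cong_sym add.commute mult.commute)
  moreover have "sigma ^ 2 * kappa * (1 / sigma) = sigma * kappa"
    by (simp add: power2_eq_square)
  ultimately show ?thesis
    unfolding LAs using relations(6)
    by (intro exI[of _ "sigma ^ 2"]) (simp add: K_gen_sigma del: K_gen.simps Kinv_gen.simps)
next
  case LCs
  have k: "kappa * sigma ^ 3 = kappa / sigma - 1 / sigma ^ 2"
  proof -
    have "kappa / sigma - kappa * sigma ^ 3 = kappa * (1 - sigma ^ 4) / sigma"
      by (simp add: field_simps eval_nat_numeral)
    also have "\<dots> = 1 / sigma ^ 2"
      by (simp add: kappa_def power2_eq_square)
    finally show ?thesis
      by (simp add: algebra_simps)
  qed
  have "cscale (kappa * sigma) (ga * gcs) \<approx> cscale (kappa * sigma) (cscale (sigma ^ 2) (gcs * ga))"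
    by (intro suq_cong_cscale relations)
  also have "\<dots> = cscale (kappa / sigma - 1 / sigma ^ 2) (gcs * ga)"
    by (simp add: flip: k) (simp add: eval_nat_numeral mult.assoc)
  finally have "cscale (kappa / sigma) (gcs * ga) - cscale (1 / sigma ^ 2) (gcs * ga) \<approx> cscale (kappa * sigma) (ga * gcs)"
    by (simp add: cscale_diff_left suq_cong_sym)
  then show ?thesis
    unfolding LCs by (intro exI[of _ 1])
      (simp add: K_gen_sigma F_gen_sigma del: K_gen.simps Kinv_gen.simps F_gen.simps)
qed

(* F(x) = kappa (u K(x) - Kinv(x) u) with u = gcs^(-1) ga, cleared of the inverse of gcs. *)
lemma F_act_commutator:
  "gcs * F_act q x * gcs \<approx>
    cscale kappa (ga * K_act q x * gcs - cscale (sigma ^ 2) (gcs * Kinv_act q x * ga))"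
proof (induction x rule: free_induct)
  case one
  have "cscale kappa 0 \<approx> cscale kappa (ga * gcs - cscale (sigma ^ 2) (gcs * ga))"
    using suq_cong_diff[OF relations(2) suq_cong_refl, of "cscale (sigma ^ 2) (gcs * ga)"]
    by (intro suq_cong_cscale) (simp add: suq_cong_sym)
  then show ?case by simp
next
  case (letter g x)
  let ?R = "ga * K_act q x * gcs - cscale (sigma ^ 2) (gcs * Kinv_act q x * ga)"
  obtain l where l: "gcs * letter g \<approx> cscale l (letter g * gcs)"
      "gcs * F_gen q g + cscale (l * kappa) (Kinv_gen q g * ga) \<approx> cscale kappa (ga * K_gen q g)"
    using kappa_F_gen by blast
  obtain k where k: "Kinv_gen q g = cscale k (letter g)"
    using Kinv_gen_scalar by blast
  have lK: "gcs * Kinv_gen q g \<approx> cscale l (Kinv_gen q g * gcs)"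
    using suq_cong_cscale[OF l(1), of k] by (simp add: k mult.commute)
  have "gcs * F_act q (letter g * x) * gcs =
      gcs * F_gen q g * (K_act q x * gcs) + (gcs * Kinv_gen q g) * (F_act q x * gcs)"
    by (simp add: F_act_letter_mult algebra_simps)
  also have "\<dots> \<approx> gcs * F_gen q g * (K_act q x * gcs) + cscale l (Kinv_gen q g * gcs) * (F_act q x * gcs)"
    by (intro suq_cong_add suq_cong_mult suq_cong_refl lK)
  also have "\<dots> = gcs * F_gen q g * (K_act q x * gcs) + cscale l (Kinv_gen q g * (gcs * F_act q x * gcs))"
    by (simp add: mult.assoc)
  also have "\<dots> \<approx> gcs * F_gen q g * (K_act q x * gcs) + cscale l (Kinv_gen q g * cscale kappa ?R)"
    by (intro suq_cong_add suq_cong_mult suq_cong_cscale suq_cong_refl letter)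
  also have "\<dots> = (gcs * F_gen q g + cscale (l * kappa) (Kinv_gen q g * ga)) * (K_act q x * gcs)
      - cscale (kappa * sigma ^ 2) (cscale l (Kinv_gen q g * gcs) * (Kinv_act q x * ga))"
    by (simp add: algebra_simps cscale_distribs)
  also have "\<dots> \<approx> cscale kappa (ga * K_gen q g) * (K_act q x * gcs)
      - cscale (kappa * sigma ^ 2) ((gcs * Kinv_gen q g) * (Kinv_act q x * ga))"
    by (intro suq_cong_diff suq_cong_cscale suq_cong_mult suq_cong_refl l suq_cong_sym[OF lK])
  finally show ?case
    by (simp add: K_act_mult Kinv_act_mult cscale_distribs mult.assoc)
next
  case (cscale z x)
  show ?case
    using suq_cong_cscale[OF cscale, of z]
    by (simp add: F_act_cscale K_act_cscale Kinv_act_cscale cscale_distribs mult.commute mult.left_commute)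
next
  case (add x y)
  show ?case
    using suq_cong_add[OF add]
    by (simp add: F_act_add K_act_add Kinv_act_add cscale_distribs algebra_simps)
qed


section \<open>Powers of B0\<close>

lemma a_B0_power: "ga * B0 ^ m \<approx> cscale (sigma ^ (4 * m)) (B0 ^ m * ga)"
proof (induction m)
  case (Suc m)
  have B0: "ga * B0 \<approx> cscale (sigma ^ 4) (B0 * ga)"
  proof -
    have "ga * B0 = (ga * gc) * gcs"
      by (simp add: B0_def mult.assoc)
    also have "\<dots> \<approx> cscale (sigma ^ 2) (gc * ga) * gcs"
      by (intro suq_cong_mult_right relations)
    also have "\<dots> = cscale (sigma ^ 2) (gc * (ga * gcs))"
      by (simp add: mult.assoc)
    also have "\<dots> \<approx> cscale (sigma ^ 2) (gc * cscale (sigma ^ 2) (gcs * ga))"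
      by (intro suq_cong_cscale suq_cong_mult_left relations)
    finally show ?thesis
      by (simp add: B0_def mult.assoc flip: power_add)
  qed
  have "ga * B0 ^ Suc m = (ga * B0) * B0 ^ m"
    by (simp add: mult.assoc)
  also have "\<dots> \<approx> cscale (sigma ^ 4) (B0 * ga) * B0 ^ m"
    by (intro suq_cong_mult_right B0)
  also have "\<dots> = cscale (sigma ^ 4) (B0 * (ga * B0 ^ m))"
    by (simp add: mult.assoc)
  also have "\<dots> \<approx> cscale (sigma ^ 4) (B0 * cscale (sigma ^ (4 * m)) (B0 ^ m * ga))"
    by (intro suq_cong_cscale suq_cong_mult_left Suc)
  finally show ?case
    by (simp add: mult.assoc flip: power_add)
qed simp

lemma commute_power:
  assumes "x * y \<approx> y * x"
  shows "x * y ^ m \<approx> y ^ m * x"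
proof (induction m)
  case (Suc m)
  have "x * y ^ Suc m = (x * y) * y ^ m"
    by (simp add: mult.assoc)
  also have "\<dots> \<approx> (y * x) * y ^ m"
    by (intro suq_cong_mult_right assms)
  also have "\<dots> = y * (x * y ^ m)"
    by (simp add: mult.assoc)
  also have "\<dots> \<approx> y * (y ^ m * x)"
    by (intro suq_cong_mult_left Suc)
  finally show ?case by (simp add: mult.assoc)
qed simp

lemma gc_B0: "gc * B0 \<approx> B0 * gc"
  using suq_cong_mult_left[OF relations(3), of gc] by (simp add: B0_def mult.assoc)

lemma gcs_B0: "gcs * B0 \<approx> B0 * gcs"
  using suq_cong_mult_right[OF suq_cong_sym[OF relations(3)], of gcs] by (simp add: B0_def mult.assoc)

lemma K_B0_power [simp]: "K_act q (B0 ^ m) = B0 ^ m" "Kinv_act q (B0 ^ m) = B0 ^ m"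
  by (induction m; simp add: K_act_mult Kinv_act_mult B0_def K_gen_sigma del: K_gen.simps Kinv_gen.simps)+

text \<open>Formally \<open>u B0 = sigma^4 B0 u\<close> and \<open>B0 u = gc ga\<close>, so the
  commutator of \<open>u\<close> with a power of \<open>B0\<close> has this form. To avoid
  cancelling \<open>gcs\<close>, the formula is proved by the Leibniz rule along the powers.\<close>

lemma F_B0_power:
  "F_act q (B0 ^ Suc m) \<approx> - cscale (kappa * (1 - sigma ^ (4 * Suc m))) (B0 ^ m * gc * ga)"
proof (induction m)
  case 0
  have "F_act q B0 = - cscale (1 / sigma) (gc * ga)"
    by (simp add: B0_def F_act_mult K_gen_sigma F_gen_sigma power2_eq_square
        del: K_gen.simps Kinv_gen.simps F_gen.simps(4))
  then show ?case by (simp add: kappa_def)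
next
  case (Suc m)
  let ?d = "1 - sigma ^ (4 * Suc m)"
  have F0: "F_act q B0 = - cscale (1 / sigma) (gc * ga)"
    by (simp add: B0_def F_act_mult K_gen_sigma F_gen_sigma power2_eq_square
        del: K_gen.simps Kinv_gen.simps F_gen.simps(4))
  have K0: "Kinv_act q B0 = B0"
    using K_B0_power(2)[of 1] by simp
  have "gc * (ga * B0 ^ Suc m) \<approx> gc * cscale (sigma ^ (4 * Suc m)) (B0 ^ Suc m * ga)"
    by (intro suq_cong_mult_left a_B0_power)
  also have "\<dots> = cscale (sigma ^ (4 * Suc m)) ((gc * B0 ^ Suc m) * ga)"
    by (simp add: mult.assoc)
  also have "\<dots> \<approx> cscale (sigma ^ (4 * Suc m)) ((B0 ^ Suc m * gc) * ga)"
    by (intro suq_cong_cscale suq_cong_mult_right commute_power gc_B0)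
  finally have 1: "gc * (ga * B0 ^ Suc m) \<approx> cscale (sigma ^ (4 * Suc m)) (B0 ^ Suc m * gc * ga)" .
  have "F_act q (B0 ^ Suc (Suc m)) = F_act q (B0 * B0 ^ Suc m)"
    by simp
  also have "\<dots> = - cscale (1 / sigma) (gc * (ga * B0 ^ Suc m)) + B0 * F_act q (B0 ^ Suc m)"
    by (subst F_act_mult) (simp add: F0 K0 mult.assoc del: power_Suc)
  also have "\<dots> \<approx> - cscale (1 / sigma) (cscale (sigma ^ (4 * Suc m)) (B0 ^ Suc m * gc * ga))
      + B0 * (- cscale (kappa * ?d) (B0 ^ m * gc * ga))"
    by (intro suq_cong_add suq_cong_minus suq_cong_cscale suq_cong_mult suq_cong_refl 1 Suc)
  also have "\<dots> = - cscale (1 / sigma * sigma ^ (4 * Suc m) + kappa * ?d) (B0 ^ Suc m * gc * ga)"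
    by (simp add: cscale_add_left mult.assoc)
  also have "1 / sigma * sigma ^ (4 * Suc m) + kappa * ?d = kappa * (1 - sigma ^ (4 * Suc (Suc m)))"
  proof -
    have "1 / sigma = kappa * (1 - sigma ^ 4)"
      by (simp add: kappa_def)
    then show ?thesis
      by (simp only:) (simp add: algebra_simps power_add)
  qed
  finally show ?case .
qed

text \<open>For \<open>f = B0 ^ Suc m\<close> one has \<open>[u,f] = - mu f u\<close>, so the two
  perturbed shifts are \<open>(1 - al mu f) u\<close> and \<open>(1 - mu f) u\<close>, and
  \<open>al mu = 1\<close> turns the first factor into \<open>1 - f\<close>. The outer factors
  \<open>gcs\<close> clear the inverses in \<open>u\<close>; the scalar \<open>sigma ^ 2\<close>
  comes from \<open>u gcs = sigma^2 ga\<close>.\<close>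

lemma gauge_commutator:
  fixes m defines "mu \<equiv> 1 - sigma ^ (4 * Suc m)"
  assumes "K_act q x \<approx> x" "Kinv_act q x \<approx> x" and "al * mu = 1"
  shows "gcs * (F_act q x - x * F_act q (B0 ^ Suc m) + cscale al (F_act q (B0 ^ Suc m)) * x) * gcs \<approx>
    cscale kappa ((1 - B0 ^ Suc m) * ga * x * gcs - cscale (sigma ^ 2) (gcs * x * (1 - cscale mu (B0 ^ Suc m)) * ga))"
proof -
  let ?f = "B0 ^ Suc m" and ?g = "B0 ^ m * gc * ga"
  have F: "F_act q ?f \<approx> - cscale (kappa * mu) ?g"
    unfolding mu_def by (rule F_B0_power)
  have 1: "gcs * F_act q x * gcs \<approx> cscale kappa (ga * x * gcs - cscale (sigma ^ 2) (gcs * x * ga))"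
    by (rule suq_cong_trans[OF F_act_commutator])
       (intro suq_cong_cscale suq_cong_diff suq_cong_mult suq_cong_refl assms)
  have "gcs * x * F_act q ?f * gcs \<approx> gcs * x * (- cscale (kappa * mu) ?g) * gcs"
    by (intro suq_cong_mult suq_cong_refl F)
  also have "\<dots> = - cscale (kappa * mu) (gcs * x * B0 ^ m * gc * (ga * gcs))"
    by (simp add: mult.assoc)
  also have "\<dots> \<approx> - cscale (kappa * mu) (gcs * x * B0 ^ m * gc * (cscale (sigma ^ 2) (gcs * ga)))"
    by (intro suq_cong_minus suq_cong_cscale suq_cong_mult_left relations)
  also have "\<dots> = - cscale (kappa * mu * sigma ^ 2) (gcs * x * (B0 ^ m * B0) * ga)"
    by (simp add: B0_def mult.assoc)
  finally have 2: "gcs * x * F_act q ?f * gcs \<approx> - cscale (kappa * mu * sigma ^ 2) (gcs * x * ?f * ga)"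
    by (simp add: power_commutes)
  have "gcs * F_act q ?f * x * gcs \<approx> gcs * (- cscale (kappa * mu) ?g) * x * gcs"
    by (intro suq_cong_mult suq_cong_refl F)
  also have "\<dots> = - cscale (kappa * mu) ((gcs * B0 ^ m) * (gc * ga * x * gcs))"
    by (simp add: mult.assoc)
  also have "\<dots> \<approx> - cscale (kappa * mu) ((B0 ^ m * gcs) * (gc * ga * x * gcs))"
    by (intro suq_cong_minus suq_cong_cscale suq_cong_mult_right commute_power gcs_B0)
  also have "\<dots> = - cscale (kappa * mu) (B0 ^ m * (gcs * gc) * (ga * x * gcs))"
    by (simp add: mult.assoc)
  also have "\<dots> \<approx> - cscale (kappa * mu) (B0 ^ m * (gc * gcs) * (ga * x * gcs))"
    by (intro suq_cong_minus suq_cong_cscale suq_cong_mult suq_cong_refl suq_cong_sym[OF relations(3)])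
  finally have 3: "gcs * F_act q ?f * x * gcs \<approx> - cscale (kappa * mu) (?f * ga * x * gcs)"
    by (simp add: B0_def[symmetric] power_commutes mult.assoc)
  have "gcs * (F_act q x - x * F_act q ?f + cscale al (F_act q ?f) * x) * gcs =
      gcs * F_act q x * gcs - gcs * x * F_act q ?f * gcs + cscale al (gcs * F_act q ?f * x * gcs)"
    by (simp add: algebra_simps)
  also have "\<dots> \<approx> cscale kappa (ga * x * gcs - cscale (sigma ^ 2) (gcs * x * ga))
      - (- cscale (kappa * mu * sigma ^ 2) (gcs * x * ?f * ga))
      + cscale al (- cscale (kappa * mu) (?f * ga * x * gcs))"
    by (intro suq_cong_add suq_cong_diff suq_cong_cscale 1 2 3)
  also have "\<dots> = cscale kappa (ga * x * gcs - cscale (sigma ^ 2) (gcs * x * ga))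
      + cscale (kappa * mu * sigma ^ 2) (gcs * x * ?f * ga)
      - cscale kappa (?f * ga * x * gcs)"
  proof -
    have "al * (kappa * mu) = kappa"
      using assms(4) by (simp add: mult.commute mult.left_commute)
    then have "cscale al (- cscale (kappa * mu) y) = - cscale kappa y" for y
      by (simp only: cscale_minus_right cscale_cscale)
    then show ?thesis by simp
  qed
  also have "\<dots> = cscale kappa ((1 - ?f) * ga * x * gcs - cscale (sigma ^ 2) (gcs * x * (1 - cscale mu ?f) * ga))"
    by (simp add: algebra_simps cscale_distribs del: power_Suc)
  finally show ?thesis .
qed

end


section \<open>Slice maps and the counit\<close>

lemma slice_right_add: "slice_right f (s + t) = slice_right f s + slice_right f t"
  unfolding slice_right_def by (rule sum_keys_add) (simp_all add: distrib_right single_add)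

lemma slice_right_single: "slice_right f (Poly_Mapping.single (u, v) z) = Poly_Mapping.single u (z * f (monomial v))"
  unfolding slice_right_def by (subst sum_keys_single) simp_all

lemma slice_left_add: "slice_left f (s + t) = slice_left f s + slice_left f t"
  unfolding slice_left_def by (rule sum_keys_add) (simp_all add: distrib_right single_add)

lemma slice_left_single: "slice_left f (Poly_Mapping.single (u, v) z) = Poly_Mapping.single v (z * f (monomial u))"
  unfolding slice_left_def by (subst sum_keys_single) simp_all

lemma slice_zero [simp]: "slice_right f 0 = 0" "slice_left f 0 = 0"
  by (simp_all add: slice_right_def slice_left_def)

lemmas slice_right_diff = additive_diff[of "slice_right f" for f, OF slice_right_add]

lemma slice_right_cscale: "slice_right f (cscale z t) = cscale z (slice_right f t)"
  by (induction t rule: poly_mapping_single_induct)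
     (auto simp: cscale_add_right slice_right_add cscale_single slice_right_single mult.assoc)

lemma slice_right_functional_add:
  "slice_right (\<lambda>y. f y + g y) t = slice_right f t + slice_right g t"
  by (simp add: slice_right_def distrib_left single_add sum.distrib)

lemma slice_right_functional_scale: "slice_right (\<lambda>y. z * f y) t = cscale z (slice_right f t)"
  by (simp add: slice_right_def cscale_sum cscale_single mult.left_commute)

lemma slice_right_functional_minus_divide:
  "slice_right (\<lambda>y. - (f y / z)) t = - cscale (1 / z) (slice_right f t)"
  using slice_right_functional_scale[of "- 1 / z" f t] by (simp add: cscale_minus_left)

lemma slice_right_letter_mult:
  assumes "\<And>z x. f (cscale z x) = z * f x"
  shows "slice_right f (Poly_Mapping.single ([g], [g']) 1 * t) =
    letter g * slice_right (\<lambda>y. f (letter g' * y)) t"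
proof (induction t rule: poly_mapping_single_induct)
  case (2 k z)
  obtain u v where k: "k = (u, v)" by (cases k)
  show ?case
    by (simp add: k mult_single slice_right_single letter_def plus_list_def)
qed (simp_all add: slice_right_add distrib_left)

text \<open>Both sides evaluate the tensor product of \<open>f\<close> and \<open>g\<close> at
  \<open>t\<close>.\<close>

lemma slice_exchange:
  assumes "\<And>x y. f (x + y) = f x + f y" "\<And>z x. f (cscale z x) = z * f x"
    and "\<And>x y. g (x + y) = g x + g y" "\<And>z x. g (cscale z x) = z * g x"
  shows "f (slice_right g t) = g (slice_left f t)"
proof (induction t rule: poly_mapping_single_induct)
  case 1
  show ?case using assms(2)[of 0 0] assms(4)[of 0 0] by simp
next
  case (2 k z)
  obtain u v where k: "k = (u, v)" by (cases k)
  show ?case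
    using assms(2)[of "z * g (monomial v)" "monomial u"] assms(4)[of "z * f (monomial u)" "monomial v"]
    by (simp add: k slice_right_single slice_left_single cscale_single)
qed (simp_all add: slice_right_add slice_left_add assms)

text \<open>A character is a product over the letters of a word; with the value 1 at
  \<open>ga\<close>, \<open>gas\<close> and 0 at \<open>gc\<close>, \<open>gcs\<close> that product
  is the indicator of the words without \<open>gc\<close> and \<open>gcs\<close>.\<close>

definition counit :: "free \<Rightarrow> complex" where
  "counit x = (\<Sum>w\<in>Poly_Mapping.keys x. Poly_Mapping.lookup x w * (if set w \<subseteq> {LA, LAs} then 1 else 0))"

lemma counit_add: "counit (x + y) = counit x + counit y"
  unfolding counit_def by (rule sum_keys_add) (simp_all add: distrib_right)

lemma counit_single: "counit (Poly_Mapping.single w z) = z * (if set w \<subseteq> {LA, LAs} then 1 else 0)"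
  unfolding counit_def by (rule sum_keys_single) simp

lemma counit_0 [simp]: "counit 0 = 0"
  by (simp add: counit_def)

lemma counit_1 [simp]: "counit 1 = 1"
  using counit_single[of "[]" 1] by simp

lemma counit_cscale: "counit (cscale z x) = z * counit x"
  by (induction x rule: poly_mapping_single_induct)
     (simp_all add: cscale_single counit_single counit_add cscale_add_right distrib_left)

lemma counit_letter: "counit (letter g) = (if g \<in> {LA, LAs} then 1 else 0)"
  by (simp add: letter_def counit_single)

lemma counit_letter_mult: "counit (letter g * x) = counit (letter g) * counit x"
proof (induction x rule: poly_mapping_single_induct)
  case (2 w v)
  then show ?case by (simp add: letter_def mult_single plus_list_def counit_single)
qed (simp_all add: counit_add distrib_left)

lemma counit_mult: "counit (x * y) = counit x * counit y"
  by (induction x rule: free_induct)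
     (simp_all add: counit_letter_mult mult.assoc counit_cscale counit_add distrib_right)

lemmas counit_minus = additive_minus[of counit, OF counit_add]
lemmas counit_diff = additive_diff[of counit, OF counit_add]

section \<open>The actions as slices of the coproduct\<close>

lemma coproduct_1 [simp]: "coproduct q 1 = 1"
  by (simp add: coproduct_def)

lemma coproduct_letter_mult: "coproduct q (letter g * x) = coproduct_gen q g * coproduct q x"
  by (simp add: coproduct_def alg_ext_letter_mult)

lemma coproduct_add: "coproduct q (x + y) = coproduct q x + coproduct q y"
  by (simp add: coproduct_def alg_ext_add)

lemma coproduct_cscale: "coproduct q (cscale z x) = cscale z (coproduct q x)"
  by (simp add: coproduct_def alg_ext_cscale)

lemma slice_right_1: "slice_right f 1 = cscale (f 1) 1"
  using slice_right_single[of f "[]" "[]" 1]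
  by (simp add: cscale_def flip: zero_list_def zero_prod_def)

context quantum_su2
begin

lemma counit_suq_ideal: "u \<in> suq_ideal q \<Longrightarrow> counit u = 0"
proof (induction rule: suq_ideal.induct)
  case (relator r x y)
  then have "counit r = 0"
    unfolding all_relators_sigma
    by (auto simp: counit_add counit_diff counit_mult counit_cscale counit_letter)
  then show ?case by (simp add: counit_mult)
qed (simp_all add: counit_add)

text \<open>The functional \<open>counit\<close> composed with \<open>K_act\<close> is
  multiplicative, so agreement on letters suffices. The formula enters the one for
  \<open>F_act\<close> through the Leibniz rule.\<close>

lemma slice_right_counit_K: "slice_right (\<lambda>y. counit (K_act q y)) (coproduct q x) = K_act q x"
proof (induction x rule: free_induct)
  case (letter g x)
  show ?case
    by (cases g) (simp_all add: coproduct_letter_mult K_act_mult left_diff_distrib distrib_right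
      slice_right_diff slice_right_add slice_right_cscale slice_right_letter_mult
      K_act_cscale counit_cscale counit_mult slice_right_functional_scale counit_letter
      slice_right_functional_scale[where f = "\<lambda>_. 0" and z = 0, simplified] letter mult.assoc)
qed (simp_all add: slice_right_1 coproduct_cscale coproduct_add slice_right_cscale slice_right_add
      K_act_cscale K_act_add)

text \<open>The action is a convolution in the second tensor factor. This brings
  \<open>F_act\<close> into a form to which the left invariance of the Haar state applies.\<close>

lemma slice_right_counit_F: "slice_right (\<lambda>y. counit (F_act q y)) (coproduct q x) = F_act q x"
proof (induction x rule: free_induct)
  case (letter g x)
  show ?case
    using q_pos
    by (cases g) (simp_all add: coproduct_letter_mult F_act_letter_mult left_diff_distrib distrib_right
      slice_right_diff slice_right_add slice_right_cscale slice_right_letter_mult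
      F_act_cscale counit_add counit_diff counit_cscale counit_minus counit_mult slice_right_functional_scale counit_letter
      slice_right_functional_add slice_right_functional_minus_divide cscale_minus_right cscale_add_right slice_right_counit_K cscale_minus_left
      slice_right_functional_scale[where f = "\<lambda>_. 0" and z = 0, simplified] letter mult.assoc)
qed (simp_all add: slice_right_1 coproduct_cscale coproduct_add slice_right_cscale slice_right_add
      F_act_cscale F_act_add)

end


section \<open>The Haar state on powers of B0\<close>

locale haar_su2 = quantum_su2 +
  fixes h :: "free \<Rightarrow> complex"
  assumes haar: "haar_state q h"
begin

lemma h_add: "h (x + y) = h x + h y"
  and h_cscale: "h (cscale z x) = z * h x"
  and h_ideal: "u \<in> suq_ideal q \<Longrightarrow> h u = 0"
  and h_1 [simp]: "h 1 = 1"
  and h_pos: "h (star x * x) \<in> \<real>" "0 \<le> Re (h (star x * x))"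
  and h_left_invariant: "slice_left h (coproduct q x) \<approx> cscale (h x) 1"
  using haar unfolding haar_state_def suq_class_eq_iff by blast+

lemmas h_minus = additive_minus[of h, OF h_add]
lemmas h_diff = additive_diff[of h, OF h_add]

lemma h_0 [simp]: "h 0 = 0"
  using h_cscale[of 0 0] by simp

lemma h_cong: "x \<approx> y \<Longrightarrow> h x = h y"
  using h_ideal[of "x - y"] by (simp add: suq_cong_def h_diff)

text \<open>Exchanging the two slices and using left invariance turns \<open>h (F_act q x)\<close>
  into \<open>h x\<close> times \<open>counit (F_act q 1)\<close>, and
  \<open>F_act q 1 = 0\<close>.\<close>

lemma h_F: "h (F_act q x) = 0"
proof -
  let ?psi = "\<lambda>y. counit (F_act q y)"
  have "h (F_act q x) = h (slice_right ?psi (coproduct q x))"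
    by (simp add: slice_right_counit_F)
  also have "\<dots> = ?psi (slice_left h (coproduct q x))"
    by (rule slice_exchange) (simp_all add: h_add h_cscale F_act_add F_act_cscale counit_add counit_cscale)
  also have "\<dots> = ?psi (cscale (h x) 1)"
    using counit_suq_ideal[of "F_act q (slice_left h (coproduct q x)) - F_act q (cscale (h x) 1)"]
      suq_cong_act(3)[OF h_left_invariant[of x]]
    by (simp add: suq_cong_def counit_diff)
  finally show ?thesis
    by (simp add: F_act_cscale)
qed

lemma F_B0_power_mult:
  "F_act q (B0 ^ m) * (gcs * gas) \<approx> - cscale (kappa * (1 - sigma ^ (4 * m)) * sigma ^ 2) (B0 ^ m * (ga * gas))"
proof (cases m)
  case (Suc n)
  let ?k = "kappa * (1 - sigma ^ (4 * m))"
  have "F_act q (B0 ^ m) * (gcs * gas) \<approx> - cscale ?k (B0 ^ n * gc * ga) * (gcs * gas)"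
    unfolding Suc by (intro suq_cong_mult_right F_B0_power)
  also have "\<dots> = - cscale ?k (B0 ^ n * gc * (ga * gcs) * gas)"
    by (simp add: mult.assoc)
  also have "\<dots> \<approx> - cscale ?k (B0 ^ n * gc * cscale (sigma ^ 2) (gcs * ga) * gas)"
    by (intro suq_cong_minus suq_cong_cscale suq_cong_mult suq_cong_refl relations)
  also have "\<dots> = - cscale (?k * sigma ^ 2) (B0 ^ m * (ga * gas))"
    by (simp add: Suc B0_def mult.assoc power_Suc2 del: power_Suc)
  finally show ?thesis .
qed simp

text \<open>\<open>h_F\<close> is applied to \<open>B0 ^ m * (gcs * gas)\<close>. This element has
  weight 2, so its image has weight 0 and reduces to a polynomial in \<open>B0\<close> that involves
  only two consecutive powers.\<close>

lemma h_B0_power_Suc: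
  "h (B0 ^ m) * (1 - sigma ^ (4 * m + 4)) = h (B0 ^ Suc m) * (1 - sigma ^ (4 * m + 8))"
proof -
  let ?k = "kappa * (1 - sigma ^ (4 * m)) * sigma ^ 4"
  have aas: "ga * gas \<approx> 1 - cscale (sigma ^ 4) B0"
    unfolding B0_def by (rule suq_cong_addD(1)[OF relations(5)])
  have csc: "gcs * gc \<approx> B0"
    unfolding B0_def by (rule suq_cong_sym[OF relations(3)])
  have "F_act q (B0 ^ m * (gcs * gas)) =
      cscale (sigma ^ 2) (F_act q (B0 ^ m) * (gcs * gas)) +
      B0 ^ m * (- cscale (1 / sigma) (ga * gas) + cscale (1 / sigma) (gcs * gc))"
    by (simp add: F_act_mult K_act_mult K_gen_sigma F_gen_sigma power2_eq_square cscale_minus_right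
        del: K_gen.simps Kinv_gen.simps F_gen.simps(4))
  also have "\<dots> \<approx> cscale (sigma ^ 2) (- cscale (kappa * (1 - sigma ^ (4 * m)) * sigma ^ 2) (B0 ^ m * (ga * gas)))
      + B0 ^ m * (- cscale (1 / sigma) (ga * gas) + cscale (1 / sigma) (gcs * gc))"
    by (intro suq_cong_add suq_cong_cscale F_B0_power_mult suq_cong_refl)
  also have "\<dots> = - cscale ?k (B0 ^ m * (ga * gas))
      + B0 ^ m * (- cscale (1 / sigma) (ga * gas) + cscale (1 / sigma) (gcs * gc))"
  proof -
    have "sigma ^ 2 * (kappa * (1 - sigma ^ (4 * m)) * sigma ^ 2) = ?k"
      by (simp add: power2_eq_square power4_eq_xxxx)
    then show ?thesis by (simp only: cscale_minus_right cscale_cscale)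
  qed
  also have "\<dots> \<approx> - cscale ?k (B0 ^ m * (1 - cscale (sigma ^ 4) B0))
      + B0 ^ m * (- cscale (1 / sigma) (1 - cscale (sigma ^ 4) B0) + cscale (1 / sigma) B0)"
    by (intro suq_cong_add suq_cong_minus suq_cong_cscale suq_cong_mult suq_cong_refl aas csc)
  finally have "h (F_act q (B0 ^ m * (gcs * gas))) = h (- cscale ?k (B0 ^ m * (1 - cscale (sigma ^ 4) B0))
      + B0 ^ m * (- cscale (1 / sigma) (1 - cscale (sigma ^ 4) B0) + cscale (1 / sigma) B0))"
    by (rule h_cong)
  moreover have "B0 ^ m * B0 = B0 ^ Suc m"
    by (simp add: power_commutes)
  ultimately have "0 = - ?k * (h (B0 ^ m) - sigma ^ 4 * h (B0 ^ Suc m))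
      + (- (1 / sigma) * (h (B0 ^ m) - sigma ^ 4 * h (B0 ^ Suc m)) + 1 / sigma * h (B0 ^ Suc m))"
    by (simp only: h_F h_add h_diff h_minus h_cscale distrib_left right_diff_distrib mult_1_right
        cscale_mult_right mult_minus_right cscale_distribs mult_minus_left cscale_cscale)
      (simp only: mult.assoc minus_diff_eq diff_minus_eq_add uminus_add_conv_diff)
  moreover have "1 / sigma = kappa * (1 - sigma ^ 4)"
    by (simp add: kappa_def)
  ultimately have "0 = kappa * ((- (1 - sigma ^ (4 * m)) * sigma ^ 4) * (h (B0 ^ m) - sigma ^ 4 * h (B0 ^ Suc m))
      - (1 - sigma ^ 4) * (h (B0 ^ m) - sigma ^ 4 * h (B0 ^ Suc m)) + (1 - sigma ^ 4) * h (B0 ^ Suc m))"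
    by (simp only:) (simp add: algebra_simps del: power_Suc)
  moreover have "kappa \<noteq> 0"
    by (simp add: kappa_def)
  ultimately have "(- (1 - sigma ^ (4 * m)) * sigma ^ 4) * (h (B0 ^ m) - sigma ^ 4 * h (B0 ^ Suc m))
      - (1 - sigma ^ 4) * (h (B0 ^ m) - sigma ^ 4 * h (B0 ^ Suc m)) + (1 - sigma ^ 4) * h (B0 ^ Suc m) = 0"
    by (metis mult_eq_0_iff)
  \<comment> \<open>Here \<open>s\<close> stands for \<open>sigma ^ 4\<close> and \<open>p\<close>
    for \<open>sigma ^ (4 * m)\<close>; the identity is polynomial in these as independent
    variables.\<close>
  moreover have "x * (1 - p * s) = y * (1 - p * s * s)"
    if "(- (1 - p) * s) * (x - s * y) - (1 - s) * (x - s * y) + (1 - s) * y = 0" for p s x y :: complex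
    using that by algebra
  ultimately have "h (B0 ^ m) * (1 - sigma ^ (4 * m) * sigma ^ 4) =
      h (B0 ^ Suc m) * (1 - sigma ^ (4 * m) * sigma ^ 4 * sigma ^ 4)"
    by blast
  moreover have "sigma ^ (4 * m + 8) = sigma ^ (4 * m) * sigma ^ 4 * sigma ^ 4"
    "sigma ^ (4 * m + 4) = sigma ^ (4 * m) * sigma ^ 4"
    by (simp_all add: add.commute flip: power_add)
  ultimately show ?thesis
    by (simp only:)
qed

text \<open>By the recursion \<open>h (B0 ^ m) * (1 - q ^ (2 * m + 2))\<close> does not depend on
  \<open>m\<close>, and at \<open>m = 0\<close> it is \<open>1 - q^2\<close>.\<close>

lemma h_B0_power: "h (B0 ^ m) = complex_of_real ((1 - q\<^sup>2) / (1 - q ^ (2 * m + 2)))"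
proof -
  have "h (B0 ^ m) * (1 - sigma ^ (4 * m + 4)) = 1 - sigma ^ 4"
  proof (induction m)
    case (Suc m)
    have "4 * Suc m + 4 = 4 * m + 8" by simp
    then show ?case using Suc h_B0_power_Suc[of m] by (simp only:)
  qed simp
  moreover have "complex_of_real (q ^ (2 * m + 2)) = sigma ^ (4 * m + 4)"
  proof -
    have "2 * (2 * m + 2) = 4 * m + 4" by simp
    then show ?thesis by (metis of_real_power of_real_q power_mult)
  qed
  moreover have "sigma ^ (4 * m + 4) \<noteq> 1"
  proof -
    have "2 * (2 * m + 2) = 4 * m + 4" by simp
    then show ?thesis using sigma_power_ne_1[of "2 * m + 2"] by (simp only: zero_less_Suc add_2_eq_Suc') simp
  qed
  ultimately show ?thesis
    by (simp add: of_real_q2 field_simps del: of_real_power)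
qed


section \<open>The L2 norm\<close>

abbreviation N :: "free \<Rightarrow> real" where "N \<equiv> l2_norm h"

lemma N_nonneg [simp]: "0 \<le> N x"
  using h_pos by (simp add: l2_norm_def)

lemma N_square: "complex_of_real ((N x)\<^sup>2) = h (star x * x)"
  using h_pos[of x] by (simp add: l2_norm_def complex_is_Real_iff complex_eq_iff)

lemma N_square_Re: "(N x)\<^sup>2 = Re (h (star x * x))"
  using h_pos[of x] by (simp add: l2_norm_def)

lemma N_eq_sqrt: "h (star x * x) = complex_of_real r \<Longrightarrow> N x = sqrt r"
  by (simp add: l2_norm_def)

text \<open>Polarization: positivity makes \<open>h (star z * z)\<close> real, and the imaginary
  parts for \<open>z = x + y\<close> and \<open>z = x + \<i> y\<close> give the two real equations
  required.\<close>

lemma h_hermitian: "h (star y * x) = cnj (h (star x * y))"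
proof -
  let ?B = "h (star x * y)" and ?C = "h (star y * x)"
  have expand: "h (star (x + cscale l y) * (x + cscale l y)) =
      h (star x * x) + l * ?B + cnj l * ?C + cnj l * l * h (star y * y)" for l
    by (simp add: star_add star_cscale algebra_simps h_add h_cscale)
  have real: "Im (h (star z * z)) = 0" for z
    using h_pos(1)[of z] by (simp add: complex_is_Real_iff)
  have "Im (?B + ?C) = 0" "Im (\<i> * ?B - \<i> * ?C) = 0"
    using real[of "x + cscale 1 y"] real[of "x + cscale \<i> y"] real[of x] real[of y]
    unfolding expand by simp_all
  then show ?thesis
    by (simp add: complex_eq_iff)
qed

lemma N_add_square:
  "(N (x + cscale l y))\<^sup>2 = (N x)\<^sup>2 + 2 * Re (l * h (star x * y)) + (cmod l)\<^sup>2 * (N y)\<^sup>2"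
proof -
  have "h (star (x + cscale l y) * (x + cscale l y)) =
      h (star x * x) + l * h (star x * y) + cnj (l * h (star x * y)) + cnj l * l * h (star y * y)"
    by (simp add: star_add star_cscale algebra_simps h_add h_cscale h_hermitian[of y x])
  also have "cnj l * l = complex_of_real ((cmod l)\<^sup>2)"
    by (simp only: complex_norm_square mult.commute)
  finally show ?thesis
    by (simp add: N_square_Re)
qed

lemma Cauchy_Schwarz: "cmod (h (star x * y)) \<le> N x * N y"
proof -
  define b where "b = h (star x * y)"
  have quad: "0 \<le> (N x)\<^sup>2 - 2 * t * (cmod b)\<^sup>2 + t\<^sup>2 * (cmod b)\<^sup>2 * (N y)\<^sup>2" for t :: real
  proof -
    have "Re (- complex_of_real t * cnj b * b) = - t * (cmod b)\<^sup>2"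
    proof -
      have "cnj b * b = complex_of_real ((cmod b)\<^sup>2)"
        by (simp only: complex_norm_square mult.commute)
      then show ?thesis
        by (simp only: mult.assoc) simp
    qed
    moreover have "(cmod (- complex_of_real t * cnj b))\<^sup>2 = t\<^sup>2 * (cmod b)\<^sup>2"
      by (simp add: norm_mult power_mult_distrib)
    ultimately show ?thesis
      using N_add_square[of x "- complex_of_real t * cnj b" y]
        zero_le_power2[of "N (x + cscale (- complex_of_real t * cnj b) y)"]
      by (simp add: b_def[symmetric])
  qed
  show ?thesis
  proof (cases "N y = 0")
    case True
    have "b = 0"
    proof (rule ccontr)
      assume "b \<noteq> 0"
      then have "0 < (cmod b)\<^sup>2" by simp
      \<comment> \<open>As \<open>N y = 0\<close>, the bound is linear in \<open>t\<close>; the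
        chosen \<open>t\<close> gives it the value -1.\<close>
      then show False
        using quad[of "((N x)\<^sup>2 + 1) / (2 * (cmod b)\<^sup>2)"] True by (simp add: field_simps)
    qed
    then show ?thesis by (simp add: b_def)
  next
    case False
    define D where "D = (N y)\<^sup>2"
    have D: "0 < D" using False by (simp add: D_def)
    \<comment> \<open>\<open>1 / D\<close> is the minimum point of the quadratic.\<close>
    have "(1 / D)\<^sup>2 * (cmod b)\<^sup>2 * D = (cmod b)\<^sup>2 / D"
      using D by (simp add: power2_eq_square)
    then have "(cmod b)\<^sup>2 / D \<le> (N x)\<^sup>2"
      using quad[of "1 / D", folded D_def] by simp
    then have "(cmod b)\<^sup>2 \<le> (N x)\<^sup>2 * (N y)\<^sup>2"
      using D by (simp add: divide_le_eq flip: D_def)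
    then show ?thesis
      unfolding b_def[symmetric] by (simp add: power_mono_iff flip: power_mult_distrib)
  qed
qed

lemma N_triangle: "N (x + y) \<le> N x + N y"
proof -
  have "(N (x + y))\<^sup>2 = (N x)\<^sup>2 + 2 * Re (h (star x * y)) + (N y)\<^sup>2"
    using N_add_square[of x 1 y] by simp
  also have "\<dots> \<le> (N x)\<^sup>2 + 2 * (N x * N y) + (N y)\<^sup>2"
    using complex_Re_le_cmod[of "h (star x * y)"] Cauchy_Schwarz[of x y] by simp
  also have "\<dots> = (N x + N y)\<^sup>2"
    by (simp add: power2_sum)
  finally show ?thesis
    by (rule power2_le_imp_le) simp
qed

lemma N_cscale: "N (cscale z x) = cmod z * N x"
proof -
  have "(N (cscale z x))\<^sup>2 = (cmod z * N x)\<^sup>2"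
    using N_add_square[of 0 z x] by (simp add: power_mult_distrib l2_norm_def)
  then show ?thesis
    by (simp add: power2_eq_iff_nonneg)
qed

lemma N_cong:
  assumes "x \<approx> y" shows "N x = N y"
proof -
  have "N (x - y) = 0"
    using assms by (simp add: l2_norm_def suq_cong_def h_ideal suq_ideal_mult_left)
  moreover have "N (y - x) = N (x - y)"
    using N_cscale[of "-1" "x - y"] by (simp add: cscale_uminus_one)
  ultimately show ?thesis
    using N_triangle[of "x - y" y] N_triangle[of "y - x" x] by simp
qed

lemma N_zero [simp]: "N 0 = 0"
  by (simp add: l2_norm_def)

lemma N_minus [simp]: "N (- x) = N x"
  using N_cscale[of "-1" x] by (simp add: cscale_uminus_one)

lemma N_diff: "N (x - y) \<le> N x + N y"
  using N_triangle[of x "- y"] by simp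

text \<open>The two sphere relations and the normality of \<open>gc\<close>, sandwiched between
  \<open>star x\<close> and \<open>x\<close>.\<close>

lemma N_gen:
  "(N (ga * x))\<^sup>2 + (N (gc * x))\<^sup>2 = (N x)\<^sup>2"
  "N (gcs * x) = N (gc * x)"
  "(N (gas * x))\<^sup>2 + (q * N (gc * x))\<^sup>2 = (N x)\<^sup>2"
proof -
  have inner: "complex_of_real ((N (letter g * x))\<^sup>2) = h (star x * (letter (adj g) * letter g) * x)" for g
    unfolding N_square by (simp add: star_mult star_letter mult.assoc)
  have "complex_of_real ((N (ga * x))\<^sup>2 + (N (gc * x))\<^sup>2) = h (star x * (gas * ga + gcs * gc) * x)"
    by (simp add: inner h_add algebra_simps del: of_real_power)
  also have "\<dots> = h (star x * 1 * x)"
    by (intro h_cong suq_cong_mult suq_cong_refl relations)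
  finally show "(N (ga * x))\<^sup>2 + (N (gc * x))\<^sup>2 = (N x)\<^sup>2"
    by (simp only: N_square[symmetric] of_real_eq_iff mult_1_right)
  have "complex_of_real ((N (gcs * x))\<^sup>2) = complex_of_real ((N (gc * x))\<^sup>2)"
    unfolding inner adj.simps by (intro h_cong suq_cong_mult suq_cong_refl relations)
  then have c: "(N (gcs * x))\<^sup>2 = (N (gc * x))\<^sup>2"
    by (simp only: of_real_eq_iff)
  then show "N (gcs * x) = N (gc * x)"
    by (simp add: power2_eq_iff_nonneg)
  have "complex_of_real ((N (gas * x))\<^sup>2 + (q * N (gcs * x))\<^sup>2) =
      h (star x * (ga * gas + cscale (sigma ^ 4) (gc * gcs)) * x)"
    by (simp add: inner h_add h_cscale algebra_simps power_mult_distrib of_real_q2 del: of_real_power)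
  also have "\<dots> = h (star x * 1 * x)"
    by (intro h_cong suq_cong_mult suq_cong_refl relations)
  finally have "(N (gas * x))\<^sup>2 + (q * N (gcs * x))\<^sup>2 = (N x)\<^sup>2"
    by (simp only: N_square[symmetric] of_real_eq_iff mult_1_right)
  then show "(N (gas * x))\<^sup>2 + (q * N (gc * x))\<^sup>2 = (N x)\<^sup>2"
    by (simp add: c power_mult_distrib)
qed

lemma N_letter_le: "N (letter g * x) \<le> N x"
proof (rule power2_le_imp_le)
  show "(N (letter g * x))\<^sup>2 \<le> (N x)\<^sup>2"
    using N_gen[of x] zero_le_power2[of "N (ga * x)"] zero_le_power2[of "N (gc * x)"]
      zero_le_power2[of "q * N (gc * x)"] zero_le_power2[of "N (gas * x)"]
    by (cases g; simp only:; linarith)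
qed simp

text \<open>Letters act as contractions. The bound makes the supremum in \<open>gns_norm\<close>
  finite and later controls the approximate inverses.\<close>

lemma N_mult_bounded: "\<exists>C\<ge>0. \<forall>y. N (x * y) \<le> C * N y"
proof (induction x rule: free_induct)
  case one
  show ?case by (intro exI[of _ 1]) simp
next
  case (letter g x)
  then obtain C where "C \<ge> 0" "\<And>y. N (x * y) \<le> C * N y" by blast
  then have "N (letter g * x * y) \<le> C * N y" for y
    using order_trans[OF N_letter_le] by (simp add: mult.assoc)
  then show ?case
    using \<open>C \<ge> 0\<close> by blast
next
  case (cscale z x)
  then obtain C where "C \<ge> 0" "\<And>y. N (x * y) \<le> C * N y" by blast
  then show ?case
    by (intro exI[of _ "cmod z * C"]) (auto simp: N_cscale mult.assoc intro!: mult_left_mono)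
next
  case (add x1 x2)
  then obtain C D where "C \<ge> 0" "\<And>y. N (x1 * y) \<le> C * N y" "D \<ge> 0" "\<And>y. N (x2 * y) \<le> D * N y"
    by blast
  then have "N ((x1 + x2) * y) \<le> (C + D) * N y" for y
    unfolding distrib_right by (intro order_trans[OF N_triangle] add_mono) auto
  then show ?case
    using \<open>C \<ge> 0\<close> \<open>D \<ge> 0\<close> by (intro exI[of _ "C + D"]) simp
qed

end


section \<open>Finiteness of the universal norm\<close>

context quantum_su2
begin

context
  fixes s assumes s: "cstar_seminorm q s"
begin

lemma cstar_seminorm_triangle: "s (x + y) \<le> s x + s y"
  and cstar_seminorm_cscale: "s (cscale z x) = cmod z * s x"
  and cstar_seminorm_mult: "s (x * y) \<le> s x * s y"
  and cstar_seminorm_star: "s (star x * x) = (s x)\<^sup>2"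
  and cstar_seminorm_ideal: "u \<in> suq_ideal q \<Longrightarrow> s u = 0"
  using s by (auto simp: cstar_seminorm_def)

lemma cstar_seminorm_minus: "s (- x) = s x"
  using cstar_seminorm_cscale[of "-1" x] by (simp add: cscale_uminus_one)

lemma cstar_seminorm_nonneg: "0 \<le> s x"
  using cstar_seminorm_triangle[of x "- x"] cstar_seminorm_cscale[of 0 x] by (simp add: cstar_seminorm_minus)

lemma cstar_seminorm_cong:
  assumes "x \<approx> y" shows "s x \<le> s y"
  using cstar_seminorm_triangle[of "x - y" y] assms by (simp add: suq_cong_def cstar_seminorm_ideal)

lemma cstar_seminorm_1: "s 1 \<le> 1"
proof -
  have "s 1 = (s 1)\<^sup>2"
    using cstar_seminorm_star[of 1] by simp
  then have "s 1 * (s 1 - 1) = 0"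
    by algebra
  then show ?thesis by auto
qed

lemma cstar_seminorm_adj: "s (star x) = s x"
proof -
  have le: "s x \<le> s (star x)" for x
  proof (cases "s x = 0")
    case False
    have "s x * s x \<le> s (star x) * s x"
      using cstar_seminorm_mult[of "star x" x] by (simp add: cstar_seminorm_star power2_eq_square)
    then show ?thesis
      using False cstar_seminorm_nonneg[of x] by simp
  qed (simp add: cstar_seminorm_nonneg)
  show ?thesis
    using le[of x] le[of "star x"] by simp
qed

(* q^2 a^* a - a a^* = q^2 - 1 bounds the norm of a without using positivity. *)
lemma cstar_seminorm_letter: "s (letter g) \<le> 2"
proof -
  have aas: "s (ga * gas) = (s ga)\<^sup>2"
    using cstar_seminorm_star[of gas] cstar_seminorm_adj[of ga] by (simp add: star_letter)
  have "ga * gas \<approx> cscale (sigma ^ 4) (gas * ga) + cscale (1 - sigma ^ 4) 1"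
  proof -
    have "ga * gas \<approx> 1 - cscale (sigma ^ 4) (gc * gcs)"
      by (rule suq_cong_addD(1)[OF relations(5)])
    also have "\<dots> \<approx> 1 - cscale (sigma ^ 4) (1 - gas * ga)"
      by (intro suq_cong_diff suq_cong_cscale suq_cong_refl suq_cong_trans[OF relations(3)]
          suq_cong_addD(2)[OF relations(4)])
    also have "\<dots> = cscale (sigma ^ 4) (gas * ga) + cscale (1 - sigma ^ 4) 1"
      by (simp add: cscale_distribs cscale_diff_left)
    finally show ?thesis .
  qed
  then have "s (ga * gas) \<le> s (cscale (sigma ^ 4) (gas * ga) + cscale (1 - sigma ^ 4) 1)"
    by (rule cstar_seminorm_cong)
  also have "\<dots> \<le> s (cscale (sigma ^ 4) (gas * ga)) + s (cscale (1 - sigma ^ 4) 1)"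
    by (rule cstar_seminorm_triangle)
  also have "\<dots> = q\<^sup>2 * (s ga)\<^sup>2 + (1 - q\<^sup>2) * s 1"
  proof -
    have "cmod (sigma ^ 4) = q\<^sup>2"
      unfolding of_real_q2[symmetric] norm_of_real by simp
    moreover have "1 - sigma ^ 4 = complex_of_real (1 - q\<^sup>2)"
      by (simp only: of_real_diff of_real_1 of_real_q2)
    then have "cmod (1 - sigma ^ 4) = 1 - q\<^sup>2"
      using q_power_less_1[of 2] by (simp only: norm_of_real) simp
    ultimately show ?thesis
      using cstar_seminorm_star[of ga] by (simp add: cstar_seminorm_cscale star_letter)
  qed
  also have "\<dots> \<le> q\<^sup>2 * (s ga)\<^sup>2 + (1 - q\<^sup>2) * 1"
    using q_power_less_1[of 2] cstar_seminorm_1 by (intro add_left_mono mult_left_mono) simp_all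
  finally have "(s ga)\<^sup>2 * (1 - q\<^sup>2) \<le> 1 * (1 - q\<^sup>2)"
    by (simp add: aas algebra_simps)
  then have a2: "(s ga)\<^sup>2 \<le> 1"
    by (rule mult_right_le_imp_le) (use q_power_less_1[of 2] in simp)
  have "(s gc)\<^sup>2 = s (gcs * gc)"
    using cstar_seminorm_star[of gc] by (simp add: star_letter)
  also have "\<dots> \<le> s (1 - gas * ga)"
    by (intro cstar_seminorm_cong suq_cong_addD(2)[OF relations(4)])
  also have "\<dots> \<le> s 1 + (s ga)\<^sup>2"
    using cstar_seminorm_triangle[of 1 "- (gas * ga)"] cstar_seminorm_star[of ga]
    by (simp add: star_letter cstar_seminorm_minus)
  also have "\<dots> \<le> 2\<^sup>2"
    using a2 cstar_seminorm_1 by simp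
  finally have "s gc \<le> 2"
    by (rule power2_le_imp_le) simp
  moreover have "s ga \<le> 2"
    using a2 by (intro order_trans[OF power2_le_imp_le[of "s ga" 1]]) simp_all
  ultimately show ?thesis
    using cstar_seminorm_adj[of ga] cstar_seminorm_adj[of gc]
    by (cases g) (simp_all add: star_letter)
qed

end

text \<open>The real supremum in \<open>univ_norm\<close> has its meaning only over a bounded
  family; the common bound on the letters propagates to all elements.\<close>

lemma cstar_seminorm_bounded: "\<exists>C\<ge>0. \<forall>s. cstar_seminorm q s \<longrightarrow> s x \<le> C"
proof (induction x rule: free_induct)
  case one
  show ?case
    by (rule exI[of _ 1], intro conjI allI impI, simp, rule cstar_seminorm_1)
next
  case (letter g x)
  then obtain C where C: "C \<ge> 0" "\<And>s. cstar_seminorm q s \<Longrightarrow> s x \<le> C" by blast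
  have "s (letter g * x) \<le> 2 * C" if s: "cstar_seminorm q s" for s
  proof -
    have "s (letter g * x) \<le> s (letter g) * s x"
      by (rule cstar_seminorm_mult[OF s])
    also have "\<dots> \<le> 2 * C"
      by (intro mult_mono cstar_seminorm_letter[OF s] C(2)[OF s] cstar_seminorm_nonneg[OF s]) simp
    finally show ?thesis .
  qed
  moreover have "0 \<le> 2 * C" using C(1) by simp
  ultimately show ?case by blast
next
  case (cscale z x)
  then obtain C where C: "C \<ge> 0" "\<And>s. cstar_seminorm q s \<Longrightarrow> s x \<le> C" by blast
  have "s (cscale z x) \<le> cmod z * C" if s: "cstar_seminorm q s" for s
    unfolding cstar_seminorm_cscale[OF s] by (intro mult_left_mono C(2)[OF s]) simp
  moreover have "0 \<le> cmod z * C" using C(1) by simp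
  ultimately show ?case by blast
next
  case (add x y)
  then obtain C D where C: "C \<ge> 0" "\<And>s. cstar_seminorm q s \<Longrightarrow> s x \<le> C"
      and D: "D \<ge> 0" "\<And>s. cstar_seminorm q s \<Longrightarrow> s y \<le> D" by blast
  have "s (x + y) \<le> C + D" if s: "cstar_seminorm q s" for s
    by (rule order_trans[OF cstar_seminorm_triangle[OF s]], intro add_mono C(2)[OF s] D(2)[OF s])
  moreover have "0 \<le> C + D" using C(1) D(1) by simp
  ultimately show ?case by blast
qed

abbreviation p :: "free \<Rightarrow> real" where "p \<equiv> univ_norm q"

lemma cstar_seminorm_le_univ_norm:
  assumes "cstar_seminorm q s" shows "s x \<le> p x"
proof -
  obtain C where C: "\<forall>s. cstar_seminorm q s \<longrightarrow> s x \<le> C"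
    using cstar_seminorm_bounded[of x] by blast
  have "bdd_above ((\<lambda>s. s x) ` Collect (cstar_seminorm q))"
    by (rule bdd_aboveI2[of _ _ C]) (use C in blast)
  then show ?thesis
    unfolding univ_norm_def using assms by (intro cSUP_upper) simp_all
qed

lemma cstar_seminorm_zero: "cstar_seminorm q (\<lambda>_. 0)"
  by (simp add: cstar_seminorm_def)

lemma univ_norm_least:
  assumes "\<And>s. cstar_seminorm q s \<Longrightarrow> s x \<le> C" shows "p x \<le> C"
  unfolding univ_norm_def
proof (rule cSUP_least)
  show "Collect (cstar_seminorm q) \<noteq> {}"
    using cstar_seminorm_zero by blast
qed (use assms in blast)

lemma univ_norm_nonneg [simp]: "0 \<le> p x"
  using cstar_seminorm_le_univ_norm[OF cstar_seminorm_zero] .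

lemma univ_norm_triangle: "p (x + y) \<le> p x + p y"
proof (rule univ_norm_least)
  fix s assume s: "cstar_seminorm q s"
  show "s (x + y) \<le> p x + p y"
    by (rule order_trans[OF cstar_seminorm_triangle[OF s]], intro add_mono cstar_seminorm_le_univ_norm[OF s])
qed

lemma univ_norm_minus [simp]: "p (- x) = p x"
proof -
  have "p (- x) \<le> p x" for x
  proof (rule univ_norm_least)
    fix s assume s: "cstar_seminorm q s"
    show "s (- x) \<le> p x"
      using cstar_seminorm_le_univ_norm[OF s, of x] by (simp add: cstar_seminorm_minus[OF s])
  qed
  from this[of x] this[of "- x"] show ?thesis by simp
qed

lemma univ_norm_zero [simp]: "p 0 = 0"
proof (rule antisym)
  show "p 0 \<le> 0"
  proof (rule univ_norm_least)
    fix s assume "cstar_seminorm q s"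
    from cstar_seminorm_ideal[OF this suq_ideal.zero] show "s 0 \<le> 0" by simp
  qed
qed simp

end

section \<open>The GNS representation\<close>

context haar_su2
begin

text \<open>The operator norm of left multiplication on the GNS space, computed on the dense image
  of the algebra. Being a C*-seminorm it lies below \<open>univ_norm\<close>, which links the two
  norms.\<close>

definition gns_norm :: "free \<Rightarrow> real" where
  "gns_norm x = (SUP y\<in>{y. N y \<le> 1}. N (x * y))"

lemma gns_norm_least: "(\<And>y. N y \<le> 1 \<Longrightarrow> N (x * y) \<le> C) \<Longrightarrow> gns_norm x \<le> C"
  unfolding gns_norm_def by (intro cSUP_least) (auto intro: exI[of _ 0])

lemma gns_norm_upper: "N y \<le> 1 \<Longrightarrow> N (x * y) \<le> gns_norm x"
proof -
  obtain C where C: "C \<ge> 0" "\<And>y. N (x * y) \<le> C * N y"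
    using N_mult_bounded by blast
  have "bdd_above ((\<lambda>y. N (x * y)) ` {y. N y \<le> 1})"
  proof (rule bdd_aboveI2)
    fix y assume "y \<in> {y. N y \<le> 1}"
    then show "N (x * y) \<le> C"
      using C(2)[of y] mult_left_mono[OF _ C(1), of "N y" 1] by simp
  qed
  then show "N y \<le> 1 \<Longrightarrow> N (x * y) \<le> gns_norm x"
    unfolding gns_norm_def by (intro cSUP_upper) simp_all
qed

lemma gns_norm_nonneg: "0 \<le> gns_norm x"
  using gns_norm_upper[of 0 x] by simp

lemma N_mult_le_gns: "N (x * y) \<le> gns_norm x * N y"
proof (cases "N y = 0")
  case True
  obtain C where "\<And>y. N (x * y) \<le> C * N y"
    using N_mult_bounded by blast
  from this[of y] True show ?thesis by simp
next
  case False
  then have pos: "0 < N y"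
    using N_nonneg[of y] by linarith
  let ?z = "complex_of_real (1 / N y)"
  have "N (cscale ?z y) = 1"
    using pos by (simp add: N_cscale norm_divide)
  then have "N (x * cscale ?z y) \<le> gns_norm x"
    by (intro gns_norm_upper) simp
  then show ?thesis
    using pos by (simp add: N_cscale norm_divide field_simps)
qed

text \<open>Cauchy-Schwarz bounds \<open>h (star y * (star x * x * y))\<close>, the square of
  \<open>N (x * y)\<close>, by the norm of \<open>star x * x\<close>. With submultiplicativity this
  gives invariance under \<open>star\<close>, and then the reverse inequality.\<close>

lemma gns_norm_star: "gns_norm (star x * x) = (gns_norm x)\<^sup>2"
proof -
  have mult: "gns_norm (x * y) \<le> gns_norm x * gns_norm y" for x y
  proof (rule gns_norm_least)
    fix z assume "N z \<le> 1"
    then show "N (x * y * z) \<le> gns_norm x * gns_norm y"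
      using N_mult_le_gns[of x "y * z"] mult_left_mono[OF gns_norm_upper[of z y] gns_norm_nonneg[of x]]
      by (simp add: mult.assoc)
  qed
  have le: "(gns_norm x)\<^sup>2 \<le> gns_norm (star x * x)" for x
  proof -
    have "gns_norm x \<le> sqrt (gns_norm (star x * x))"
    proof (rule gns_norm_least)
      fix y assume y: "N y \<le> 1"
      have "complex_of_real ((N (x * y))\<^sup>2) = h (star y * (star x * x * y))"
        unfolding N_square by (simp add: star_mult mult.assoc)
      then have "(N (x * y))\<^sup>2 = cmod (h (star y * (star x * x * y)))"
        by (metis norm_of_real abs_power2)
      also have "\<dots> \<le> N y * N (star x * x * y)"
        by (rule Cauchy_Schwarz)
      also have "\<dots> \<le> 1 * gns_norm (star x * x)"
        using y by (intro mult_mono gns_norm_upper) simp_all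
      finally show "N (x * y) \<le> sqrt (gns_norm (star x * x))"
        by (simp add: real_le_rsqrt)
    qed
    then show ?thesis
      using power_mono[OF _ gns_norm_nonneg, of x _ 2] gns_norm_nonneg by fastforce
  qed
  have adj: "gns_norm x \<le> gns_norm (star x)" for x
  proof (cases "gns_norm x = 0")
    case False
    have "gns_norm x * gns_norm x \<le> gns_norm (star x) * gns_norm x"
      using le[of x] mult[of "star x" x] by (simp add: power2_eq_square)
    then show ?thesis
      using False gns_norm_nonneg[of x] by simp
  qed (simp add: gns_norm_nonneg)
  have "gns_norm (star x) = gns_norm x"
    using adj[of x] adj[of "star x"] by simp
  then show ?thesis
    using le[of x] mult[of "star x" x] by (simp add: power2_eq_square)
qed

lemma cstar_seminorm_gns: "cstar_seminorm q gns_norm"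
  unfolding cstar_seminorm_def
proof (intro conjI allI ballI)
  fix x y
  show "gns_norm (x + y) \<le> gns_norm x + gns_norm y"
    by (rule gns_norm_least)
       (auto simp: distrib_right intro!: order_trans[OF N_triangle] add_mono gns_norm_upper)
  show "gns_norm (x * y) \<le> gns_norm x * gns_norm y"
  proof (rule gns_norm_least)
    fix z assume "N z \<le> 1"
    then show "N (x * y * z) \<le> gns_norm x * gns_norm y"
      using N_mult_le_gns[of x "y * z"] mult_left_mono[OF gns_norm_upper[of z y] gns_norm_nonneg[of x]]
      by (simp add: mult.assoc)
  qed
  show "gns_norm (star x * x) = (gns_norm x)\<^sup>2"
    by (rule gns_norm_star)
next
  fix z x
  have le: "gns_norm (cscale z x) \<le> cmod z * gns_norm x" for z x
    by (rule gns_norm_least) (auto simp: N_cscale intro!: mult_left_mono gns_norm_upper)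
  show "gns_norm (cscale z x) = cmod z * gns_norm x"
  proof (cases "z = 0")
    case True
    then show ?thesis using le[of 0 x] gns_norm_nonneg[of 0] by simp
  next
    case False
    then show ?thesis
      using le[of z x] le[of "1 / z" "cscale z x"] by (simp add: norm_divide field_simps)
  qed
next
  fix u assume "u \<in> suq_ideal q"
  then have "N (u * y) = 0" for y
    using N_cong[of "u * y" 0] by (simp add: suq_cong_def suq_ideal_mult_right)
  then show "gns_norm u = 0"
    using gns_norm_nonneg[of u] gns_norm_least[of u 0] by force
qed

text \<open>Through this inequality points of the universal completion act on the GNS
  completion.\<close>

lemma N_mult_le: "N (x * y) \<le> p x * N y"
  using N_mult_le_gns[of x y] mult_right_mono[OF cstar_seminorm_le_univ_norm[OF cstar_seminorm_gns, of x], of "N y"]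
  by simp

end


section \<open>Line modules and connections\<close>

context quantum_su2
begin

definition wt :: "int \<Rightarrow> complex" where "wt n = complex_of_real (q powr (real_of_int n / 2))"

lemma wt_add: "wt (m + n) = wt m * wt n"
  by (simp add: wt_def add_divide_distrib powr_add)

lemma wt_simps [simp]: "wt 0 = 1" "wt 1 = sigma" "wt (- 1) = 1 / sigma"
  using q_pos powr_half powr_minus_half by (simp_all add: wt_def)

lemma line_module_iff: "x \<in> line_module q n \<longleftrightarrow> K_act q x \<approx> cscale (wt n) x"
  by (simp add: line_module_def suq_class_eq_iff wt_def)

lemma line_module_mult:
  assumes "x \<in> line_module q m" "y \<in> line_module q n"
  shows "x * y \<in> line_module q (m + n)"
  using suq_cong_mult[of "K_act q x" "cscale (wt m) x" "K_act q y" "cscale (wt n) y"] assms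
  by (simp add: line_module_iff K_act_mult wt_add mult.commute)

lemma line_module_add:
  "x \<in> line_module q n \<Longrightarrow> y \<in> line_module q n \<Longrightarrow> x + y \<in> line_module q n"
  using suq_cong_add[of "K_act q x" "cscale (wt n) x" "K_act q y" "cscale (wt n) y"]
  by (simp add: line_module_iff K_act_add cscale_add_right)

lemma line_module_cscale: "x \<in> line_module q n \<Longrightarrow> cscale z x \<in> line_module q n"
  using suq_cong_cscale[of "K_act q x" "cscale (wt n) x" z]
  by (simp add: line_module_iff K_act_cscale mult.commute)

lemma line_module_generators:
  "ga \<in> line_module q (- 1)" "gc \<in> line_module q (- 1)" "gas \<in> line_module q 1" "gcs \<in> line_module q 1"
  by (simp_all add: line_module_iff K_gen_sigma del: K_gen.simps)

lemma A_CP_iff: "x \<in> A_CP q \<longleftrightarrow> K_act q x \<approx> x"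
  by (simp add: line_module_iff)

lemma A_CP_1: "1 \<in> A_CP q" and A_CP_0: "0 \<in> A_CP q" and A_CP_B0_power: "B0 ^ m \<in> A_CP q"
  by (simp_all add: A_CP_iff)

lemma A_CP_mult: "x \<in> A_CP q \<Longrightarrow> y \<in> A_CP q \<Longrightarrow> x * y \<in> A_CP q"
  using line_module_mult[of x 0 y 0] by simp

lemma A_CP_Kinv:
  assumes "x \<in> A_CP q" shows "Kinv_act q x \<approx> x"
proof -
  have "Kinv_act q (K_act q x) = x" for x
  proof (induction x rule: free_induct)
    case (letter g x)
    then show ?case
      by (cases g) (simp_all add: K_act_mult Kinv_act_mult Kinv_act_cscale K_gen_sigma del: K_gen.simps Kinv_gen.simps)
  qed (simp_all add: K_act_cscale Kinv_act_cscale K_act_add Kinv_act_add)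
  then show ?thesis
    using suq_cong_act(2)[of "K_act q x" x] assms by (simp add: A_CP_iff suq_cong_sym)
qed

text \<open>The sphere relations are partitions of unity: if everything in degree
  \<open>k + 1\<close> annihilates \<open>y\<close>, then
  \<open>ga * gas + cscale (sigma ^ 4) (gc * gcs)\<close>, congruent to 1, carries this down to
  degree \<open>k\<close>. The relation with \<open>gas * ga\<close> does the same for negative
  degrees, and degree 0 contains 1.\<close>

lemma line_module_annihilator:
  assumes "\<And>s. s \<in> line_module q n \<Longrightarrow> s * y \<approx> 0"
  shows "y \<approx> 0"
proof -
  have pos: "y \<approx> 0" if "\<And>s. s \<in> line_module q (int k) \<Longrightarrow> s * y \<approx> 0" for k
    using that
  proof (induction k)
    case 0
    show ?case using 0[of 1] A_CP_1 by simp
  next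
    case (Suc k)
    have "s * y \<approx> 0" if s: "s \<in> line_module q (int k)" for s
    proof -
      have "gas * s * y \<approx> 0" "gcs * s * y \<approx> 0"
        using line_module_mult[OF line_module_generators(3) s] line_module_mult[OF line_module_generators(4) s]
        by (intro Suc.prems; simp)+
      then have "ga * (gas * s * y) + cscale (sigma ^ 4) (gc * (gcs * s * y)) \<approx> ga * 0 + cscale (sigma ^ 4) (gc * 0)"
        by (intro suq_cong_add suq_cong_cscale suq_cong_mult_left)
      then have "(ga * gas + cscale (sigma ^ 4) (gc * gcs)) * (s * y) \<approx> 0"
        by (simp add: algebra_simps)
      with suq_cong_sym[OF suq_cong_mult_right[OF relations(5)]]
      have "1 * (s * y) \<approx> 0"
        by (rule suq_cong_trans)
      then show ?thesis by simp
    qed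
    then show ?case by (rule Suc.IH)
  qed
  have neg: "y \<approx> 0" if "\<And>s. s \<in> line_module q (- int k) \<Longrightarrow> s * y \<approx> 0" for k
    using that
  proof (induction k)
    case 0
    show ?case using 0[of 1] A_CP_1 by simp
  next
    case (Suc k)
    have "s * y \<approx> 0" if s: "s \<in> line_module q (- int k)" for s
    proof -
      have "ga * s * y \<approx> 0" "gc * s * y \<approx> 0"
        using line_module_mult[OF line_module_generators(1) s] line_module_mult[OF line_module_generators(2) s]
        by (intro Suc.prems; simp)+
      then have "gas * (ga * s * y) + gcs * (gc * s * y) \<approx> gas * 0 + gcs * 0"
        by (intro suq_cong_add suq_cong_mult_left)
      then have "(gas * ga + gcs * gc) * (s * y) \<approx> 0"
        by (simp add: algebra_simps)
      with suq_cong_sym[OF suq_cong_mult_right[OF relations(4)]]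
      have "1 * (s * y) \<approx> 0"
        by (rule suq_cong_trans)
      then show ?thesis by simp
    qed
    then show ?case by (rule Suc.IH)
  qed
  show ?thesis
  proof (cases "0 \<le> n")
    case True
    then show ?thesis by (intro pos[of "nat n"] assms) simp
  next
    case False
    then show ?thesis by (intro neg[of "nat (- n)"] assms) simp
  qed
qed

text \<open>Gauge equivalence is a relation between connections and quantifies over all functions
  that induce them, so the derivative must be recovered from the connection.
  \<open>line_module_annihilator\<close> removes the factor \<open>s\<close>, and
  \<open>K_act\<close> disappears on \<open>A_CP q\<close>.\<close>

lemma connection_eqD:
  assumes "connection q n f1 = connection q n f2" "f1 \<in> A_CP q" "f2 \<in> A_CP q"
  shows "F_act q f1 \<approx> F_act q f2"
proof -
  define w where "w = complex_of_real (q powr real_of_int (2 - n))"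
  have w: "w \<noteq> 0" using q_pos by (simp add: w_def)
  have "s * (X_minus q f1 - X_minus q f2) \<approx> 0" if s: "s \<in> line_module q n" for s
  proof -
    have "suq_class q (nabla0 q n s - twisted_flip q n s (X_minus q f1)) =
        suq_class q (nabla0 q n s - twisted_flip q n s (X_minus q f2))"
      using fun_cong[OF assms(1), of s] s by (simp add: connection_def)
    then have "cscale w (s * (X_minus q f2 - X_minus q f1)) \<in> suq_ideal q"
      unfolding suq_class_eq_iff
      by (simp add: suq_cong_def twisted_flip_def w_def right_diff_distrib cscale_diff_right)
    from suq_ideal_cscale[OF this, of "- (1 / w)"] w show ?thesis
      by (simp add: suq_cong_def right_diff_distrib cscale_distribs cscale_minus_left)
  qed
  then have "X_minus q f1 - X_minus q f2 \<approx> 0"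
    by (rule line_module_annihilator)
  then have "X_minus q f1 \<approx> X_minus q f2"
    by (simp add: suq_cong_def)
  then have "cscale sigma (X_minus q f1) \<approx> cscale sigma (X_minus q f2)"
    by (rule suq_cong_cscale)
  then have K: "F_act q (K_act q f1) \<approx> F_act q (K_act q f2)"
    unfolding X_minus_def powr_minus_half by simp
  have "F_act q f1 \<approx> F_act q (K_act q f1)"
    using assms(2) by (intro suq_cong_act suq_cong_sym[of "K_act q f1"]) (simp add: A_CP_iff)
  also note K
  also have "F_act q (K_act q f2) \<approx> F_act q f2"
    using assms(3) by (intro suq_cong_act) (simp add: A_CP_iff)
  finally show ?thesis .
qed

end


lemma null_comparison:
  fixes f g :: "nat \<Rightarrow> real"
  assumes "\<And>k. \<bar>f k\<bar> \<le> g k" and "g \<longlonglongrightarrow> 0"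
  shows "f \<longlonglongrightarrow> 0"
proof (rule tendsto_0_le[OF assms(2), of _ 1])
  have "norm (f k) \<le> norm (g k) * 1" for k
    using assms(1)[of k] by simp
  then show "\<forall>\<^sub>F k in sequentially. norm (f k) \<le> norm (g k) * 1"
    by simp
qed


section \<open>Completions\<close>

text \<open>Common ground for \<open>l2_norm\<close> and \<open>univ_norm\<close>, whose completions
  are built in the same way.\<close>

locale free_seminorm =
  fixes r :: "free \<Rightarrow> real"
  assumes triangle: "r (x + y) \<le> r x + r y"
    and minus: "r (- x) = r x"
    and zero: "r 0 = 0"
begin

lemma nonneg: "0 \<le> r x"
  using triangle[of x "- x"] by (simp add: minus zero)

lemma minus_commute: "r (x - y) = r (y - x)"
  using minus[of "x - y"] by simp

lemma triangle_diff: "r (x - z) \<le> r (x - y) + r (y - z)"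
  using triangle[of "x - y" "y - z"] by simp

lemma diff_le: "r x - r y \<le> r (x - y)"
  using triangle[of "x - y" y] by simp

lemma abs_diff_le: "\<bar>r x - r y\<bar> \<le> r (x - y)"
  using diff_le[of x y] diff_le[of y x] by (simp add: minus_commute abs_le_iff)

lemma abs_diff_diff_le: "\<bar>r (x - y) - r (x' - y')\<bar> \<le> r (x - x') + r (y - y')"
proof -
  have "\<bar>r (x - y) - r (x' - y')\<bar> \<le> r ((x - x') + - (y - y'))"
    using abs_diff_le[of "x - y" "x' - y'"] by (simp add: algebra_simps)
  also have "\<dots> \<le> r (x - x') + r (- (y - y'))"
    by (rule triangle)
  finally show ?thesis by (simp only: minus)
qed

lemma convergent_dist:
  assumes "sn_cauchy r X" "sn_cauchy r Y"
  shows "convergent (\<lambda>k. r (X k - Y k))"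
proof (rule real_Cauchy_convergent, rule CauchyI)
  fix e :: real assume "0 < e"
  then have e: "0 < e / 2" by simp
  from assms(1) e obtain M1 where M1: "\<And>m n. m \<ge> M1 \<Longrightarrow> n \<ge> M1 \<Longrightarrow> r (X m - X n) < e / 2"
    unfolding sn_cauchy_def by blast
  from assms(2) e obtain M2 where M2: "\<And>m n. m \<ge> M2 \<Longrightarrow> n \<ge> M2 \<Longrightarrow> r (Y m - Y n) < e / 2"
    unfolding sn_cauchy_def by blast
  have "norm (r (X m - Y m) - r (X n - Y n)) < e" if "m \<ge> max M1 M2" "n \<ge> max M1 M2" for m n
    using abs_diff_diff_le[of "X m" "Y m" "X n" "Y n"] M1[of m n] M2[of m n] that by simp
  then show "\<exists>M. \<forall>m\<ge>M. \<forall>n\<ge>M. norm (r (X m - Y m) - r (X n - Y n)) < e"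
    by blast
qed

lemma sn_cauchy_const: "sn_cauchy r (\<lambda>_. x)"
  by (simp add: sn_cauchy_def zero)

lemma self_in_sn_class: "sn_cauchy r X \<Longrightarrow> X \<in> sn_class r X"
  by (simp add: sn_class_def zero)

lemma sn_class_eqI:
  assumes "(\<lambda>k. r (X k - Y k)) \<longlonglongrightarrow> 0"
  shows "sn_class r X = sn_class r Y"
proof -
  have sub: "sn_class r X \<subseteq> sn_class r Y" if lim: "(\<lambda>k. r (X k - Y k)) \<longlonglongrightarrow> 0" for X Y
  proof
    fix Z assume Z: "Z \<in> sn_class r X"
    then have "(\<lambda>k. r (X k - Y k) + r (X k - Z k)) \<longlonglongrightarrow> 0 + 0"
      using lim by (intro tendsto_add) (simp_all add: sn_class_def)
    then have "(\<lambda>k. r (X k - Y k) + r (X k - Z k)) \<longlonglongrightarrow> 0"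
      by simp
    then have "(\<lambda>k. r (Y k - Z k)) \<longlonglongrightarrow> 0"
    proof (rule null_comparison[rotated])
      fix k
      show "\<bar>r (Y k - Z k)\<bar> \<le> r (X k - Y k) + r (X k - Z k)"
        using triangle_diff[of "Y k" "Z k" "X k"] nonneg[of "Y k - Z k"]
        unfolding minus_commute[of "Y k" "X k"] by simp
    qed
    with Z show "Z \<in> sn_class r Y"
      by (simp add: sn_class_def)
  qed
  have "(\<lambda>k. r (Y k - X k)) \<longlonglongrightarrow> 0"
    using assms by (subst minus_commute)
  from sub[OF assms] sub[OF this] show ?thesis by (rule equalityI)
qed

text \<open>Distances between other representatives differ from these by a null sequence, so the
  definite description in \<open>sn_dist\<close> has exactly one candidate.\<close>

lemma sn_dist_eq:
  assumes "sn_cauchy r X" "sn_cauchy r Y" "(\<lambda>k. r (X k - Y k)) \<longlonglongrightarrow> d"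
  shows "sn_dist r (sn_class r X) (sn_class r Y) = d"
  unfolding sn_dist_def
proof (rule the_equality)
  show "\<exists>X'\<in>sn_class r X. \<exists>Y'\<in>sn_class r Y. (\<lambda>k. r (X' k - Y' k)) \<longlonglongrightarrow> d"
    using self_in_sn_class[OF assms(1)] self_in_sn_class[OF assms(2)] assms(3) by blast
next
  fix d' assume "\<exists>X'\<in>sn_class r X. \<exists>Y'\<in>sn_class r Y. (\<lambda>k. r (X' k - Y' k)) \<longlonglongrightarrow> d'"
  then obtain X' Y' where X': "(\<lambda>k. r (X k - X' k)) \<longlonglongrightarrow> 0" and Y': "(\<lambda>k. r (Y k - Y' k)) \<longlonglongrightarrow> 0"
      and d': "(\<lambda>k. r (X' k - Y' k)) \<longlonglongrightarrow> d'"
    by (auto simp: sn_class_def)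
  have "(\<lambda>k. r (X k - X' k) + r (Y k - Y' k)) \<longlonglongrightarrow> 0"
    using tendsto_add[OF X' Y'] by simp
  then have "(\<lambda>k. r (X k - Y k) - r (X' k - Y' k)) \<longlonglongrightarrow> 0"
    by (rule null_comparison[rotated]) (rule abs_diff_diff_le)
  from tendsto_diff[OF assms(3) this] have "(\<lambda>k. r (X' k - Y' k)) \<longlonglongrightarrow> d"
    by simp
  with d' show "d' = d"
    by (rule LIMSEQ_unique)
qed

lemma sn_norm_emb: "sn_norm r (emb r x) = r x"
  unfolding sn_norm_def emb_def by (intro sn_dist_eq sn_cauchy_const) simp

lemma tendsto_sn_dist:
  assumes "sn_cauchy r X" "sn_cauchy r Y"
  shows "(\<lambda>k. r (X k - Y k)) \<longlonglongrightarrow> sn_dist r (sn_class r X) (sn_class r Y)"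
  using convergent_dist[OF assms] sn_dist_eq[OF assms] by (auto simp: convergent_def)

lemma sn_cauchy_bounded:
  assumes "sn_cauchy r X" obtains C where "0 \<le> C" "\<And>k. r (X k) \<le> C"
proof -
  have "convergent (\<lambda>k. r (X k - 0))"
    by (intro convergent_dist assms sn_cauchy_const)
  then have "Bseq (\<lambda>k. r (X k))"
    by (simp add: convergent_imp_Bseq)
  then obtain C where "0 < C" "\<And>k. norm (r (X k)) \<le> C"
    by (auto simp: Bseq_def)
  then show ?thesis
    by (intro that[of C]) (auto simp: nonneg)
qed

text \<open>If equivalent sequences have equivalent images, the union in \<open>lift1\<close> runs
  over one and the same class.\<close>

lemma lift1_sn_class:
  assumes "sn_cauchy r X"
    and "\<And>Y. Y \<in> sn_class r X \<Longrightarrow> (\<lambda>k. r (f (X k) - f (Y k))) \<longlonglongrightarrow> 0"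
  shows "lift1 r f (sn_class r X) = sn_class r (\<lambda>k. f (X k))"
  unfolding lift1_def
proof (rule SUP_eq_const)
  show "sn_class r X \<noteq> {}"
    using self_in_sn_class[OF assms(1)] by blast
  show "sn_class r (\<lambda>k. f (Y k)) = sn_class r (\<lambda>k. f (X k))" if "Y \<in> sn_class r X" for Y
    using sn_class_eqI[OF assms(2)[OF that]] by (rule sym)
qed

(* The acting element may live in the completion for another seminorm r'. *)
lemma lift2_sn_class:
  assumes "free_seminorm r'" "sn_cauchy r' X" "sn_cauchy r Y"
    and "\<And>X' Y'. X' \<in> sn_class r' X \<Longrightarrow> Y' \<in> sn_class r Y \<Longrightarrow>
      (\<lambda>k. r (f (X k) (Y k) - f (X' k) (Y' k))) \<longlonglongrightarrow> 0"
  shows "lift2 r f (sn_class r' X) (sn_class r Y) = sn_class r (\<lambda>k. f (X k) (Y k))"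
  unfolding lift2_def
proof (rule SUP_eq_const, goal_cases)
  case 1
  show ?case using free_seminorm.self_in_sn_class[OF assms(1,2)] by blast
next
  case (2 X')
  show ?case
  proof (rule SUP_eq_const)
    show "sn_class r Y \<noteq> {}"
      using self_in_sn_class[OF assms(3)] by blast
    show "sn_class r (\<lambda>k. f (X' k) (Y' k)) = sn_class r (\<lambda>k. f (X k) (Y k))" if "Y' \<in> sn_class r Y" for Y'
      using sn_class_eqI[OF assms(4)[OF 2 that]] by (rule sym)
  qed
qed

end


section \<open>Approximate form of the gauge equation\<close>

context haar_su2
begin

sublocale N: free_seminorm N
  by standard (simp_all add: N_triangle)

sublocale p: free_seminorm p
  by standard (simp_all add: univ_norm_triangle)

section \<open>Products and differences of Cauchy sequences\<close>

lemma N_mult_le_mult: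
  assumes "p x \<le> a" "N y \<le> b" shows "N (x * y) \<le> a * b"
proof -
  have "0 \<le> a" using assms(1) univ_norm_nonneg[of x] by linarith
  then have "p x * N y \<le> a * b"
    by (intro mult_mono assms) simp_all
  with N_mult_le[of x y] show ?thesis by linarith
qed

lemma N_mult_diff_le: "N (x * y - x' * y') \<le> p (x - x') * N y + p x' * N (y - y')"
proof -
  have "x * y - x' * y' = (x - x') * y + x' * (y - y')"
    by (simp add: algebra_simps)
  then show ?thesis
    using N_triangle[of "(x - x') * y" "x' * (y - y')"] N_mult_le[of "x - x'" y] N_mult_le[of x' "y - y'"]
    by simp
qed

lemma tendsto_N_mult_diff:
  assumes "sn_cauchy N Y" "sn_cauchy p X'"
    and "(\<lambda>k. p (X k - X' k)) \<longlonglongrightarrow> 0" "(\<lambda>k. N (Y k - Y' k)) \<longlonglongrightarrow> 0"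
  shows "(\<lambda>k. N (X k * Y k - X' k * Y' k)) \<longlonglongrightarrow> 0"
proof -
  obtain C where C: "\<And>k. N (Y k) \<le> C" using N.sn_cauchy_bounded[OF assms(1)] by blast
  obtain D where D: "\<And>k. p (X' k) \<le> D" using p.sn_cauchy_bounded[OF assms(2)] by blast
  have "(\<lambda>k. p (X k - X' k) * C + D * N (Y k - Y' k)) \<longlonglongrightarrow> 0 * C + D * 0"
    by (intro tendsto_intros assms)
  then have "(\<lambda>k. p (X k - X' k) * C + D * N (Y k - Y' k)) \<longlonglongrightarrow> 0"
    by simp
  then show ?thesis
  proof (rule null_comparison[rotated])
    fix k
    have "N (X k * Y k - X' k * Y' k) \<le> p (X k - X' k) * N (Y k) + p (X' k) * N (Y k - Y' k)"
      by (rule N_mult_diff_le)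
    also have "\<dots> \<le> p (X k - X' k) * C + D * N (Y k - Y' k)"
      by (intro add_mono mult_left_mono mult_right_mono C D) simp_all
    finally show "\<bar>N (X k * Y k - X' k * Y' k)\<bar> \<le> p (X k - X' k) * C + D * N (Y k - Y' k)"
      by simp
  qed
qed

lemma sn_cauchy_mult:
  assumes X: "sn_cauchy p X" and Y: "sn_cauchy N Y"
  shows "sn_cauchy N (\<lambda>k. X k * Y k)"
  unfolding sn_cauchy_def
proof (intro allI impI)
  fix e :: real assume e: "0 < e"
  obtain C where C: "0 \<le> C" "\<And>k. N (Y k) \<le> C" using N.sn_cauchy_bounded[OF Y] by blast
  obtain D where D: "0 \<le> D" "\<And>k. p (X k) \<le> D" using p.sn_cauchy_bounded[OF X] by blast
  define d where "d = e / (C + D + 1)"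
  have d: "0 < d" using e C(1) D(1) by (simp add: d_def)
  from X d obtain M1 where M1: "\<And>m n. m \<ge> M1 \<Longrightarrow> n \<ge> M1 \<Longrightarrow> p (X m - X n) < d"
    unfolding sn_cauchy_def by blast
  from Y d obtain M2 where M2: "\<And>m n. m \<ge> M2 \<Longrightarrow> n \<ge> M2 \<Longrightarrow> N (Y m - Y n) < d"
    unfolding sn_cauchy_def by blast
  have "N (X m * Y m - X n * Y n) < e" if "m \<ge> max M1 M2" "n \<ge> max M1 M2" for m n
  proof -
    have "N (X m * Y m - X n * Y n) \<le> p (X m - X n) * N (Y m) + p (X n) * N (Y m - Y n)"
      by (rule N_mult_diff_le)
    also have "\<dots> \<le> d * C + D * d"
      using M1[of m n] M2[of m n] that C D d by (intro add_mono mult_mono) (auto simp: less_imp_le)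
    also have "\<dots> < d * (C + D + 1)"
      using d by (simp add: algebra_simps)
    also have "\<dots> = e"
      using C(1) D(1) by (simp add: d_def)
    finally show ?thesis .
  qed
  then show "\<exists>M. \<forall>m\<ge>M. \<forall>n\<ge>M. N (X m * Y m - X n * Y n) < e"
    by blast
qed

lemma sn_cauchy_mult_const: "sn_cauchy N Y \<Longrightarrow> sn_cauchy N (\<lambda>k. x * Y k)"
  by (rule sn_cauchy_mult) (rule p.sn_cauchy_const)

lemma sn_cauchy_diff:
  assumes "sn_cauchy N X" "sn_cauchy N Y" shows "sn_cauchy N (\<lambda>k. X k - Y k)"
  unfolding sn_cauchy_def
proof (intro allI impI)
  fix e :: real assume "0 < e"
  then have e: "0 < e / 2" by simp
  from assms(1) e obtain M1 where M1: "\<And>m n. m \<ge> M1 \<Longrightarrow> n \<ge> M1 \<Longrightarrow> N (X m - X n) < e / 2"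
    unfolding sn_cauchy_def by blast
  from assms(2) e obtain M2 where M2: "\<And>m n. m \<ge> M2 \<Longrightarrow> n \<ge> M2 \<Longrightarrow> N (Y m - Y n) < e / 2"
    unfolding sn_cauchy_def by blast
  have "N ((X m - Y m) - (X n - Y n)) < e" if "m \<ge> max M1 M2" "n \<ge> max M1 M2" for m n
    using N_diff[of "X m - X n" "Y m - Y n"] M1[of m n] M2[of m n] that by (simp add: algebra_simps)
  then show "\<exists>M. \<forall>m\<ge>M. \<forall>n\<ge>M. N ((X m - Y m) - (X n - Y n)) < e"
    by blast
qed

lemma dbar_sn_class:
  assumes "sn_cauchy N S"
  shows "dbar q h f (sn_class N S) = sn_class N (\<lambda>k. cscale (q powr (-1/2)) (F_act q f) * S k)"
  unfolding dbar_def
proof (rule N.lift1_sn_class[OF assms])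
  fix Y assume "Y \<in> sn_class N S"
  then show "(\<lambda>k. N (cscale (q powr (-1/2)) (F_act q f) * S k - cscale (q powr (-1/2)) (F_act q f) * Y k)) \<longlonglongrightarrow> 0"
    by (intro tendsto_N_mult_diff assms p.sn_cauchy_const) (auto simp: sn_class_def)
qed

lemma C_act_sn_class:
  assumes "sn_cauchy p G" "sn_cauchy N S"
  shows "C_act h (sn_class p G) (sn_class N S) = sn_class N (\<lambda>k. G k * S k)"
  unfolding C_act_def
  by (rule N.lift2_sn_class[OF p.free_seminorm_axioms assms], rule tendsto_N_mult_diff[OF assms(2)])
     (auto simp: sn_class_def)

lemma H_minus_diff_sn_class:
  assumes "sn_cauchy N X" "sn_cauchy N Y"
  shows "H_minus_diff h (sn_class N X) (sn_class N Y) = sn_class N (\<lambda>k. X k - Y k)"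
  unfolding H_minus_diff_def
proof (rule N.lift2_sn_class[OF N.free_seminorm_axioms assms])
  fix X' Y' assume "X' \<in> sn_class N X" "Y' \<in> sn_class N Y"
  then have "(\<lambda>k. N (X k - X' k) + N (Y k - Y' k)) \<longlonglongrightarrow> 0 + 0"
    by (intro tendsto_add) (auto simp: sn_class_def)
  then have lim: "(\<lambda>k. N (X k - X' k) + N (Y k - Y' k)) \<longlonglongrightarrow> 0"
    by simp
  have "N ((X k - Y k) - (X' k - Y' k)) \<le> N (X k - X' k) + N (Y k - Y' k)" for k
    using N_diff[of "X k - X' k" "Y k - Y' k"] by (simp add: algebra_simps)
  then show "(\<lambda>k. N ((X k - Y k) - (X' k - Y' k))) \<longlonglongrightarrow> 0"
    by (intro null_comparison[OF _ lim]) simp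
qed

text \<open>The domain of the closure supplies \<open>X k\<close> near \<open>g\<close> whose
  \<open>dbar\<close> is near the right-hand side of the gauge equation. Replacing \<open>g\<close>
  by \<open>X k\<close> there costs at most \<open>p (d f1) + p (d f2)\<close> times the distance,
  so the equation becomes an estimate inside the algebra, tested on the degree 1 part, which is
  dense in \<open>H_plus q h\<close>.\<close>

lemma gauge_solution_approximation:
  fixes f1 f2 :: free
  defines "d \<equiv> \<lambda>f. cscale (q powr (-1/2)) (F_act q f)"
  assumes gauge: "mixed_gauge_eq q h f1 f2 g" and g: "g = sn_class p G" "sn_cauchy p G"
    and e: "0 < e"
  obtains x j where "x \<in> A_CP q" "\<And>i. i \<ge> j \<Longrightarrow> p (x - G i) < e"
    "\<And>s. s \<in> line_module q 1 \<Longrightarrow> N ((d x - x * d f1 + d f2 * x) * s) \<le> e * N s"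
proof -
  define C where "C = p (d f1) + p (d f2) + 1"
  have C: "1 \<le> C" by (simp add: C_def)
  obtain X where X: "range X \<subseteq> A_CP q" "(\<lambda>k. sn_dist p (emb p (X k)) g) \<longlonglongrightarrow> 0"
    and T: "op_tendsto q h (\<lambda>k. dbar q h (X k))
      (\<lambda>\<xi>. H_minus_diff h (C_act h g (dbar q h f1 \<xi>)) (dbar q h f2 (C_act h g \<xi>)))"
    using gauge unfolding mixed_gauge_eq_def dbar_closure_def by blast
  \<comment> \<open>One \<open>t\<close> is spent on the operator convergence and
    \<open>t * (p (d f1) + p (d f2))\<close> on replacing \<open>g\<close> by \<open>x\<close>;
    together this is \<open>t * C\<close>.\<close>
  define t where "t = min e 1 * (1 / (2 * C))"
  have t: "0 < t" "t < e" "t + t * C \<le> e"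
  proof -
    have "t \<le> e * (1 / (2 * C))" unfolding t_def using C by (intro mult_right_mono) simp_all
    then have tC: "2 * (t * C) \<le> e" using C by (simp add: field_simps)
    show t0: "0 < t" using C e by (simp add: t_def)
    have "t \<le> t * C" using mult_left_mono[of 1 C t] C t0 by simp
    then show "t < e" "t + t * C \<le> e" using tC e t0 by linarith+
  qed
  have "\<forall>\<^sub>F k in sequentially. sn_dist p (emb p (X k)) g < t"
    using order_tendstoD(2)[OF X(2) t(1)] .
  moreover have "\<forall>\<^sub>F k in sequentially. \<forall>\<xi>\<in>H_plus q h. sn_dist N (dbar q h (X k) \<xi>)
      (H_minus_diff h (C_act h g (dbar q h f1 \<xi>)) (dbar q h f2 (C_act h g \<xi>))) \<le> t * sn_norm N \<xi>"
    using T t(1) unfolding op_tendsto_def by blast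
  ultimately have "\<forall>\<^sub>F k in sequentially. sn_dist p (emb p (X k)) g < t \<and>
      (\<forall>\<xi>\<in>H_plus q h. sn_dist N (dbar q h (X k) \<xi>)
      (H_minus_diff h (C_act h g (dbar q h f1 \<xi>)) (dbar q h f2 (C_act h g \<xi>))) \<le> t * sn_norm N \<xi>)"
    by (rule eventually_conj)
  then obtain k where k: "sn_dist p (emb p (X k)) g < t"
    and op: "\<And>\<xi>. \<xi> \<in> H_plus q h \<Longrightarrow> sn_dist N (dbar q h (X k) \<xi>)
      (H_minus_diff h (C_act h g (dbar q h f1 \<xi>)) (dbar q h f2 (C_act h g \<xi>))) \<le> t * sn_norm N \<xi>"
    using eventually_happens' sequentially_bot by blast
  define x where "x = X k"
  have lim: "(\<lambda>i. p (x - G i)) \<longlonglongrightarrow> sn_dist p (emb p x) g"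
    unfolding g emb_def by (intro p.tendsto_sn_dist p.sn_cauchy_const g)
  then obtain j where j: "\<And>i. i \<ge> j \<Longrightarrow> p (x - G i) < t"
    using order_tendstoD(2)[OF lim k[folded x_def]] by (auto simp: eventually_sequentially)
  have main: "N ((d x - x * d f1 + d f2 * x) * s) \<le> e * N s" if s: "s \<in> line_module q 1" for s
  proof -
    let ?Y = "\<lambda>i. G i * (d f1 * s) - d f2 * (G i * s)"
    have const: "sn_cauchy N (\<lambda>_. s)" for s by (rule N.sn_cauchy_const)
    have Y: "sn_cauchy N ?Y"
      by (intro sn_cauchy_diff sn_cauchy_mult_const sn_cauchy_mult g const)
    have emb: "emb N s \<in> H_plus q h"
      unfolding H_plus_def completion_def emb_def using s const by blast
    have "H_minus_diff h (C_act h g (dbar q h f1 (emb N s))) (dbar q h f2 (C_act h g (emb N s))) = sn_class N ?Y"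
      unfolding emb_def g(1) d_def
      by (simp only: dbar_sn_class C_act_sn_class H_minus_diff_sn_class sn_cauchy_mult_const
          sn_cauchy_mult g(2) const)
    moreover have "dbar q h (X k) (emb N s) = sn_class N (\<lambda>_. d x * s)"
      unfolding emb_def d_def x_def by (simp only: dbar_sn_class const)
    ultimately have "sn_dist N (sn_class N (\<lambda>_. d x * s)) (sn_class N ?Y) \<le> t * N s"
      using op[OF emb] by (simp add: N.sn_norm_emb)
    moreover have "(\<lambda>i. N (d x * s - ?Y i)) \<longlonglongrightarrow> sn_dist N (sn_class N (\<lambda>_. d x * s)) (sn_class N ?Y)"
      by (rule N.tendsto_sn_dist[OF const Y])
    moreover have "N ((d x - x * d f1 + d f2 * x) * s) - t * (p (d f1) + p (d f2)) * N s \<le> N (d x * s - ?Y i)"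
      if "i \<ge> j" for i
    proof -
      have "(d x - x * d f1 + d f2 * x) * s =
          (d x * s - ?Y i) + (- ((x - G i) * (d f1 * s)) + d f2 * ((x - G i) * s))"
        by (simp add: algebra_simps)
      then have "N ((d x - x * d f1 + d f2 * x) * s) \<le>
          N (d x * s - ?Y i) + (N ((x - G i) * (d f1 * s)) + N (d f2 * ((x - G i) * s)))"
        using N_triangle[of "d x * s - ?Y i" "- ((x - G i) * (d f1 * s)) + d f2 * ((x - G i) * s)"]
          N_triangle[of "- ((x - G i) * (d f1 * s))" "d f2 * ((x - G i) * s)"] by simp
      also have "N ((x - G i) * (d f1 * s)) \<le> t * (p (d f1) * N s)"
        by (rule N_mult_le_mult[OF less_imp_le[OF j[OF that]] N_mult_le])
      also have "N (d f2 * ((x - G i) * s)) \<le> p (d f2) * (t * N s)"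
        by (rule N_mult_le_mult[OF order_refl N_mult_le_mult[OF less_imp_le[OF j[OF that]] order_refl]])
      finally show ?thesis
        by (simp add: algebra_simps)
    qed
    \<comment> \<open>The lower bound holds from \<open>j\<close> on and passes to the limit, which
      is the distance in the completion.\<close>
    ultimately have "N ((d x - x * d f1 + d f2 * x) * s) - t * (p (d f1) + p (d f2)) * N s \<le> t * N s"
      by (blast intro: order_trans[OF LIMSEQ_le_const])
    then have "N ((d x - x * d f1 + d f2 * x) * s) \<le> (t * C) * N s"
      by (simp add: C_def algebra_simps)
    also have "\<dots> \<le> e * N s"
      using t by (intro mult_right_mono) simp_all
    finally show ?thesis .
  qed
  show ?thesis
  proof (rule that)
    show "x \<in> A_CP q" using X(1) by (auto simp: x_def)
    show "p (x - G i) < e" if "i \<ge> j" for i using j[OF that] t(2) by simp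
  qed (rule main)
qed

text \<open>\<open>C\<close> is read off from sequences that represent \<open>g\<close> and its
  inverse, before \<open>e\<close> is given; this order of quantifiers permits an accuracy that
  depends on \<open>C\<close>.\<close>

lemma gauge_equivalence_approximation:
  fixes f1 f2 :: free
  defines "d \<equiv> \<lambda>f. cscale (q powr (-1/2)) (F_act q f)"
  assumes inv: "invertible_in_domain q h g" and gauge: "mixed_gauge_eq q h f1 f2 g"
  obtains C where "0 \<le> C" and "\<And>e. 0 < e \<Longrightarrow> \<exists>x\<in>A_CP q. \<exists>x'\<in>A_CP q. p x \<le> C \<and> p x' \<le> C \<and>
      (\<forall>y. N (x * x' * y - y) \<le> e * N y) \<and>
      (\<forall>s\<in>line_module q 1. N ((d x - x * d f1 + d f2 * x) * s) \<le> e * N s)"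
proof -
  obtain g' where g': "g' \<in> dbar_domain q h" and gg': "C_mult q g g' = emb p 1" and gd: "g \<in> dbar_domain q h"
    using inv unfolding invertible_in_domain_def by blast
  obtain G where G: "g = sn_class p G" "range G \<subseteq> A_CP q" "sn_cauchy p G"
    using gd by (auto simp: dbar_domain_def dbar_closure_def C_CP_def completion_def)
  obtain G' where G': "g' = sn_class p G'" "range G' \<subseteq> A_CP q" "sn_cauchy p G'"
    using g' by (auto simp: dbar_domain_def dbar_closure_def C_CP_def completion_def)
  \<comment> \<open>The product of points is a union over representatives, so this membership yields
    representatives \<open>U\<close>, \<open>V\<close> whose products tend to 1. They are then
    compared with \<open>G\<close>, \<open>G'\<close>, whose terms lie in
    \<open>A_CP q\<close>.\<close>
  have "(\<lambda>_. 1) \<in> C_mult q g g'"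
    unfolding gg' emb_def by (intro p.self_in_sn_class p.sn_cauchy_const)
  then obtain U V where U: "U \<in> g" and V: "V \<in> g'" and UV: "(\<lambda>k. p (U k * V k - 1)) \<longlonglongrightarrow> 0"
    by (auto simp: C_mult_def lift2_def sn_class_def)
  have U': "sn_cauchy p U" "(\<lambda>k. p (G k - U k)) \<longlonglongrightarrow> 0" and V': "(\<lambda>k. p (G' k - V k)) \<longlonglongrightarrow> 0"
    using U V by (auto simp: G G' sn_class_def)
  obtain B1 where B1: "0 \<le> B1" "\<And>k. p (G k) \<le> B1" using p.sn_cauchy_bounded[OF G(3)] by blast
  obtain B2 where B2: "0 \<le> B2" "\<And>k. p (G' k) \<le> B2" using p.sn_cauchy_bounded[OF G'(3)] by blast
  obtain B3 where B3: "0 \<le> B3" "\<And>k. p (U k) \<le> B3" using p.sn_cauchy_bounded[OF U'(1)] by blast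
  have "(\<lambda>k. p (G k - U k) * B2 + B3 * p (G' k - V k) + p (U k * V k - 1)) \<longlonglongrightarrow> 0 * B2 + B3 * 0 + 0"
    by (intro tendsto_intros U' V' UV)
  then have lim: "(\<lambda>k. p (G k - U k) * B2 + B3 * p (G' k - V k) + p (U k * V k - 1)) \<longlonglongrightarrow> 0"
    by simp
  define C where "C = B1 + B2 + 1"
  show ?thesis
  proof (rule that[of C])
    show "0 \<le> C" using B1 B2 by (simp add: C_def)
  next
    fix e :: real assume e: "0 < e"
    \<comment> \<open>The bound 1 serves \<open>p x \<le> C\<close>; the third entry makes the cost
      of replacing \<open>x\<close> by \<open>G i\<close> at most \<open>e / 2\<close>, the other
      errors being below \<open>e / 2\<close> in total.\<close>
    define t where "t = min 1 (min e (e / (2 * (B2 + 1))))"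
    have t: "0 < t" "t \<le> 1" "t \<le> e" "t * B2 \<le> e / 2"
    proof -
      show "0 < t" "t \<le> 1" "t \<le> e" using e B2 by (auto simp: t_def)
      have "t * B2 \<le> e / (2 * (B2 + 1)) * B2"
        using B2 by (intro mult_right_mono) (auto simp: t_def)
      also have "\<dots> = e / 2 * (B2 / (B2 + 1))"
        by simp
      also have "\<dots> \<le> e / 2 * 1"
        using B2 e by (intro mult_left_mono) simp_all
      finally show "t * B2 \<le> e / 2" by simp
    qed
    obtain x j where x: "x \<in> A_CP q" "\<And>i. i \<ge> j \<Longrightarrow> p (x - G i) < t"
      "\<And>s. s \<in> line_module q 1 \<Longrightarrow> N ((d x - x * d f1 + d f2 * x) * s) \<le> t * N s"
      using gauge_solution_approximation[OF gauge G(1,3) t(1)] unfolding d_def by blast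
    have "\<forall>\<^sub>F k in sequentially. p (G k - U k) * B2 + B3 * p (G' k - V k) + p (U k * V k - 1) < e / 2"
      using order_tendstoD(2)[OF lim, of "e / 2"] e by simp
    then have "\<forall>\<^sub>F k in sequentially. k \<ge> j \<and>
        p (G k - U k) * B2 + B3 * p (G' k - V k) + p (U k * V k - 1) < e / 2"
      using eventually_ge_at_top[of j] by (rule eventually_conj[rotated])
    then obtain i where i: "i \<ge> j"
        "p (G i - U i) * B2 + B3 * p (G' i - V i) + p (U i * V i - 1) < e / 2"
      using eventually_happens' sequentially_bot by blast
    have "N (x * G' i * y - y) \<le> e * N y" for y
    proof -
      \<comment> \<open>Telescoping through \<open>G i * G' i\<close>, \<open>U i * G' i\<close> and
        \<open>U i * V i\<close>.\<close>
      have "x * G' i * y - y = (x - G i) * (G' i * y) + ((G i - U i) * (G' i * y)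
          + (U i * ((G' i - V i) * y) + (U i * V i - 1) * y))"
        by (simp add: algebra_simps)
      then have "N (x * G' i * y - y) \<le> N ((x - G i) * (G' i * y)) + (N ((G i - U i) * (G' i * y))
          + (N (U i * ((G' i - V i) * y)) + N ((U i * V i - 1) * y)))"
        by (simp only:) (intro order_trans[OF N_triangle] add_mono order_refl)
      also have "\<dots> \<le> t * (B2 * N y) + (p (G i - U i) * (B2 * N y)
          + (B3 * (p (G' i - V i) * N y) + p (U i * V i - 1) * N y))"
      proof -
        have *: "N (u * (v * y)) \<le> a * (b * N y)" if "p u \<le> a" "p v \<le> b" for u v a b
          by (intro N_mult_le_mult that order_refl)
        show ?thesis
          using x(2)[OF i(1)] by (intro add_mono * N_mult_le B2 B3 order_refl) simp_all
      qed
      also have "\<dots> = (t * B2 + (p (G i - U i) * B2 + B3 * p (G' i - V i) + p (U i * V i - 1))) * N y"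
        by (simp add: algebra_simps)
      also have "\<dots> \<le> e * N y"
        using t(4) i(2) by (intro mult_right_mono) simp_all
      finally show ?thesis .
    qed
    moreover have "p x \<le> C"
      using p.triangle_diff[of x 0 "G i"] x(2)[OF i(1)] B1(2)[of i] t(2) B2(1) by (simp add: C_def)
    moreover have "p (G' i) \<le> C"
      using B2(2)[of i] B1(1) by (simp add: C_def)
    moreover have "N ((d x - x * d f1 + d f2 * x) * s) \<le> e * N s" if "s \<in> line_module q 1" for s
      using x(3)[OF that] mult_right_mono[OF t(3), of "N s"] by simp
    moreover have "G' i \<in> A_CP q" using G'(2) by blast
    ultimately show "\<exists>x\<in>A_CP q. \<exists>x'\<in>A_CP q. p x \<le> C \<and> p x' \<le> C \<and>
      (\<forall>y. N (x * x' * y - y) \<le> e * N y) \<and>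
      (\<forall>s\<in>line_module q 1. N ((d x - x * d f1 + d f2 * x) * s) \<le> e * N s)"
      using x(1) by blast
  qed
qed


section \<open>The top spectral projection of B0\<close>

(* P0 y is the L2 norm of the component of y in the eigenspace of B0 for the eigenvalue 1. *)
definition P0 :: "free \<Rightarrow> real" where "P0 y = lim (\<lambda>M. N (gc ^ M * y))"

text \<open>\<open>gc\<close> is a contraction, so the sequence decreases. The square of its term is
  the quadratic form of \<open>B0 ^ M\<close> at \<open>y\<close>.\<close>

lemma tendsto_P0: "(\<lambda>M. N (gc ^ M * y)) \<longlonglongrightarrow> P0 y"
proof -
  have "decseq (\<lambda>M. N (gc ^ M * y))"
    using N_letter_le[of LC] by (intro decseq_SucI) (simp add: mult.assoc)
  then have "convergent (\<lambda>M. N (gc ^ M * y))"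
    by (rule decseq_convergent[of _ 0]) (auto simp: convergent_def)
  then show ?thesis
    by (simp add: P0_def convergent_LIMSEQ_iff)
qed

lemma N_gc_power_le: "N (gc ^ M * y) \<le> N y"
proof (induction M)
  case (Suc M)
  then show ?case
    using N_letter_le[of LC "gc ^ M * y"] by (simp add: mult.assoc)
qed simp

lemma P0_le: "P0 y \<le> N y"
  by (rule LIMSEQ_le_const2[OF tendsto_P0]) (use N_gc_power_le in blast)

lemma P0_triangle: "P0 (x + y) \<le> P0 x + P0 y"
  by (rule LIMSEQ_le[OF tendsto_P0 tendsto_add[OF tendsto_P0 tendsto_P0]])
     (use N_triangle in \<open>auto simp: distrib_left\<close>)

lemma P0_cscale: "P0 (cscale z x) = cmod z * P0 x"
proof (rule LIMSEQ_unique[OF tendsto_P0])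
  show "(\<lambda>M. N (gc ^ M * cscale z x)) \<longlonglongrightarrow> cmod z * P0 x"
    using tendsto_mult_left[OF tendsto_P0, of "cmod z" x] by (simp add: N_cscale)
qed

lemma P0_minus: "P0 (- x) = P0 x"
  using P0_cscale[of "- 1" x] by (simp add: cscale_uminus_one)

lemma P0_cong:
  assumes "x \<approx> y" shows "P0 x = P0 y"
proof -
  have "N (gc ^ M * x) = N (gc ^ M * y)" for M
    by (intro N_cong suq_cong_mult_left assms)
  then show ?thesis by (simp add: P0_def)
qed

text \<open>The extra factor only shifts the index of the sequence.\<close>

lemma P0_gc: "P0 (gc * y) = P0 y"
proof (rule LIMSEQ_unique)
  show "(\<lambda>M. N (gc ^ M * (gc * y))) \<longlonglongrightarrow> P0 (gc * y)"
    by (rule tendsto_P0)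
  show "(\<lambda>M. N (gc ^ M * (gc * y))) \<longlonglongrightarrow> P0 y"
    using LIMSEQ_Suc[OF tendsto_P0[of y]] by (simp add: power_Suc2 mult.assoc del: power_Suc)
qed

text \<open>By normality of \<open>gc\<close>, the factor \<open>gcs\<close> can be moved past the
  power and traded for \<open>gc\<close> inside the norm.\<close>

lemma P0_gcs: "P0 (gcs * y) = P0 y"
proof -
  have "N (gc ^ M * (gcs * y)) = N (gc ^ M * (gc * y))" for M
  proof -
    have "(gcs * gc ^ M) * y \<approx> (gc ^ M * gcs) * y"
      by (intro suq_cong_mult_right commute_power suq_cong_sym[OF relations(3)])
    from N_cong[OF this] have "N (gc ^ M * (gcs * y)) = N (gcs * (gc ^ M * y))"
      by (simp only: mult.assoc)
    also have "\<dots> = N (gc * (gc ^ M * y))"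
      by (rule N_gen)
    finally show ?thesis
      by (simp add: mult.assoc[symmetric] power_commutes)
  qed
  then have "P0 (gcs * y) = P0 (gc * y)"
    by (simp add: P0_def)
  then show ?thesis by (simp add: P0_gc)
qed

text \<open>Moving \<open>gas\<close> through \<open>gc ^ M\<close> costs a factor
  \<open>q ^ M\<close>: the range of \<open>gas\<close> is orthogonal to the top eigenspace.\<close>

lemma P0_gas: "P0 (gas * y) = 0"
proof (rule LIMSEQ_unique[OF tendsto_P0])
  have comm: "gc ^ M * gas \<approx> cscale (sigma ^ (2 * M)) (gas * gc ^ M)" for M
  proof (induction M)
    case (Suc M)
    have "gc ^ Suc M * gas = gc * (gc ^ M * gas)"
      by (simp add: mult.assoc)
    also have "\<dots> \<approx> gc * cscale (sigma ^ (2 * M)) (gas * gc ^ M)"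
      by (intro suq_cong_mult_left Suc)
    also have "\<dots> = cscale (sigma ^ (2 * M)) ((gc * gas) * gc ^ M)"
      by (simp add: mult.assoc)
    also have "\<dots> \<approx> cscale (sigma ^ (2 * M)) (cscale (sigma ^ 2) (gas * gc) * gc ^ M)"
      by (intro suq_cong_cscale suq_cong_mult_right relations)
    also have "\<dots> = cscale (sigma ^ (2 * Suc M)) (gas * gc ^ Suc M)"
      by (simp add: mult.assoc power2_eq_square mult.commute)
    finally show ?case .
  qed simp
  have "cmod (sigma ^ (2 * M)) = q ^ M" for M
    using q_pos by (simp add: power_mult norm_power flip: of_real_q)
  then have bound: "N (gc ^ M * (gas * y)) \<le> q ^ M * N y" for M
  proof -
    have "N (gc ^ M * (gas * y)) = N (cscale (sigma ^ (2 * M)) (gas * gc ^ M) * y)"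
      using N_cong[OF suq_cong_mult_right[OF comm[of M]]] by (simp only: mult.assoc)
    also have "\<dots> = q ^ M * N (gas * (gc ^ M * y))"
      using \<open>cmod (sigma ^ (2 * M)) = q ^ M\<close> by (simp add: N_cscale mult.assoc)
    also have "\<dots> \<le> q ^ M * N y"
      using q_pos order_trans[OF N_letter_le N_gc_power_le] by (intro mult_left_mono) simp_all
    finally show ?thesis .
  qed
  have "(\<lambda>M. q ^ M * N y) \<longlonglongrightarrow> 0"
    using tendsto_mult_right[OF LIMSEQ_power_zero[of q], of "N y"] q_pos q_less_1 by simp
  then show "(\<lambda>M. N (gc ^ M * (gas * y))) \<longlonglongrightarrow> 0"
    by (rule null_comparison[rotated]) (use bound in simp)
qed

text \<open>Modulo the relations \<open>1 - B0\<close> is \<open>gas * ga\<close>, and it divides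
  \<open>1 - B0 ^ m\<close>. With \<open>P0_gas\<close> this expresses the vanishing weight
  algebraically.\<close>

lemma one_minus_B0_power: "\<exists>u. 1 - B0 ^ m \<approx> gas * u"
proof (induction m)
  case 0
  show ?case by (intro exI[of _ 0]) simp
next
  case (Suc m)
  then obtain u where u: "1 - B0 ^ m \<approx> gas * u" by blast
  have "1 - B0 \<approx> gas * ga"
    using suq_cong_diff[OF suq_cong_refl[of 1] relations(3)] suq_cong_sym[OF suq_cong_addD(1)[OF relations(4)]]
    unfolding B0_def by (rule suq_cong_trans)
  then have "(1 - B0 ^ m) + (1 - B0) * B0 ^ m \<approx> gas * u + (gas * ga) * B0 ^ m"
    by (intro suq_cong_add u suq_cong_mult_right)
  then have "1 - B0 ^ Suc m \<approx> gas * (u + ga * B0 ^ m)"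
    by (simp add: algebra_simps)
  then show ?case by blast
qed

lemma P0_one_minus_B0_power: "P0 ((1 - B0 ^ m) * y) = 0"
proof -
  obtain u where "1 - B0 ^ m \<approx> gas * u" using one_minus_B0_power by blast
  then have "P0 ((1 - B0 ^ m) * y) = P0 (gas * u * y)"
    by (intro P0_cong suq_cong_mult_right)
  then show ?thesis by (simp add: mult.assoc P0_gas)
qed

lemma star_gc_power_mult: "gcs ^ M * gc ^ M \<approx> B0 ^ M"
proof (induction M)
  case (Suc M)
  have "gcs ^ Suc M * gc ^ Suc M = gcs * (gcs ^ M * gc ^ M) * gc"
    by (simp add: mult.assoc power_commutes)
  also have "\<dots> \<approx> (gcs * B0 ^ M) * gc"
    by (intro suq_cong_mult suq_cong_refl Suc)
  also have "\<dots> \<approx> (B0 ^ M * gcs) * gc"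
    by (intro suq_cong_mult_right commute_power gcs_B0)
  also have "\<dots> = B0 ^ M * (gcs * gc)"
    by (simp add: mult.assoc)
  also have "\<dots> \<approx> B0 ^ M * (gc * gcs)"
    by (intro suq_cong_mult_left suq_cong_sym[OF relations(3)])
  finally show ?case
    by (simp add: B0_def[symmetric] power_commutes)
qed simp

lemma P0_1_pos: "0 < P0 1"
proof -
  have q2: "q\<^sup>2 < 1" using q_power_less_1[of 2] by simp
  have "sqrt (1 - q\<^sup>2) \<le> N (gc ^ M * 1)" for M
  proof -
    have "0 < q ^ (2 * M + 2)" "q ^ (2 * M + 2) < 1"
      using q_pos q_power_less_1[of "2 * M + 2"] by simp_all
    then have "1 - q\<^sup>2 \<le> (1 - q\<^sup>2) / (1 - q ^ (2 * M + 2))"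
      using q2 by (intro mult_imp_le_div_pos) (simp_all add: mult_left_le del: power_Suc)
    moreover have "N (gc ^ M) = sqrt ((1 - q\<^sup>2) / (1 - q ^ (2 * M + 2)))"
    proof (rule N_eq_sqrt)
      show "h (star (gc ^ M) * gc ^ M) = complex_of_real ((1 - q\<^sup>2) / (1 - q ^ (2 * M + 2)))"
        using h_cong[OF star_gc_power_mult] by (simp only: star_power star_letter adj.simps h_B0_power)
    qed
    ultimately show ?thesis
      by (simp only: mult_1_right real_sqrt_le_iff)
  qed
  then have "sqrt (1 - q\<^sup>2) \<le> P0 1"
    by (intro LIMSEQ_le_const[OF tendsto_P0]) blast
  moreover have "0 < sqrt (1 - q\<^sup>2)" using q2 by simp
  ultimately show ?thesis by linarith
qed


section \<open>Approximate inverses\<close>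

text \<open>A truncated Neumann series with remainder \<open>y ^ J\<close>. As a polynomial in
  \<open>y\<close> the approximate inverse stays in \<open>A_CP q\<close>, so multiplication by it
  preserves degrees.\<close>

lemma approximate_inverse:
  assumes y: "y \<in> A_CP q" and t: "0 \<le> t" "t < 1" "\<And>z. N (y * z) \<le> t * N z" and e: "0 < e"
  shows "\<exists>R\<in>A_CP q. \<forall>z. N ((1 - y) * (R * z) - z) \<le> e * N z"
proof -
  obtain J where J: "t ^ J < e"
    using real_arch_pow_inv[OF e t(2)] by blast
  have "\<exists>R\<in>A_CP q. (1 - y) * R = 1 - y ^ J" for J
  proof (induction J)
    case 0
    show ?case using A_CP_0 by (intro bexI[of _ 0]) simp_all
  next
    case (Suc J)
    then obtain R where R: "R \<in> A_CP q" "(1 - y) * R = 1 - y ^ J" by blast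
    have "1 + y * R \<in> A_CP q"
      by (intro line_module_add A_CP_mult A_CP_1 y R)
    moreover have "(1 - y) * (1 + y * R) = (1 - y) + y * ((1 - y) * R)"
      by (simp add: algebra_simps)
    then have "(1 - y) * (1 + y * R) = 1 - y ^ Suc J"
      unfolding R(2) by (simp add: right_diff_distrib)
    ultimately show ?case by blast
  qed
  then obtain R where R: "R \<in> A_CP q" "(1 - y) * R = 1 - y ^ J" by blast
  have pow: "N (y ^ k * z) \<le> t ^ k * N z" for k z
  proof (induction k)
    case (Suc k)
    have "N (y ^ Suc k * z) \<le> t * N (y ^ k * z)"
      using t(3)[of "y ^ k * z"] by (simp add: mult.assoc)
    also have "\<dots> \<le> t * (t ^ k * N z)"
      using t(1) Suc by (rule mult_left_mono[rotated])
    finally show ?case by (simp add: mult.assoc)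
  qed simp
  have "N ((1 - y) * (R * z) - z) \<le> e * N z" for z
  proof -
    have "(1 - y) * (R * z) - z = - (y ^ J * z)"
      unfolding mult.assoc[symmetric] R(2) by (simp add: left_diff_distrib)
    then have "N ((1 - y) * (R * z) - z) \<le> t ^ J * N z"
      using pow by simp
    also have "\<dots> \<le> e * N z"
      using J by (intro mult_right_mono) simp_all
    finally show ?thesis .
  qed
  then show ?thesis using R(1) by blast
qed

lemma N_B0_power_le: "N (B0 ^ m * z) \<le> N z"
proof (induction m)
  case (Suc m)
  have "N (B0 * (B0 ^ m * z)) \<le> N (gcs * (B0 ^ m * z))"
    using N_letter_le[of LC "gcs * (B0 ^ m * z)"] by (simp add: B0_def mult.assoc)
  also have "\<dots> \<le> N (B0 ^ m * z)"
    by (rule N_letter_le)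
  finally show ?case using Suc by (simp add: mult.assoc)
qed simp

text \<open>Since \<open>1 - cscale (sigma ^ 4) B0\<close> is \<open>ga * gas\<close> modulo the
  relations, this is a quantitative form of the fact that no weight on the right vanishes. Each
  factor has its own Neumann series, as \<open>mu\<close> and \<open>sigma ^ 4\<close> have modulus
  below 1.\<close>

lemma approximate_inverse_product:
  assumes mu: "mu = 1 - sigma ^ (4 * Suc m)" and e: "0 < e"
  shows "\<exists>R\<in>A_CP q. \<forall>z. N ((1 - cscale mu (B0 ^ Suc m)) * ((1 - cscale (sigma ^ 4) B0) * (R * z)) - z) \<le> e * N z"
proof -
  have B: "N (cscale c (B0 ^ k) * z) \<le> cmod c * N z" for c k z
    by (simp add: N_cscale mult_left_mono N_B0_power_le)
  have AB: "cscale c (B0 ^ k) \<in> A_CP q" for c k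
    by (intro line_module_cscale A_CP_B0_power)
  have sig: "cmod (1 - sigma ^ (4 * Suc m)) = 1 - q ^ (2 * Suc m)" "cmod (sigma ^ 4) = q ^ 2"
  proof -
    have "complex_of_real (q ^ (2 * Suc m)) = sigma ^ (2 * (2 * Suc m))"
      by (simp only: of_real_power of_real_q power_mult)
    moreover have "2 * (2 * Suc m) = 4 * Suc m" by simp
    ultimately have "1 - sigma ^ (4 * Suc m) = complex_of_real (1 - q ^ (2 * Suc m))"
      by (simp only: of_real_diff of_real_1)
    then show "cmod (1 - sigma ^ (4 * Suc m)) = 1 - q ^ (2 * Suc m)"
      using q_power_less_1[of "2 * Suc m"] by (simp only: norm_of_real) simp
    show "cmod (sigma ^ 4) = q ^ 2"
      unfolding of_real_q2[symmetric] norm_of_real by simp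
  qed
  have mu1: "0 \<le> cmod mu" "cmod mu < 1"
    using q_pos q_power_less_1[of "2 * Suc m"] by (simp_all add: mu sig del: power_Suc mult_Suc_right)
  have s1: "0 \<le> cmod (sigma ^ 4)" "cmod (sigma ^ 4) < 1"
    using q_power_less_1[of 2] by (simp_all only: sig) simp_all
  obtain R1 where R1: "R1 \<in> A_CP q" "\<And>z. N ((1 - cscale mu (B0 ^ Suc m)) * (R1 * z) - z) \<le> e / 2 * N z"
    using approximate_inverse[OF AB mu1 B half_gt_zero[OF e]] by blast
  obtain D where D: "0 \<le> D" "\<And>z. N (R1 * z) \<le> D * N z"
    using N_mult_bounded by blast
  \<comment> \<open>The error of \<open>R2\<close> is amplified by \<open>D\<close> through
    \<open>R1\<close> and by at most 2 through \<open>1 - cscale mu (B0 ^ Suc m)\<close>; the result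
    stays below \<open>e / 2\<close>, and \<open>R1\<close> uses up the other half.\<close>
  define e2 where "e2 = e / (4 * (D + 1))"
  have e2: "0 < e2" using e D(1) by (simp add: e2_def)
  obtain R2 where R2: "R2 \<in> A_CP q" "\<And>z. N ((1 - cscale (sigma ^ 4) (B0 ^ 1)) * (R2 * z) - z) \<le> e2 * N z"
    using approximate_inverse[OF AB s1 B e2] by blast
  have "N ((1 - cscale mu (B0 ^ Suc m)) * ((1 - cscale (sigma ^ 4) B0) * (R2 * R1 * z)) - z) \<le> e * N z" for z
  proof -
    let ?u = "(1 - cscale (sigma ^ 4) B0) * (R2 * (R1 * z)) - R1 * z"
    have u: "N ?u \<le> e2 * (D * N z)"
      using order_trans[OF R2(2)[of "R1 * z"] mult_left_mono[OF D(2) less_imp_le[OF e2]]] by simp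
    have "N ((1 - cscale mu (B0 ^ Suc m)) * ?u) \<le> N ?u + cmod mu * N ?u"
      using N_diff[of ?u "cscale mu (B0 ^ Suc m) * ?u"] B[of mu "Suc m" ?u]
      by (simp add: left_diff_distrib del: power_Suc)
    also have "cmod mu * N ?u \<le> 1 * N ?u"
      using mu1 by (intro mult_right_mono) simp_all
    also have "N ?u + 1 * N ?u \<le> 2 * (e2 * (D * N z))"
      using u by simp
    also have "\<dots> \<le> e / 2 * N z"
    proof -
      have "2 * (e2 * D) = e / 2 * (D / (D + 1))"
        using D(1) by (simp add: e2_def field_simps)
      also have "\<dots> \<le> e / 2 * 1"
        using D(1) e by (intro mult_left_mono) simp_all
      finally have "2 * (e2 * D) * N z \<le> e / 2 * N z"
        by (intro mult_right_mono) simp_all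
      then show ?thesis by (simp add: mult.assoc)
    qed
    finally have 1: "N ((1 - cscale mu (B0 ^ Suc m)) * ?u) \<le> e / 2 * N z" by simp
    have "(1 - cscale mu (B0 ^ Suc m)) * ((1 - cscale (sigma ^ 4) B0) * (R2 * R1 * z)) - z
        = (1 - cscale mu (B0 ^ Suc m)) * ?u + ((1 - cscale mu (B0 ^ Suc m)) * (R1 * z) - z)"
      by (simp add: algebra_simps del: power_Suc)
    then have "N ((1 - cscale mu (B0 ^ Suc m)) * ((1 - cscale (sigma ^ 4) B0) * (R2 * R1 * z)) - z)
        \<le> N ((1 - cscale mu (B0 ^ Suc m)) * ?u) + N ((1 - cscale mu (B0 ^ Suc m)) * (R1 * z) - z)"
      by (simp only: N_triangle)
    also have "\<dots> \<le> e / 2 * N z + e / 2 * N z"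
      by (intro add_mono 1 R1)
    finally show ?thesis by simp
  qed
  then show ?thesis
    using A_CP_mult[OF R2(1) R1(1)] by blast
qed


section \<open>Failure of gauge equivalence\<close>

text \<open>The gauge estimate is applied to \<open>gcs * (gas * w)\<close>, which has degree 1
  because \<open>w\<close> has degree -1. After multiplication by \<open>gcs\<close>,
  \<open>gauge_commutator\<close> leaves a term starting with \<open>1 - B0 ^ Suc m\<close>,
  annihilated by \<open>P0\<close>, and a term starting with \<open>gcs\<close>, which
  \<open>P0\<close> does not see. In the constant, \<open>cmod sigma\<close> undoes the factor of
  \<open>dbar\<close>, and \<open>q\<close> is the modulus of \<open>sigma ^ 2\<close>.\<close>

lemma P0_estimate:
  assumes mu: "mu = 1 - sigma ^ (4 * Suc m)" "al * mu = 1"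
    and x: "x \<in> A_CP q" and w: "w \<in> line_module q (- 1)"
    and F1: "F_act q f1 \<approx> F_act q (B0 ^ Suc m)" and F2: "F_act q f2 \<approx> cscale al (F_act q (B0 ^ Suc m))"
    and gauge: "\<And>s. s \<in> line_module q 1 \<Longrightarrow>
      N ((cscale (q powr (-1/2)) (F_act q x) - x * cscale (q powr (-1/2)) (F_act q f1)
        + cscale (q powr (-1/2)) (F_act q f2) * x) * s) \<le> e * N s" and e: "0 \<le> e"
  shows "P0 (x * ((1 - cscale mu (B0 ^ Suc m)) * ((1 - cscale (sigma ^ 4) B0) * w)))
    \<le> cmod sigma / (q * cmod kappa) * (e * N w)"
proof -
  let ?f = "B0 ^ Suc m"
  \<comment> \<open>The factor \<open>gas\<close> completes the trailing \<open>ga\<close> of the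
    commutator identity to \<open>ga * gas\<close>, a polynomial in \<open>B0\<close>.\<close>
  define v where "v = gas * w"
  have v: "v \<in> A_CP q"
    using line_module_mult[OF line_module_generators(3) w] by (simp add: v_def)
  have s: "gcs * v \<in> line_module q 1"
    using line_module_mult[OF line_module_generators(4) v] by simp
  have Nv: "N (gcs * v) \<le> N w"
    unfolding v_def by (rule order_trans[OF N_letter_le N_letter_le])
  define E where "E = F_act q x - x * F_act q ?f + cscale al (F_act q ?f) * x"
  define T where "T = (1 - ?f) * ga * x * gcs - cscale (sigma ^ 2) (gcs * x * (1 - cscale mu ?f) * ga)"
  have K: "gcs * E * gcs \<approx> cscale kappa T"
    unfolding E_def T_def mu(1)
    using x mu A_CP_Kinv[OF x] by (intro gauge_commutator) (simp_all add: A_CP_iff del: power_Suc mult_Suc_right)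
  have "(F_act q x - x * F_act q f1 + F_act q f2 * x) \<approx> E"
    unfolding E_def by (intro suq_cong_add suq_cong_diff suq_cong_mult suq_cong_refl F1 F2)
  then have "cscale (1 / sigma) (F_act q x - x * F_act q f1 + F_act q f2 * x) * (gcs * v) \<approx> cscale (1 / sigma) E * (gcs * v)"
    by (intro suq_cong_mult_right suq_cong_cscale)
  from N_cong[OF this]
  have "N (cscale (1 / sigma) E * (gcs * v)) \<le> e * N (gcs * v)"
    using gauge[OF s] unfolding powr_minus_half by (simp add: cscale_distribs)
  also have "\<dots> \<le> e * N w"
    using Nv e by (rule mult_left_mono)
  finally have "N (E * (gcs * v)) \<le> cmod sigma * (e * N w)"
    by (simp add: N_cscale norm_divide field_simps)
  then have "N (gcs * (E * (gcs * v))) \<le> cmod sigma * (e * N w)"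
    using N_letter_le order_trans by blast
  moreover have "N (gcs * (E * (gcs * v))) = N (cscale kappa T * v)"
    using N_cong[OF suq_cong_mult_right[OF K, of v]] by (simp only: mult.assoc)
  ultimately have T: "cmod kappa * N (T * v) \<le> cmod sigma * (e * N w)"
    by (simp add: N_cscale)
  let ?Z = "x * ((1 - cscale mu ?f) * ((1 - cscale (sigma ^ 4) B0) * w))"
  have "ga * gas \<approx> 1 - cscale (sigma ^ 4) B0"
    unfolding B0_def by (rule suq_cong_addD(1)[OF relations(5)])
  then have "gcs * x * (1 - cscale mu ?f) * (ga * gas) * w \<approx> gcs * x * (1 - cscale mu ?f) * (1 - cscale (sigma ^ 4) B0) * w"
    by (intro suq_cong_mult suq_cong_refl)
  from P0_cong[OF this] have "P0 (gcs * x * (1 - cscale mu ?f) * ga * v) = P0 (gcs * ?Z)"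
    unfolding v_def mult.assoc .
  then have Z: "P0 (gcs * x * (1 - cscale mu ?f) * ga * v) = P0 ?Z"
    by (simp only: P0_gcs)
  have "cmod (sigma ^ 2) = q"
    unfolding of_real_q[symmetric] using q_pos by simp
  then have "q * P0 ?Z = P0 (cscale (sigma ^ 2) (gcs * x * (1 - cscale mu ?f) * ga * v))"
    by (simp only: P0_cscale Z)
  also have "cscale (sigma ^ 2) (gcs * x * (1 - cscale mu ?f) * ga * v) = (1 - ?f) * (ga * x * gcs * v) + - (T * v)"
    by (simp add: T_def algebra_simps del: power_Suc)
  also have "P0 \<dots> \<le> P0 ((1 - ?f) * (ga * x * gcs * v)) + P0 (- (T * v))"
    by (rule P0_triangle)
  also have "\<dots> = P0 (T * v)"
    by (simp only: P0_one_minus_B0_power P0_minus add_0)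
  also have "\<dots> \<le> N (T * v)"
    by (rule P0_le)
  finally have "q * P0 ?Z \<le> N (T * v)" .
  moreover have kappa: "0 < cmod kappa"
    by (simp add: kappa_def)
  ultimately have "cmod kappa * (q * P0 ?Z) \<le> cmod sigma * (e * N w)"
    using T mult_left_mono[of "q * P0 ?Z" "N (T * v)" "cmod kappa"] by linarith
  then show ?thesis
    using kappa q_pos by (simp add: field_simps del: power_Suc)
qed

text \<open>With exact inverses, \<open>w = ((1 - mu f) ga gas)^(-1) x' gc\<close> would give
  \<open>x (1 - mu f) ga gas w = gc\<close>, whose \<open>P0\<close> is positive, whereas
  \<open>P0_estimate\<close> would make it 0. The errors from the gauge equation, from
  \<open>R\<close> and from \<open>x * x'\<close> are each held below a quarter of
  \<open>P0 1\<close>.\<close>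

lemma not_gauge_equivalent:
  fixes m :: nat
  defines "al \<equiv> 1 / (1 - sigma ^ (4 * Suc m))"
  shows "\<not> gauge_equivalent q h n (connection q n (B0 ^ Suc m)) (connection q n (cscale al (B0 ^ Suc m)))"
proof
  let ?f = "B0 ^ Suc m"
  assume "gauge_equivalent q h n (connection q n ?f) (connection q n (cscale al ?f))"
  then obtain f1 f2 g where f: "f1 \<in> A_CP q" "f2 \<in> A_CP q"
      "connection q n ?f = connection q n f1" "connection q n (cscale al ?f) = connection q n f2"
    and g: "invertible_in_domain q h g" "mixed_gauge_eq q h f1 f2 g"
    unfolding gauge_equivalent_def by blast
  define mu where "mu = 1 - sigma ^ (4 * Suc m)"
  have "2 * (2 * Suc m) = 4 * Suc m" by simp
  then have "mu \<noteq> 0"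
    using sigma_power_ne_1[of "2 * Suc m"] by (simp only: mu_def) simp
  then have al: "al * mu = 1"
    by (simp add: al_def mu_def del: mult_Suc_right)
  have F1: "F_act q f1 \<approx> F_act q ?f"
    by (intro connection_eqD[OF f(3)[symmetric]] f A_CP_B0_power)
  have F2: "F_act q f2 \<approx> cscale al (F_act q ?f)"
    using connection_eqD[OF f(4)[symmetric] f(2) line_module_cscale[OF A_CP_B0_power]]
    by (simp only: F_act_cscale)
  obtain C where C: "0 \<le> C" and approx: "\<And>e. 0 < e \<Longrightarrow> \<exists>x\<in>A_CP q. \<exists>x'\<in>A_CP q. p x \<le> C \<and> p x' \<le> C \<and>
      (\<forall>y. N (x * x' * y - y) \<le> e * N y) \<and>
      (\<forall>s\<in>line_module q 1. N ((cscale (q powr (-1/2)) (F_act q x) - x * cscale (q powr (-1/2)) (F_act q f1)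
        + cscale (q powr (-1/2)) (F_act q f2) * x) * s) \<le> e * N s)"
    using gauge_equivalence_approximation[OF g] by blast
  define b where "b = P0 1"
  have b: "0 < b" unfolding b_def by (rule P0_1_pos)
  \<comment> \<open>The error of \<open>R\<close> occurs at \<open>x' * gc\<close>, of norm at most
    \<open>C\<close>, and is then multiplied by \<open>x\<close>, which contributes another
    \<open>C\<close>.\<close>
  define e1 where "e1 = b / (4 * (C * C + 1))"
  have CC: "0 \<le> C * C" using C by simp
  have frac: "t / (t + 1) \<le> 1" if "0 \<le> t" for t :: real
    using that by simp
  have e1: "0 < e1" "C * (e1 * C) \<le> b / 4"
  proof -
    show "0 < e1" unfolding e1_def using b add_nonneg_pos[OF CC zero_less_one] by (intro divide_pos_pos) simp_all
    have "C * (e1 * C) = b / 4 * ((C * C) / (C * C + 1))"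
      by (simp add: e1_def)
    also have "\<dots> \<le> b / 4 * 1"
      using b by (intro mult_left_mono frac CC) simp
    finally show "C * (e1 * C) \<le> b / 4" by simp
  qed
  obtain R where R: "R \<in> A_CP q"
    and rR: "\<And>z. N ((1 - cscale mu ?f) * ((1 - cscale (sigma ^ 4) B0) * (R * z)) - z) \<le> e1 * N z"
    using approximate_inverse_product[OF mu_def e1(1)] by blast
  obtain D where D: "0 \<le> D" "\<And>z. N (R * z) \<le> D * N z"
    using N_mult_bounded by blast
  define k where "k = cmod sigma / (q * cmod kappa)"
  have k: "0 \<le> k" using q_pos by (simp add: k_def)
  \<comment> \<open>Chosen after \<open>R\<close>, since the gauge defect is weighed by the norm of
    \<open>w\<close>, at most \<open>D * C\<close>. The summand 1 in the denominator also gives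
    \<open>e \<le> b / 4\<close>, for the error of \<open>x * x'\<close>.\<close>
  define e where "e = b / (4 * (k * (D * C) + 1))"
  have kDC: "0 \<le> k * (D * C)" using k D(1) C by simp
  have e: "0 < e" "e \<le> b / 4" "k * (e * (D * C)) \<le> b / 4"
  proof -
    show "0 < e" unfolding e_def using b add_nonneg_pos[OF kDC zero_less_one] by (intro divide_pos_pos) simp_all
    show "e \<le> b / 4" unfolding e_def using b kDC by (intro divide_left_mono) simp_all
    have "k * (e * (D * C)) = b / 4 * (k * (D * C) / (k * (D * C) + 1))"
      by (simp add: e_def)
    also have "\<dots> \<le> b / 4 * 1"
      using b by (intro mult_left_mono frac kDC) simp
    finally show "k * (e * (D * C)) \<le> b / 4" by simp
  qed
  obtain x x' where x: "x \<in> A_CP q" "p x \<le> C" and x': "x' \<in> A_CP q" "p x' \<le> C"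
    and xx': "\<And>y. N (x * x' * y - y) \<le> e * N y"
    and gauge: "\<And>s. s \<in> line_module q 1 \<Longrightarrow>
      N ((cscale (q powr (-1/2)) (F_act q x) - x * cscale (q powr (-1/2)) (F_act q f1)
        + cscale (q powr (-1/2)) (F_act q f2) * x) * s) \<le> e * N s"
    using approx[OF e(1)] by blast
  have Nc: "N gc \<le> 1"
  proof -
    have "N 1 = 1" by (simp add: l2_norm_def)
    then show ?thesis using N_letter_le[of LC 1] by simp
  qed
  \<comment> \<open>\<open>gc\<close> supplies the degree -1 that \<open>P0_estimate\<close>
    requires, and \<open>P0\<close> takes the same value at \<open>gc\<close> as at 1.\<close>
  define w where "w = R * (x' * gc)"
  have w: "w \<in> line_module q (- 1)"
    using line_module_mult[OF R line_module_mult[OF x'(1) line_module_generators(2)]] by (simp add: w_def)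
  have x'c: "N (x' * gc) \<le> C"
    using N_mult_le_mult[OF x'(2) Nc] by simp
  have Nw: "N w \<le> D * C"
    unfolding w_def by (rule order_trans[OF D(2) mult_left_mono[OF x'c D(1)]])
  let ?r = "(1 - cscale mu ?f) * ((1 - cscale (sigma ^ 4) B0) * w)"
  have "P0 (x * ?r) \<le> k * (e * N w)"
    unfolding k_def by (rule P0_estimate[OF mu_def al x(1) w F1 F2 gauge less_imp_le[OF e(1)]])
  also have "\<dots> \<le> k * (e * (D * C))"
    using k e(1) Nw by (intro mult_left_mono) simp_all
  finally have 1: "P0 (x * ?r) \<le> b / 4"
    using e(3) by linarith
  have "N (?r - x' * gc) \<le> e1 * C"
    unfolding w_def by (rule order_trans[OF rR mult_left_mono[OF x'c less_imp_le[OF e1(1)]]])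
  from N_mult_le_mult[OF x(2) this] have 2: "N (x * (?r - x' * gc)) \<le> b / 4"
    using e1(2) by linarith
  have 3: "N (x * x' * gc - gc) \<le> b / 4"
    using order_trans[OF xx'[of gc] mult_left_mono[OF Nc less_imp_le[OF e(1)]]] e(2) by simp
  have "b = P0 gc"
    using P0_gc[of 1] by (simp add: b_def)
  also have "gc = x * ?r + (- (x * (?r - x' * gc)) + - (x * x' * gc - gc))"
    by (simp add: algebra_simps del: power_Suc)
  also have "P0 \<dots> \<le> P0 (x * ?r) + (P0 (- (x * (?r - x' * gc))) + P0 (- (x * x' * gc - gc)))"
    by (intro order_trans[OF P0_triangle] add_left_mono P0_triangle)
  also have "\<dots> \<le> b / 4 + (b / 4 + b / 4)"
    unfolding P0_minus using 1 2 3 P0_le[of "x * (?r - x' * gc)"] P0_le[of "x * x' * gc - gc"] by linarith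
  finally show False using b by simp
qed

text \<open>A scalar value would have to be 1, because \<open>P0\<close> annihilates
  \<open>1 - B0 ^ Suc m\<close> but not 1; the Haar state rules out the value 1.\<close>

lemma nonconstant_B0_power: "nonconstant q (B0 ^ Suc m)"
  unfolding nonconstant_def suq_class_eq_iff
proof (intro allI notI)
  fix z assume z: "B0 ^ Suc m \<approx> cscale z 1"
  have "P0 ((1 - B0 ^ Suc m) * 1) = P0 ((1 - cscale z 1) * 1)"
    by (intro P0_cong suq_cong_mult_right suq_cong_diff suq_cong_refl z)
  then have "P0 ((1 - cscale z 1) * 1) = 0"
    by (simp only: P0_one_minus_B0_power)
  moreover have "(1 - cscale z 1) * 1 = cscale (1 - z) (1 :: free)"
    by (simp add: cscale_diff_left)
  ultimately have "cmod (1 - z) * P0 1 = 0"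
    by (simp only: P0_cscale)
  then have "z = 1"
    using P0_1_pos by simp
  then have "h (B0 ^ Suc m) = 1"
    using h_cong[OF z] by (simp only: cscale_one h_1)
  then have "(1 - q\<^sup>2) / (1 - q ^ (2 * Suc m + 2)) = 1"
    unfolding h_B0_power by (simp only: of_real_eq_1_iff)
  then have "q\<^sup>2 = q\<^sup>2 * q ^ (2 * Suc m)"
    by (simp add: divide_eq_eq split: if_splits) (simp add: power_add power2_eq_square)
  then have "q ^ (2 * Suc m) = 1"
    using q_pos by simp
  then show False
    using q_power_less_1[of "2 * Suc m"] by simp
qed

text \<open>The Haar state already separates the powers, as \<open>q ^ (2 * m + 2)\<close> can be
  recovered from \<open>h (B0 ^ m)\<close>.\<close>

lemma inj_B0_power_class: "inj (\<lambda>m. suq_class q (B0 ^ Suc m))"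
proof (rule injI)
  fix i j assume "suq_class q (B0 ^ Suc i) = suq_class q (B0 ^ Suc j)"
  then have "h (B0 ^ Suc i) = h (B0 ^ Suc j)"
    by (intro h_cong) (simp only: suq_class_eq_iff)
  then have eq: "(1 - q\<^sup>2) / (1 - q ^ (2 * Suc i + 2)) = (1 - q\<^sup>2) / (1 - q ^ (2 * Suc j + 2))"
    unfolding h_B0_power by (simp only: of_real_eq_iff)
  have "1 - q\<^sup>2 \<noteq> 0" using q_power_less_1[of 2] by simp
  with eq have "1 - q ^ (2 * Suc i + 2) = 1 - q ^ (2 * Suc j + 2)"
    by (simp only: divide_cancel_left) simp
  then have "q ^ (2 * Suc i + 2) = q ^ (2 * Suc j + 2)"
    by linarith
  then have "2 * Suc i + 2 = 2 * Suc j + 2"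
    using q_pos q_less_1 by (intro power_inject_exp'[THEN iffD1, of q]) simp_all
  then show "i = j" by simp
qed

lemma B0_power_in_Pol_B0: "B0 ^ m \<in> Pol_B0"
proof -
  have "B0 ^ m = (\<Sum>i\<le>m. cscale (if i = m then 1 else 0) (B0 ^ i))"
    by (subst sum.remove[of _ m]) (auto intro!: sum.neutral)
  then show ?thesis
    unfolding Pol_B0_def by (intro CollectI exI[of _ m] exI[of _ "\<lambda>i. if i = m then 1 else 0"]) simp
qed

end

theorem lemma3p3:
  fixes q :: real and h :: "free \<Rightarrow> complex" and n :: int
  assumes "0 < q" and "q < 1"
    and "haar_state q h"
  shows "infinite {suq_class q f | f. f \<in> Pol_B0 \<and> nonconstant q f \<and>
           (\<exists>\<alpha>. \<alpha> \<noteq> 0 \<and>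
              \<not> gauge_equivalent q h n (connection q n f) (connection q n (cscale \<alpha> f)))}"
    (is "infinite ?S")
proof
  interpret haar_su2 q h
    using assms by unfold_locales
  assume "finite ?S"
  have "suq_class q (B0 ^ Suc m) \<in> ?S" for m
  proof -
    have "2 * (2 * Suc m) = 4 * Suc m" by simp
    then have "sigma ^ (4 * Suc m) \<noteq> 1"
      using sigma_power_ne_1[of "2 * Suc m"] by (simp only:) simp
    \<comment> \<open>The witness for \<alpha>, which varies with \<open>m\<close>.\<close>
    then have "1 / (1 - sigma ^ (4 * Suc m)) \<noteq> 0"
      by (simp del: mult_Suc_right)
    then show ?thesis
      using B0_power_in_Pol_B0 nonconstant_B0_power not_gauge_equivalent by blast
  qed
  then have "range (\<lambda>m. suq_class q (B0 ^ Suc m)) \<subseteq> ?S"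
    by blast
  with \<open>finite ?S\<close> have "finite (range (\<lambda>m. suq_class q (B0 ^ Suc m)))"
    by (rule finite_subset[rotated])
  with inj_B0_power_class show False
    using finite_imageD infinite_UNIV_nat by blast
qed

end
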